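(* Let $A_m(x;q)$, $B_m(x;q)$ ($m\in\mathbb Z$, $|q|\ne1$) be the descendant holomorphic blocks of the $\mathbf 4_1$ knot defined in the context. (a) $A_m(x;q)$ and $B_m(x;q)$ are $q$-holonomic functions in the variables $(m,x)$ with common annihilating ideal $$\mathcal I_{\mathbf 4_1}=\big\langle\, q^mx^2+(-q^m+q^{1+2m}x^2)S_m+x^3S_x,\ \ (1-x^{-1}S_m)(1-x^{-2}S_m)+q^{1+m}S_m\,\big\rangle,$$ where $S_m$ shifts $m$ to $m+1$ and $S_x$ shifts $x$ to $qx$. The ideal $\mathcal I_{\mathbf 4_1}$ has rank $2$ and the two functions form a basis of solutions of the corresponding system of linear equations. (b) As functions of the integer $m$, $A_m(x;q)$ and $B_m(x;q)$ form a basis of solutions of the linear $q$-difference equation $\widehat B_{\mathbf 4_1}(S_m,x,q^m,q)f_m(x;q)=0$ for $|q|\neq1$, where $\widehat B_{\mathbf 4_1}(S_m,x,q^m,q)=(1-x^{-1}S_m)(1-x^{-2}S_m)+q^{1+m}S_m$. (c) The Wronskian $W_m(x;q)=\begin{pmatrix} A_m(x;q) & B_m(x;q) \\ A_{m+1}(x;q) & B_{m+1}(x;q) \end{pmatrix}$ satisfies $\det W_m(x;q)=x^{3m+3}$ for all $m\in\mathbb Z$. (d) It satisfies the orthogonality relation $$W_{-1}(x;q)\begin{pmatrix} 1 & 0 \\ 0 & -1 \end{pmatrix}W_{-1}(x;q^{-1})^T=\begin{pmatrix} x^{-2}+x^{-1}-1 & 1 \\ 1 & 0 \end{pmatrix},$$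 and it follows that for all integers $m,\ell$, $\ W_m(x;q)\begin{pmatrix} 1 & 0 \\ 0 & -1 \end{pmatrix}W_\ell(x;q^{-1})^T\in \mathrm{GL}(2,\mathbb Z[q^{\pm1},x^{\pm1}])$. (e) As functions of $x$, $A_m(x;q)$ and $B_m(x;q)$ form a basis of solutions of the linear $q$-difference equation $\sum_{j=0}^2C_j(x,q^m,q)S_x^j\,f_m(x;q)=0$, where $$C_0=q^{2+3m}x^2(-1+q^{3+m}x^2),$$ $$C_1=-q^m(-1+q^{2+m}x^2)(1-qx-q^{1+m}x^2-q^{3+m}x^2-q^{3+m}x^3+q^{4+2m}x^4),$$ $$C_2=q^2x^2(-1+q^{1+m}x^2).$$ (f) The Wronskian $\mathcal W_m(x;q)=\begin{pmatrix} A_m(x;q) & B_m(x;q) \\ A_m(qx;q) & B_m(qx;q) \end{pmatrix}$ ($|q|\ne1$) satisfies $\det\mathcal W_m(x;q)=q^mx^{3m}(1-q^{m+1}x^2)$ for all $m\in\mathbb Z$.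
   Context: For $|q|<1$: $(x;q)_\infty=\prod_{j\ge0}(1-q^jx)$, $(x;q)_n=\prod_{j=0}^{n-1}(1-q^jx)$, $\theta(x;q)=(-q^{1/2}x;q)_\infty(-q^{1/2}x^{-1};q)_\infty$, and $\theta(x;q^{-1}):=\theta(x;q)^{-1}$. For $|q|\ne1$ and $x\in\mathbb C^*$, $$A_m(x;q)=\theta(-q^{1/2}x;q)^{-2}x^{2m}J(q^mx^2,x;q),\qquad B_m(x;q)=\theta(-q^{-1/2}x;q)\,x^mJ(q^mx,x^{-1};q),$$ where, for $|q|<1$, $$J(x,y;q)=(qy;q)_\infty\sum_{n\ge0}(-1)^n\frac{q^{n(n+1)/2}x^n}{(q;q)_n(qy;q)_n},\qquad J(x,y;q^{-1})=\frac1{(y;q)_\infty}\sum_{n\ge0}(-1)^n\frac{q^{n(n+1)/2}x^ny^{-n}}{(q;q)_n(qy^{-1};q)_n}.$$ (These are meromorphic in $x$; identities are identities of meromorphic functions.) Annihilating ideals are left ideals in the algebra of $q$-difference operators in $S_x,S_m$ with coefficients rational functions in $x$, $q^m$, $q$ (written on the left), with $S_xx=qxS_x$, $S_mq^m=q\,q^mS_m$, and all other pairs of generators commuting; the annihilating ideal of a function of $(m,x)$ is the set of all operators that kill it. The rank of an ideal is the dimension of the quotient of the algebra by the ideal over the field of rational functions in $x,q^m,q$. A function is $q$-holonomic in the sense of Zeilberger. *)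

theory Defs
  imports
    "HOL-Complex_Analysis.Complex_Analysis"
    "HOL-Computational_Algebra.Fraction_Field"
    "HOL-Library.Poly_Mapping"
    "HOL-Library.Landau_Symbols"
begin

definition admissible :: "complex \<Rightarrow> bool" where
  "admissible q \<longleftrightarrow> q \<noteq> 0 \<and> norm q \<noteq> 1"

definition qpoch_inf :: "complex \<Rightarrow> complex \<Rightarrow> complex" where
  "qpoch_inf x q = prodinf (\<lambda>j. 1 - q ^ j * x)"

definition qpoch :: "complex \<Rightarrow> complex \<Rightarrow> nat \<Rightarrow> complex" where
  "qpoch x q n = (\<Prod>j<n. 1 - q ^ j * x)"

text \<open>
  \<open>theta h x\<close> is $\theta(x;q)$ for $q = h^2$; the argument \<open>h\<close> is the chosen square root
  $q^{1/2}$, and the square root of $q^{-1}$ is taken to be $1/q^{1/2}$. The values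
  $\theta(-q^{\pm 1/2}x;q)$ used below do not depend on the choice of the root.
\<close>

definition theta :: "complex \<Rightarrow> complex \<Rightarrow> complex" where
  "theta h x =
     (let \<theta> = (\<lambda>h. qpoch_inf (- h * x) (h\<^sup>2) * qpoch_inf (- h / x) (h\<^sup>2))
      in if norm h < 1 then \<theta> h else inverse (\<theta> (inverse h)))"

definition J :: "complex \<Rightarrow> complex \<Rightarrow> complex \<Rightarrow> complex" where
  "J x y q =
     (if norm q < 1
      then qpoch_inf (q * y) q *
             suminf (\<lambda>n. (-1) ^ n *
                (q ^ (n * (n + 1) div 2) * x ^ n / (qpoch q q n * qpoch (q * y) q n)))
      else let p = inverse q in
           1 / qpoch_inf y p *
             suminf (\<lambda>n. (-1) ^ n *
                (p ^ (n * (n + 1) div 2) * x ^ n * inverse y ^ n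
                   / (qpoch p p n * qpoch (p * inverse y) p n))))"

text \<open>
  The formulas are meaningful for \<open>x\<close> outside \<open>{0} \<union> {q powi k | k. True}\<close>. At the points
  \<open>q powi k\<close> the values are artefacts of division by zero; all identities below are
  identities of meromorphic functions on the punctured plane, i.e. they are asserted
  off a sparse subset of \<open>- {0}\<close>.
\<close>

definition block_A :: "complex \<Rightarrow> int \<Rightarrow> complex \<Rightarrow> complex" where
  "block_A q m x =
     theta (csqrt q) (- csqrt q * x) powi (-2) * x powi (2 * m) * J (q powi m * x\<^sup>2) x q"

definition block_B :: "complex \<Rightarrow> int \<Rightarrow> complex \<Rightarrow> complex" where
  "block_B q m x =
     theta (csqrt q) (- inverse (csqrt q) * x) * x powi m * J (q powi m * x) (inverse x) q"

definition wronskian_m :: "complex \<Rightarrow> int \<Rightarrow> complex \<Rightarrow> complex^2^2" where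
  "wronskian_m q m x =
     vector [vector [block_A q m x, block_B q m x],
             vector [block_A q (m + 1) x, block_B q (m + 1) x]]"

definition wronskian_x :: "complex \<Rightarrow> int \<Rightarrow> complex \<Rightarrow> complex^2^2" where
  "wronskian_x q m x =
     vector [vector [block_A q m x, block_B q m x],
             vector [block_A q m (q * x), block_B q m (q * x)]]"

text \<open>
  Polynomials in three independent indeterminates with complex coefficients: the outermost
  variable is \<open>x\<close>, the middle one \<open>M\<close> (standing for $q^m$), the innermost one \<open>q\<close>.
\<close>

type_synonym poly3 = "complex poly poly poly"
type_synonym rf = "poly3 fract"

definition eval3 :: "poly3 \<Rightarrow> complex \<Rightarrow> complex \<Rightarrow> complex \<Rightarrow> complex" where
  "eval3 p x M q = poly (poly (poly p [:[:x:]:]) [:M:]) q"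

definition q_rf :: rf where "q_rf = Fract [:[:[:0, 1:]:]:] 1"
definition M_rf :: rf where "M_rf = Fract [:[:0, 1:]:] 1"
definition x_rf :: rf where "x_rf = Fract [:0, 1:] 1"

text \<open>The value is unspecified where the rational function has no representation with
  nonvanishing denominator.\<close>

definition rf_eval :: "rf \<Rightarrow> complex \<Rightarrow> complex \<Rightarrow> complex \<Rightarrow> complex" where
  "rf_eval r x M q =
     (THE v. \<exists>a b. r = Fract a b \<and> eval3 b x M q \<noteq> 0 \<and> v = eval3 a x M q / eval3 b x M q)"

text \<open>\<open>poly3_shift i j\<close> is the substitution $x \mapsto q^i x$, $M \mapsto q^j M$.\<close>

definition poly3_shift :: "nat \<Rightarrow> nat \<Rightarrow> poly3 \<Rightarrow> poly3" where
  "poly3_shift i j p =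
     pcompose (map_poly (\<lambda>c. pcompose c [:0, [:0, 1:] ^ j:]) p) [:0, [:[:0, 1:] ^ i:]:]"

lemma map_poly_mult_hom:
  fixes f :: "'a::comm_ring_1 \<Rightarrow> 'b::comm_ring_1"
  assumes "f 0 = 0" "\<And>a b. f (a + b) = f a + f b" "\<And>a b. f (a * b) = f a * f b"
  shows "map_poly f (p * q) = map_poly f p * map_poly f q"
proof (rule poly_eqI)
  fix n
  have sum: "f (sum g A) = (\<Sum>a\<in>A. f (g a))" if "finite A" for g and A :: "nat set"
    using that by (induction A rule: finite_induct) (auto simp: assms)
  show "coeff (map_poly f (p * q)) n = coeff (map_poly f p * map_poly f q) n"
    by (simp add: coeff_map_poly assms coeff_mult sum)
qed

lemma poly3_shift_mult: "poly3_shift i j (a * b) = poly3_shift i j a * poly3_shift i j b"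
  unfolding poly3_shift_def
  by (subst map_poly_mult_hom) (auto simp: pcompose_add pcompose_mult)

lemma poly3_shift_eq_0_iff: "poly3_shift i j a = 0 \<longleftrightarrow> a = 0"
proof
  assume "poly3_shift i j a = 0"
  then have *: "map_poly (\<lambda>c. pcompose c [:0, [:0, 1:] ^ j:]) a = 0"
    unfolding poly3_shift_def by (rule pcompose_eq_0) auto
  have "pcompose (coeff a n) [:0, [:0, 1:] ^ j:] = 0" for n
    using arg_cong[OF *, of "\<lambda>p. coeff p n"] by (simp add: coeff_map_poly)
  then have "coeff a n = 0" for n
    by (rule pcompose_eq_0) auto
  then show "a = 0"
    by (simp add: poly_eq_iff)
qed (simp add: poly3_shift_def)

lift_definition rf_shift :: "nat \<Rightarrow> nat \<Rightarrow> rf \<Rightarrow> rf" is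
  "\<lambda>i j (a, b). (poly3_shift i j a, poly3_shift i j b)"
  by (auto simp: fractrel_def poly3_shift_eq_0_iff simp flip: poly3_shift_mult)

lemma rf_shift_Fract:
  "b \<noteq> 0 \<Longrightarrow> rf_shift i j (Fract a b) = Fract (poly3_shift i j a) (poly3_shift i j b)"
  by transfer (auto simp: poly3_shift_eq_0_iff)

lemma rf_shift_x: "rf_shift i j x_rf = q_rf ^ i * x_rf"
  and rf_shift_M: "rf_shift i j M_rf = q_rf ^ j * M_rf"
  and rf_shift_q: "rf_shift i j q_rf = q_rf"
proof -
  have pow: "Fract p 1 ^ n = Fract (p ^ n) (1 :: poly3)" for p n
    by (induction n) (auto simp: One_fract_def)
  have const: "[:p:] ^ n = [:p ^ n:]" for p :: "'a :: comm_ring_1" and n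
    by (induction n) auto
  have one: "poly3_shift i j 1 = 1"
    by (simp add: poly3_shift_def map_poly_pCons one_pCons)
  show "rf_shift i j x_rf = q_rf ^ i * x_rf" "rf_shift i j M_rf = q_rf ^ j * M_rf"
    "rf_shift i j q_rf = q_rf"
    unfolding x_rf_def M_rf_def q_rf_def
    by (simp_all add: rf_shift_Fract one pow const)
       (simp_all add: poly3_shift_def map_poly_pCons pcompose_pCons one_pCons)
qed

lemma rf_shift_1 [simp]: "rf_shift i j 1 = 1"
  by (simp add: One_fract_def rf_shift_Fract poly3_shift_def map_poly_pCons one_pCons)

lemma rf_shift_0 [simp]: "rf_shift i j 0 = 0"
  by (simp add: Zero_fract_def rf_shift_Fract poly3_shift_def map_poly_pCons one_pCons)

text \<open>
  An operator $\sum a_{ij}\, S_x^i S_m^j$ is the finitely supported map \<open>(i, j) \<mapsto> a\<^sub>i\<^sub>j\<close>.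
  Its product is \<open>\<star>\<close>, determined by $S_x^i S_m^j\, a(x,M,q) = a(q^i x, q^j M, q)\, S_x^i S_m^j$.
  (The product \<open>*\<close> that the library provides on this type is the commutative convolution and
  is not used.)
\<close>

type_synonym qop = "(nat \<times> nat) \<Rightarrow>\<^sub>0 rf"

definition op_mult :: "qop \<Rightarrow> qop \<Rightarrow> qop" (infixl \<open>\<star>\<close> 70) where
  "P \<star> Q =
     (\<Sum>(i, j)\<in>Poly_Mapping.keys P. \<Sum>(k, l)\<in>Poly_Mapping.keys Q.
        Poly_Mapping.single (i + k, j + l)
          (Poly_Mapping.lookup P (i, j) * rf_shift i j (Poly_Mapping.lookup Q (k, l))))"

definition coeff_op :: "rf \<Rightarrow> qop" where "coeff_op r = Poly_Mapping.single (0, 0) r"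
definition S_x :: qop where "S_x = Poly_Mapping.single (1, 0) 1"
definition S_m :: qop where "S_m = Poly_Mapping.single (0, 1) 1"

lemma op_mult_single:
  "Poly_Mapping.single (i, j) a \<star> Poly_Mapping.single (k, l) b =
     Poly_Mapping.single (i + k, j + l) (a * rf_shift i j b)"
  by (cases "a = 0"; cases "b = 0") (simp_all add: op_mult_def)

lemma S_x_commute: "S_x \<star> coeff_op x_rf = coeff_op (q_rf * x_rf) \<star> S_x"
  and S_m_commute: "S_m \<star> coeff_op M_rf = coeff_op (q_rf * M_rf) \<star> S_m"
  and S_x_M_commute: "S_x \<star> coeff_op M_rf = coeff_op M_rf \<star> S_x"
  and S_m_x_commute: "S_m \<star> coeff_op x_rf = coeff_op x_rf \<star> S_m"
  and S_x_S_m_commute: "S_x \<star> S_m = S_m \<star> S_x"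
  by (simp_all add: S_x_def S_m_def coeff_op_def op_mult_single rf_shift_x rf_shift_M)

inductive_set left_ideal :: "qop set \<Rightarrow> qop set" for G :: "qop set" where
  zero: "0 \<in> left_ideal G"
| add: "P \<in> left_ideal G \<Longrightarrow> Q \<in> left_ideal G \<Longrightarrow> P + Q \<in> left_ideal G"
| mult: "g \<in> G \<Longrightarrow> P \<star> g \<in> left_ideal G"

text \<open>\<open>has_rank I n\<close>: the classes of \<open>n\<close> suitable operators form a basis of the quotient by
  \<open>I\<close>, as a left vector space over the field of rational functions.\<close>

definition has_rank :: "qop set \<Rightarrow> nat \<Rightarrow> bool" where
  "has_rank I n \<longleftrightarrow>
     (\<exists>B. finite B \<and> card B = n \<and>
        (\<forall>P. \<exists>!c :: qop \<Rightarrow> rf. (\<forall>b. b \<notin> B \<longrightarrow> c b = 0) \<and> P - (\<Sum>b\<in>B. coeff_op (c b) \<star> b) \<in> I))"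

definition apply_op :: "qop \<Rightarrow> complex \<Rightarrow> (int \<Rightarrow> complex \<Rightarrow> complex) \<Rightarrow> int \<Rightarrow> complex \<Rightarrow> complex" where
  "apply_op P q f m x =
     (\<Sum>(i, j)\<in>Poly_Mapping.keys P.
        rf_eval (Poly_Mapping.lookup P (i, j)) x (q powi m) q * f (m + int j) (q ^ i * x))"

text \<open>
  The coefficients may have denominators, and these may vanish identically in \<open>x\<close> for
  particular \<open>m\<close> and \<open>q\<close> (e.g. $1/(q^m - q^3)$). So an operator kills a function if it
  does so wherever some fixed nonzero polynomial in $x, q^m, q$ does not vanish. This is what
  makes the annihilator a left ideal.
\<close>

definition annihilator :: "(complex \<Rightarrow> int \<Rightarrow> complex \<Rightarrow> complex) \<Rightarrow> qop set" where
  "annihilator f =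
     {P. \<exists>D :: poly3. D \<noteq> 0 \<and>
           (\<forall>q m. admissible q \<longrightarrow>
              (\<forall>\<^sub>\<approx>x\<in>-{0}. eval3 D x (q powi m) q \<noteq> 0 \<longrightarrow> apply_op P q (f q) m x = 0))}"

text \<open>
  The $q$-Weyl algebra in $x, q^m, S_x, S_m$ over the field of rational functions in \<open>q\<close> is
  filtered by total degree in the four generators. \<open>f\<close> is $q$-holonomic if it is zero or if the
  cyclic module generated by \<open>f\<close> has Hilbert dimension 2, the number of variables $(m, x)$.
  The quadruple \<open>(a, b, c, d)\<close> encodes the monomial $x^a (q^m)^b S_x^c S_m^d$. Linear
  independence over rational functions in \<open>q\<close> is tested, after clearing denominators,
  with polynomial coefficients. The Hilbert function, the dimension of the span of the
  monomials of degree at most \<open>n\<close> applied to \<open>f\<close>, is a polynomial in \<open>n\<close> for large \<open>n\<close>;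
  the growth condition says that its degree is 2.
\<close>

definition weyl_independent ::
    "(complex \<Rightarrow> int \<Rightarrow> complex \<Rightarrow> complex) \<Rightarrow> (nat \<times> nat \<times> nat \<times> nat) set \<Rightarrow> bool" where
  "weyl_independent f T \<longleftrightarrow>
     (\<forall>u :: nat \<times> nat \<times> nat \<times> nat \<Rightarrow> complex poly.
        (\<forall>q m. admissible q \<longrightarrow>
           (\<forall>\<^sub>\<approx>x\<in>-{0}. (\<Sum>(a, b, c, d)\<in>T. poly (u (a, b, c, d)) q * x ^ a * (q powi m) ^ b *
                           f q (m + int d) (q ^ c * x)) = 0))
        \<longrightarrow> (\<forall>t\<in>T. u t = 0))"

definition hilbert_fun :: "(complex \<Rightarrow> int \<Rightarrow> complex \<Rightarrow> complex) \<Rightarrow> nat \<Rightarrow> nat" where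
  "hilbert_fun f n =
     Max {card T |T. T \<subseteq> {(a, b, c, d). a + b + c + d \<le> n} \<and> weyl_independent f T}"

definition q_holonomic :: "(complex \<Rightarrow> int \<Rightarrow> complex \<Rightarrow> complex) \<Rightarrow> bool" where
  "q_holonomic f \<longleftrightarrow>
     (\<forall>q m. admissible q \<longrightarrow> (\<forall>\<^sub>\<approx>x\<in>-{0}. f q m x = 0)) \<or>
     (\<lambda>n. real (hilbert_fun f n)) \<in> \<Theta>(\<lambda>n. real n ^ 2)"

definition mero_family :: "(int \<Rightarrow> complex \<Rightarrow> complex) \<Rightarrow> bool" where
  "mero_family f \<longleftrightarrow> (\<forall>m. f m meromorphic_on -{0})"

definition is_solution :: "complex \<Rightarrow> qop set \<Rightarrow> (int \<Rightarrow> complex \<Rightarrow> complex) \<Rightarrow> bool" where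
  "is_solution q G f \<longleftrightarrow>
     mero_family f \<and> (\<forall>P\<in>G. \<forall>m. \<forall>\<^sub>\<approx>x\<in>-{0}. apply_op P q f m x = 0)"

text \<open>
  The scalars for the solution space of a system in which only the shifts
  $S_x^i S_m^j$, \<open>(i, j) \<in> S\<close>, occur are the meromorphic functions invariant under these
  shifts: \<open>S = {(0, 1)}\<close> gives functions of \<open>x\<close> only, \<open>S = {(1, 0)}\<close> gives functions that are
  $q$-periodic in \<open>x\<close>, for every \<open>m\<close> separately.
\<close>

definition is_scalar :: "complex \<Rightarrow> (nat \<times> nat) set \<Rightarrow> (int \<Rightarrow> complex \<Rightarrow> complex) \<Rightarrow> bool" where
  "is_scalar q S c \<longleftrightarrow>
     mero_family c \<and> (\<forall>(i, j)\<in>S. \<forall>m. \<forall>\<^sub>\<approx>x\<in>-{0}. c (m + int j) (q ^ i * x) = c m x)"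

definition basis_of_solutions ::
    "complex \<Rightarrow> (nat \<times> nat) set \<Rightarrow> qop set \<Rightarrow>
       (int \<Rightarrow> complex \<Rightarrow> complex) \<Rightarrow> (int \<Rightarrow> complex \<Rightarrow> complex) \<Rightarrow> bool" where
  "basis_of_solutions q S G f g \<longleftrightarrow>
     is_solution q G f \<and> is_solution q G g \<and>
     (\<forall>h. is_solution q G h \<longrightarrow>
        (\<exists>c d. is_scalar q S c \<and> is_scalar q S d \<and>
           (\<forall>m. \<forall>\<^sub>\<approx>x\<in>-{0}. h m x = c m x * f m x + d m x * g m x))) \<and>
     (\<forall>c d. is_scalar q S c \<and> is_scalar q S d \<and>
        (\<forall>m. \<forall>\<^sub>\<approx>x\<in>-{0}. c m x * f m x + d m x * g m x = 0) \<longrightarrow>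
        (\<forall>m. \<forall>\<^sub>\<approx>x\<in>-{0}. c m x = 0 \<and> d m x = 0))"

definition first_op :: qop where
  "first_op =
     coeff_op (M_rf * x_rf ^ 2) + coeff_op (- M_rf + q_rf * M_rf ^ 2 * x_rf ^ 2) \<star> S_m
       + coeff_op (x_rf ^ 3) \<star> S_x"

definition B_hat :: qop where
  "B_hat =
     (1 - coeff_op (inverse x_rf) \<star> S_m) \<star> (1 - coeff_op (inverse (x_rf ^ 2)) \<star> S_m)
       + coeff_op (q_rf * M_rf) \<star> S_m"

definition ideal_41 :: "qop set" where
  "ideal_41 = left_ideal {first_op, B_hat}"

definition C0 :: rf where
  "C0 = q_rf ^ 2 * M_rf ^ 3 * x_rf ^ 2 * (- 1 + q_rf ^ 3 * M_rf * x_rf ^ 2)"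

definition C1 :: rf where
  "C1 = - M_rf * (- 1 + q_rf ^ 2 * M_rf * x_rf ^ 2) *
          (1 - q_rf * x_rf - q_rf * M_rf * x_rf ^ 2 - q_rf ^ 3 * M_rf * x_rf ^ 2
             - q_rf ^ 3 * M_rf * x_rf ^ 3 + q_rf ^ 4 * M_rf ^ 2 * x_rf ^ 4)"

definition C2 :: rf where
  "C2 = q_rf ^ 2 * x_rf ^ 2 * (- 1 + q_rf * M_rf * x_rf ^ 2)"

definition A_hat :: qop where
  "A_hat = coeff_op C0 + coeff_op C1 \<star> S_x + coeff_op C2 \<star> S_x \<star> S_x"

text \<open>The group ring of $\mathbb{Z}^2$; \<open>(i, j)\<close> stands for $q^i x^j$. Here the library
  product (convolution) is the right one.\<close>

type_synonym laurent = "(int \<times> int) \<Rightarrow>\<^sub>0 int"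

definition laurent_eval :: "laurent \<Rightarrow> complex \<Rightarrow> complex \<Rightarrow> complex" where
  "laurent_eval p q x =
     (\<Sum>(i, j)\<in>Poly_Mapping.keys p. of_int (Poly_Mapping.lookup p (i, j)) * q powi i * x powi j)"

definition signature_mat :: "complex^2^2" where
  "signature_mat = vector [vector [1, 0], vector [0, -1]]"

end

theory Submission
  imports
    Defs
    "HOL-Computational_Algebra.Polynomial_Factorial"
    "HOL-Computational_Algebra.Field_as_Ring"
begin

text \<open>
  For $|q| < 1$ both blocks are an explicit factor times the entire function
  $H(u,y) = \sum_n (-1)^n q^{n(n+1)/2} u^n (q^{n+1}y;q)_\infty / (q;q)_n$, and the contiguous
  relations of $H$ give the first operator of the ideal and the recurrence
  $f_{m+2} = (x^2 + x - q^{m+1}x^3) f_{m+1} - x^3 f_m$. The recurrence determines the Casorati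
  determinant up to a constant, which is found by letting $m \to \infty$. For $|q| > 1$
  everything follows from $A_m(x;q^{-1}) = x^{3m} B_{-m}(x;q)$ and
  $B_m(x;q^{-1}) = x^{3m} A_{-m}(x;q)$, which also give the orthogonality relation.

  Modulo the ideal every operator is a combination of $1$ and $S_m$. These are independent on
  either block: otherwise the Riccati equation of the recurrence would have a solution that is
  rational in $q^m$. This gives the annihilators and the rank, and it bounds the Hilbert
  function from below; from above it is bounded because reducing the monomials of degree at
  most $n$ only needs a power of $q$ and a power of $x$ of exponent $O(n)$ as denominator.
\<close>

section \<open>The entire function underlying both blocks\<close>

text \<open>The definitions may divide by zero at the points \<open>q powi k\<close>, so the
  identities are proved pointwise on \<open>generic q\<close>, the other nonzero points. This set is
  cosparse in the punctured plane and stable under \<open>x -> q x\<close> and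
  \<open>q -> 1/q\<close>, so chains of shifts produce no side conditions. The symmetry under
  \<open>q -> 1/q\<close> originates in \<open>J\<close>: in the inverted base its series is H at
  \<open>(x/y, 1/y)\<close>, and this substitution exchanges the argument pairs
  \<open>(q^m x^2, x)\<close> and \<open>(q^m x, 1/x)\<close> of the two blocks up to the sign of
  \<open>m\<close>. The Riccati equation arises as follows: a relation a(q^m) f_m + b(q^m) f_(m+1) =
  0 and its shift by one form a homogeneous linear system for the pair (f_m, f_(m+1)), which never
  vanishes, so the determinant is zero. Here \<open>q\<close> and \<open>x\<close> are fixed while
  \<open>m\<close> varies; one \<open>x\<close> must therefore serve all \<open>m\<close> at once,
  which is possible because sparse sets are countable. Operators act compatibly with sums and
  products only where their coefficients have no poles. Hence polynomials witnessing nonvanishing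
  denominators are carried along whenever operators are combined.\<close>

lemma summable_q_gauss:
  fixes q :: complex and r :: real
  assumes "norm q < 1"
  shows "summable (\<lambda>n. norm q ^ (n * (n + 1) div 2) * r ^ n)"
proof -
  have "(\<lambda>n. norm q ^ n * \<bar>norm q * r\<bar>) \<longlonglongrightarrow> 0 * \<bar>norm q * r\<bar>"
    using assms by (intro tendsto_intros LIMSEQ_power_zero) auto
  then have "eventually (\<lambda>n. norm q ^ n * \<bar>norm q * r\<bar> < 1/2) sequentially"
    by (intro order_tendstoD) auto
  then obtain N where N: "\<And>n. n \<ge> N \<Longrightarrow> norm q ^ n * \<bar>norm q * r\<bar> < 1/2"
    by (auto simp: eventually_sequentially)
  show ?thesis
  proof (rule summable_ratio_test[of "1/2" N])
    fix n assume "n \<ge> N"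
    \<comment> \<open>The triangular exponent grows by n + 1, so the ratio of consecutive terms has
      absolute value |q|^(n+1) |r|, which tends to 0 for every \<open>r\<close>.\<close>
    have tri: "Suc n * (Suc n + 1) div 2 = n * (n + 1) div 2 + (n + 1)" 
      by simp
    have "norm (norm q ^ (Suc n * (Suc n + 1) div 2) * r ^ Suc n)
        = (norm q ^ n * \<bar>norm q * r\<bar>) * norm (norm q ^ (n * (n + 1) div 2) * r ^ n)"
      unfolding tri by (simp add: power_add abs_mult norm_power power_abs)
    also have "\<dots> \<le> 1/2 * norm (norm q ^ (n * (n + 1) div 2) * r ^ n)"
      using N[OF \<open>n \<ge> N\<close>] by (intro mult_right_mono) auto
    finally show "norm (norm q ^ (Suc n * (Suc n + 1) div 2) * r ^ Suc n)
        \<le> 1/2 * norm (norm q ^ (n * (n + 1) div 2) * r ^ n)" .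
  qed simp
qed

lemma convergent_qpoch:
  fixes q x :: complex
  assumes "norm q < 1"
  shows "convergent_prod (\<lambda>j. 1 - q ^ j * x)"
proof (rule abs_convergent_prod_imp_convergent_prod, rule summable_imp_abs_convergent_prod)
  have "summable (\<lambda>j. norm q ^ j * norm x)"
    using assms by (intro summable_mult2 summable_geometric) auto
  then show "summable (\<lambda>i. norm ((1 - q ^ i * x) - 1))"
    by (simp add: norm_mult norm_power)
qed

lemma qpoch_tendsto:
  assumes "norm q < 1"
  shows "qpoch x q \<longlonglongrightarrow> qpoch_inf x q"
proof -
  have "(\<lambda>n. \<Prod>i\<le>n. 1 - q ^ i * x) \<longlonglongrightarrow> qpoch_inf x q"
    unfolding qpoch_inf_def using assms by (intro convergent_prod_LIMSEQ convergent_qpoch)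
  then show ?thesis
    unfolding qpoch_def by (subst LIMSEQ_lessThan_iff_atMost)
qed

lemma qpoch_Suc: "qpoch x q (Suc n) = (1 - x) * qpoch (q * x) q n"
  unfolding qpoch_def by (subst prod.lessThan_Suc_shift) (simp add: mult.assoc mult.left_commute)

lemma qpoch_Suc': "qpoch x q (Suc n) = qpoch x q n * (1 - q ^ n * x)"
  by (simp add: qpoch_def)

lemma qpoch_0 [simp]: "qpoch x q 0 = 1"
  by (simp add: qpoch_def)

lemma qpoch_inf_Suc:
  assumes "norm q < 1"
  shows "qpoch_inf x q = (1 - x) * qpoch_inf (q * x) q"
proof (rule LIMSEQ_unique)
  show "(\<lambda>n. qpoch x q (Suc n)) \<longlonglongrightarrow> qpoch_inf x q"
    using qpoch_tendsto[OF assms] by (rule LIMSEQ_Suc)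
  show "(\<lambda>n. qpoch x q (Suc n)) \<longlonglongrightarrow> (1 - x) * qpoch_inf (q * x) q"
    unfolding qpoch_Suc by (intro tendsto_intros qpoch_tendsto assms)
qed

lemma qpoch_inf_split:
  assumes "norm q < 1"
  shows "qpoch_inf x q = qpoch x q n * qpoch_inf (q ^ n * x) q"
proof (induction n)
  case (Suc n)
  then show ?case
    using qpoch_inf_Suc[OF assms, of "q ^ n * x"] by (simp add: qpoch_Suc' mult_ac)
qed simp

lemma qpoch_inf_nonzero:
  assumes "norm q < 1" "\<And>j. q ^ j * x \<noteq> 1"
  shows "qpoch_inf x q \<noteq> 0"
  unfolding qpoch_inf_def
  by (intro prodinf_nonzero convergent_qpoch assms(1)) (use assms(2) in \<open>metis right_minus_eq\<close>)

text \<open>The partial products are polynomials, and on a disc of radius 1 about \<open>z\<close>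
  the deviations of the factors from 1 are dominated by the geometric terms |q|^n (|z| + 1).\<close>

lemma holomorphic_qpoch_inf:
  assumes "norm q < 1"
  shows "(\<lambda>x. qpoch_inf x q) holomorphic_on UNIV"
proof (rule holomorphic_uniform_sequence)
  show "(\<lambda>x. qpoch x q n) holomorphic_on UNIV" for n
    unfolding qpoch_def by (intro holomorphic_intros)
  fix z :: complex
  have "uniformly_convergent_on (cball z 1) (\<lambda>N x. \<Sum>n<N. norm (1 - q ^ n * x - 1))"
  proof (rule Weierstrass_m_test'_ev)
    show "summable (\<lambda>n. norm q ^ n * (norm z + 1))"
      using assms by (intro summable_mult2 summable_geometric) auto
    show "\<forall>\<^sub>F n in sequentially. \<forall>x\<in>cball z 1.
            norm (norm (1 - q ^ n * x - 1)) \<le> norm q ^ n * (norm z + 1)"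
    proof (intro always_eventually allI ballI)
      fix n x assume "x \<in> cball z 1"
      then have "norm x \<le> norm z + 1"
        by (metis add.commute add_le_cancel_left dist_commute dist_norm mem_cball norm_triangle_sub order_trans)
      then show "norm (norm (1 - q ^ n * x - 1)) \<le> norm q ^ n * (norm z + 1)"
        by (simp add: norm_mult norm_power mult_left_mono)
    qed
  qed
  then have "uniformly_convergent_on (cball z 1) (\<lambda>N x. qpoch x q N)"
    unfolding qpoch_def by (intro uniformly_convergent_on_prod') (auto intro!: continuous_intros)
  then obtain l where l: "uniform_limit (cball z 1) (\<lambda>N x. qpoch x q N) l sequentially"
    by (auto simp: uniformly_convergent_on_def)
  have "l x = qpoch_inf x q" if "x \<in> cball z 1" for x
    using tendsto_uniform_limitI[OF l that] qpoch_tendsto[OF assms] LIMSEQ_unique by blast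
  then have "uniform_limit (cball z 1) (\<lambda>N x. qpoch x q N) (\<lambda>x. qpoch_inf x q) sequentially"
    using l by (subst uniform_limit_cong'[where g = "\<lambda>N x. qpoch x q N" and i = l]) auto
  then show "\<exists>d>0. cball z d \<subseteq> UNIV \<and>
      uniform_limit (cball z d) (\<lambda>N x. qpoch x q N) (\<lambda>x. qpoch_inf x q) sequentially"
    by (intro exI[of _ 1]) auto
qed simp

text \<open>The quotient of (qy;q)_inf by (qy;q)_n is written as the single product (q^(n+1)
  y;q)_inf. In this form no coefficient has a pole in \<open>y\<close>.\<close>

definition hcoeff :: "complex \<Rightarrow> complex \<Rightarrow> nat \<Rightarrow> complex" where
  "hcoeff q y n =
     (-1) ^ n * q ^ (n * (n + 1) div 2) / qpoch q q n * qpoch_inf (q ^ Suc n * y) q"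

text \<open>With u = z^2 and y = q^nu this is the Hahn-Exton q-Bessel function J_nu(z;q) up to the
  factor z^nu / (q;q)_inf.\<close>

definition hahn :: "complex \<Rightarrow> complex \<Rightarrow> complex \<Rightarrow> complex" where
  "hahn q u y = suminf (\<lambda>n. hcoeff q y n * u ^ n)"

lemma qpoch_q_nonzero: 
  assumes "norm q < 1" 
  shows "qpoch q q n \<noteq> 0"
proof -
  have "q ^ Suc j \<noteq> 1" for j
  proof
    assume "q ^ Suc j = 1"
    then have "norm q ^ Suc j = 1"
      by (metis norm_one norm_power)
    then show False
      using power_less_one_iff[of "norm q" "Suc j"] assms by simp
  qed
  then show ?thesis by (auto simp: qpoch_def mult.commute)
qed

text \<open>The sequence 1/(q;q)_n converges, hence is bounded, and q^(n+1) y stays in the disc of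
  radius \<open>R\<close>, where the infinite product is bounded by compactness. One constant thus
  serves all \<open>n\<close> and all \<open>y\<close> in the disc.\<close>

lemma hcoeff_bound:
  assumes q: "norm q < 1"
  shows "\<exists>C\<ge>0. \<forall>n y. norm y \<le> R \<longrightarrow> norm (hcoeff q y n) \<le> C * norm q ^ (n * (n + 1) div 2)"
proof -
  have "q ^ j * q \<noteq> 1" for j
    using qpoch_q_nonzero[OF q, of "Suc j"] by (auto simp: qpoch_def)
  then have "(\<lambda>n. inverse (qpoch q q n)) \<longlonglongrightarrow> inverse (qpoch_inf q q)"
    by (intro tendsto_inverse qpoch_tendsto qpoch_inf_nonzero q) 
  then have "Bseq (\<lambda>n. inverse (qpoch q q n))"
    by (intro convergent_imp_Bseq convergentI)
  then obtain C1 where C1: "C1 > 0" "\<And>n. norm (inverse (qpoch q q n)) \<le> C1"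
    by (auto elim: BseqE)
  have "compact ((\<lambda>x. qpoch_inf x q) ` cball 0 R)"
    using holomorphic_qpoch_inf[OF q]
    by (intro compact_continuous_image) (auto intro: continuous_on_subset holomorphic_on_imp_continuous_on)
  from compact_imp_bounded[OF this] have "\<exists>C. \<forall>x\<in>cball 0 R. norm (qpoch_inf x q) \<le> C"
    by (auto simp: bounded_iff)
  then obtain C2 where C2: "\<forall>x\<in>cball 0 R. norm (qpoch_inf x q) \<le> C2" ..
  show ?thesis
  proof (intro exI[of _ "C1 * \<bar>C2\<bar>"] conjI allI impI)
    fix n and y :: complex assume y: "norm y \<le> R"
    have "norm (q ^ Suc n * y) \<le> 1 * norm y"
      unfolding norm_mult norm_power using q by (intro mult_right_mono power_le_one) auto
    then have "norm (qpoch_inf (q ^ Suc n * y) q) \<le> \<bar>C2\<bar>"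
      using bspec[OF C2, of "q ^ Suc n * y"] y by simp
    then have "norm (inverse (qpoch q q n)) * norm (qpoch_inf (q ^ Suc n * y) q) \<le> C1 * \<bar>C2\<bar>"
      using C1 by (intro mult_mono) auto
    from mult_left_mono[OF this, of "norm q ^ (n * (n + 1) div 2)"]
    show "norm (hcoeff q y n) \<le> C1 * \<bar>C2\<bar> * norm q ^ (n * (n + 1) div 2)"
      by (simp add: hcoeff_def norm_mult norm_power norm_divide norm_inverse divide_inverse mult_ac)
  qed (use C1 in auto)
qed

lemma summable_hahn:
  assumes q: "norm q < 1"
  shows "summable (\<lambda>n. hcoeff q y n * u ^ n)"
proof -
  obtain C where C: "norm (hcoeff q y n) \<le> C * norm q ^ (n * (n + 1) div 2)" for n
    using hcoeff_bound[OF q, of "norm y"] by auto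
  show ?thesis
  proof (rule summable_comparison_test)
    show "summable (\<lambda>n. C * (norm q ^ (n * (n + 1) div 2) * norm u ^ n))"
      by (intro summable_mult summable_q_gauss q)
    show "\<exists>N. \<forall>n\<ge>N. norm (hcoeff q y n * u ^ n) \<le> C * (norm q ^ (n * (n + 1) div 2) * norm u ^ n)"
    proof (intro exI[of _ 0] allI impI)
      fix n show "norm (hcoeff q y n * u ^ n) \<le> C * (norm q ^ (n * (n + 1) div 2) * norm u ^ n)"
        using mult_right_mono[OF C[of n], of "norm u ^ n"] by (simp add: norm_mult norm_power mult.assoc)
    qed
  qed
qed

text \<open>Both arguments are functions of one variable, so the one-variable Weierstrass theorem
  suffices although H depends on two variables.\<close>

lemma holomorphic_hahn:
  assumes q: "norm q < 1" and "open S" and f: "f holomorphic_on S" and g: "g holomorphic_on S"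
  shows "(\<lambda>x. hahn q (f x) (g x)) holomorphic_on S"
proof (rule holomorphic_uniform_sequence)
  show "(\<lambda>x. \<Sum>n<N. hcoeff q (g x) n * f x ^ n) holomorphic_on S" for N
  proof -
    have "(\<lambda>x. qpoch_inf (q ^ Suc n * g x) q) holomorphic_on S" for n
    proof -
      have "(\<lambda>x. q ^ Suc n * g x) holomorphic_on S"
        by (intro holomorphic_on_mult holomorphic_on_const g)
      from holomorphic_on_compose_gen[OF this holomorphic_qpoch_inf[OF q] subset_UNIV] show ?thesis
        unfolding o_def .
    qed
    then show ?thesis
      unfolding hcoeff_def
      by (intro holomorphic_on_sum holomorphic_on_mult holomorphic_on_power holomorphic_on_const f)
  qed
  fix z assume "z \<in> S"
  then have "\<exists>d>0. cball z d \<subseteq> S"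
    using open_contains_cball_eq[OF \<open>open S\<close>] by simp
  then obtain d where d: "d > 0" "cball z d \<subseteq> S"
    by (elim exE conjE)
  have bdd: "\<exists>B. \<forall>x\<in>cball z d. norm (h x) \<le> B" if "h holomorphic_on S" for h :: "complex \<Rightarrow> complex"
  proof -
    have "continuous_on (cball z d) h"
      using that d(2) continuous_on_subset holomorphic_on_imp_continuous_on by blast
    then have "bounded (h ` cball z d)"
      using compact_continuous_image compact_imp_bounded compact_cball by blast
    then show ?thesis
      by (auto simp: bounded_iff)
  qed
  obtain F where F: "\<forall>x\<in>cball z d. norm (f x) \<le> F"
    using bdd[OF f] ..
  obtain R where R: "\<forall>x\<in>cball z d. norm (g x) \<le> R"
    using bdd[OF g] ..
  obtain C where C: "C \<ge> 0" "\<forall>n y. norm y \<le> R \<longrightarrow> norm (hcoeff q y n) \<le> C * norm q ^ (n * (n + 1) div 2)"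
    using hcoeff_bound[OF q, of R] by blast
  have "uniform_limit (cball z d) (\<lambda>N x. \<Sum>n<N. hcoeff q (g x) n * f x ^ n)
      (\<lambda>x. hahn q (f x) (g x)) sequentially"
    unfolding hahn_def
  proof (rule Weierstrass_m_test)
    show "summable (\<lambda>n. C * (norm q ^ (n * (n + 1) div 2) * F ^ n))"
      by (intro summable_mult summable_q_gauss q)
    fix n x assume x: "x \<in> cball z d"
    have "norm (hcoeff q (g x) n) * norm (f x) ^ n \<le> (C * norm q ^ (n * (n + 1) div 2)) * F ^ n"
      using C(1) C(2)[rule_format, OF bspec[OF R x], of n] bspec[OF F x] by (intro mult_mono power_mono) simp_all
    then show "norm (hcoeff q (g x) n * f x ^ n) \<le> C * (norm q ^ (n * (n + 1) div 2) * F ^ n)"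
      by (simp add: norm_mult norm_power mult_ac)
  qed
  then show "\<exists>d>0. cball z d \<subseteq> S \<and> uniform_limit (cball z d) (\<lambda>N x. \<Sum>n<N. hcoeff q (g x) n * f x ^ n)
      (\<lambda>x. hahn q (f x) (g x)) sequentially"
    using d by blast
qed fact


lemma isCont_hahn: "norm q < 1 \<Longrightarrow> isCont (\<lambda>u. hahn q u y) u"
  unfolding hahn_def by (intro isCont_powser_converges_everywhere summable_hahn)

lemma hahn_0: "hahn q 0 y = qpoch_inf (q * y) q"
  unfolding hahn_def powser_zero by (simp add: hcoeff_def)

text \<open>Since q^(n+2) y = q^(n+1) (q y), raising the index replaces \<open>y\<close> by
  \<open>q * y\<close> in the tail product; 1 - q^(n+1) is the new factor of (q;q)_(n+1).\<close>

lemma hcoeff_Suc: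
  assumes q: "norm q < 1"
  shows "(1 - q ^ Suc n) * hcoeff q y (Suc n) = - (q ^ Suc n * hcoeff q (q * y) n)"
proof -
  have tri: "Suc n * (Suc n + 1) div 2 = Suc n + n * (n + 1) div 2"
    by simp
  define w where "w = q ^ Suc n"
  have w: "q ^ n * q = w"
    by (simp add: w_def)
  have "1 - w \<noteq> 0"
    using qpoch_q_nonzero[OF q, of "Suc n"] unfolding qpoch_Suc' w by simp
  have "hcoeff q y (Suc n) = (-1) ^ Suc n * (w * q ^ (n * (n + 1) div 2)) / (qpoch q q n * (1 - w))
      * qpoch_inf (q ^ Suc (Suc n) * y) q"
    unfolding hcoeff_def tri power_add[of q "Suc n"] qpoch_Suc'[of q] w unfolding w_def ..
  also have "(1 - w) * \<dots> = - (w * hcoeff q (q * y) n)"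
    using \<open>1 - w \<noteq> 0\<close> unfolding hcoeff_def by (simp add: mult_ac)
  finally show ?thesis
    unfolding w_def .
qed

lemma hcoeff_shift:
  assumes q: "norm q < 1"
  shows "hcoeff q y n = (1 - q ^ Suc n * y) * hcoeff q (q * y) n"
  unfolding hcoeff_def using qpoch_inf_Suc[OF q, of "q ^ Suc n * y"] by (simp add: mult_ac)

text \<open>This is \<open>hcoeff_shift\<close> summed up; the factor q^n in it is absorbed by the
  dilation from \<open>u\<close> to \<open>q * u\<close>.\<close>

lemma hahn_shift_y:
  assumes q: "norm q < 1"
  shows "hahn q u y = hahn q u (q * y) - q * y * hahn q (q * u) (q * y)"
proof -
  have "(\<lambda>n. hcoeff q (q * y) n * u ^ n - q * y * (hcoeff q (q * y) n * (q * u) ^ n)) sums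
      (hahn q u (q * y) - q * y * hahn q (q * u) (q * y))"
    unfolding hahn_def by (intro sums_diff sums_mult summable_sums summable_hahn q)
  moreover have "hcoeff q (q * y) n * u ^ n - q * y * (hcoeff q (q * y) n * (q * u) ^ n)
      = hcoeff q y n * u ^ n" for n
    unfolding hcoeff_shift[OF q, of y] by (simp add: algebra_simps power_mult_distrib)
  ultimately show ?thesis
    unfolding hahn_def[of q u y] by (simp only: sums_unique[symmetric])
qed

text \<open>The dilation multiplies the coefficient of u^n by q^n, so the difference carries 1 -
  q^n, which is what \<open>hcoeff_Suc\<close> needs to lower the index.\<close>

lemma hahn_shift_u:
  assumes q: "norm q < 1"
  shows "hahn q u y - hahn q (q * u) y = - (q * u * hahn q (q * u) (q * y))"
proof -
  have "(\<lambda>n. hcoeff q y n * u ^ n - hcoeff q y n * (q * u) ^ n) sums (hahn q u y - hahn q (q * u) y)"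
    unfolding hahn_def by (intro sums_diff summable_sums summable_hahn q)
  \<comment> \<open>The terms of index 0 cancel, so the series may start at index 1.\<close>
  then have "(\<lambda>n. hcoeff q y (Suc n) * u ^ Suc n - hcoeff q y (Suc n) * (q * u) ^ Suc n)
      sums (hahn q u y - hahn q (q * u) y)"
    by (subst sums_Suc_iff) simp
  moreover have "hcoeff q y (Suc n) * u ^ Suc n - hcoeff q y (Suc n) * (q * u) ^ Suc n
      = - (q * u) * (hcoeff q (q * y) n * (q * u) ^ n)" for n
  proof -
    have "hcoeff q y (Suc n) * u ^ Suc n - hcoeff q y (Suc n) * (q * u) ^ Suc n
        = ((1 - q ^ Suc n) * hcoeff q y (Suc n)) * u ^ Suc n"
      by (simp add: algebra_simps power_mult_distrib)
    then show ?thesis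
      unfolding hcoeff_Suc[OF q] by (simp add: algebra_simps power_mult_distrib)
  qed
  moreover have "(\<lambda>n. - (q * u) * (hcoeff q (q * y) n * (q * u) ^ n)) sums
      (- (q * u) * hahn q (q * u) (q * y))"
    unfolding hahn_def by (intro sums_mult summable_sums summable_hahn q)
  ultimately show ?thesis
    by (metis (no_types, lifting) mult_minus_left sums_cong sums_unique2)
qed

text \<open>The two values at \<open>q * y\<close> are eliminated from one instance of
  \<open>hahn_shift_y\<close> and two of \<open>hahn_shift_u\<close>; what remains is a relation
  with \<open>y\<close> fixed.\<close>

lemma hahn_rec:
  assumes q: "norm q < 1"
  shows "hahn q u y - (1 + y) * hahn q (q * u) y + y * hahn q (q * (q * u)) y + q * u * hahn q (q * u) y = 0"
proof -
  have "hahn q (q * u) y = hahn q (q * u) (q * y) - q * y * hahn q (q * (q * u)) (q * y)"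
    by (rule hahn_shift_y[OF q])
  moreover have "hahn q u y - hahn q (q * u) y = - (q * u * hahn q (q * u) (q * y))"
    "hahn q (q * u) y - hahn q (q * (q * u)) y = - (q * (q * u) * hahn q (q * (q * u)) (q * y))"
    by (rule hahn_shift_u[OF q])+
  ultimately show ?thesis by algebra
qed

section \<open>The blocks at generic points\<close>

text \<open>The zeros of the theta factors and of the Pochhammer denominators of the blocks are
  powers of \<open>q\<close>. Excluding all integer powers makes the set invariant under
  \<open>x -> q x\<close> and \<open>q -> 1/q\<close>.\<close>

definition generic :: "complex \<Rightarrow> complex set" where
  "generic q = {x. x \<noteq> 0 \<and> (\<forall>k::int. x \<noteq> q powi k)}"

lemma generic_nonzero: "x \<in> generic q \<Longrightarrow> x \<noteq> 0"
  by (simp add: generic_def)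

lemma generic_inverse: "generic (inverse q) = generic q"
proof -
  have "(\<forall>k. x \<noteq> inverse q powi k) \<longleftrightarrow> (\<forall>k. x \<noteq> q powi k)" for x
    by (metis minus_minus power_int_inverse power_int_minus)
  then show ?thesis
    by (simp add: generic_def)
qed

lemma generic_mult:
  assumes "q \<noteq> 0" "x \<in> generic q"
  shows "q * x \<in> generic q"
proof -
  have "q * x \<noteq> q powi k" for k
  proof
    assume "q * x = q powi k"
    then have "x = q powi (k - 1)"
      using assms(1) by (simp add: power_int_diff field_simps)
    then show False
      using assms(2) by (auto simp: generic_def)
  qed
  then show ?thesis
    using assms by (auto simp: generic_def)
qed

text \<open>The powers of \<open>q\<close> accumulate only at 0 and infinity, so a small punctured
  disc about a nonzero point avoids all of them. The case |q| > 1 reduces to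
  \<open>inverse q\<close>, which has the same generic set.\<close>

lemma eventually_generic:
  assumes "admissible q"
  shows "\<forall>\<^sub>\<approx>x\<in>-{0}. x \<in> generic q"
proof -
  have *: "\<forall>\<^sub>\<approx>x\<in>-{0}. x \<in> generic q" if "q \<noteq> 0" and q: "norm q < 1" for q :: complex
  proof -
    have "eventually (\<lambda>x. x \<in> generic q) (at z)" if "z \<noteq> 0" for z
    proof -
      define r where "r = norm z"
      have r: "r > 0"
        using that by (simp add: r_def)
      \<comment> \<open>In the annulus r/2 < |x| < 2r, an equation x = q^n gives |q|^n > r/2 and x =
        q^(-n) gives |q|^n > 1/(2r). Either way |q|^n > \<open>e\<close>, which leaves finitely many
        \<open>n\<close>.\<close>
      define e where "e = min (r / 2) (1 / (2 * r))"
      have "e > 0"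
        using r by (simp add: e_def)
      have "(\<lambda>n. norm q ^ n) \<longlonglongrightarrow> 0"
        using q by (intro LIMSEQ_power_zero) auto
      then have "eventually (\<lambda>n. norm q ^ n < e) sequentially"
        using \<open>e > 0\<close> by (rule order_tendstoD(2))
      then obtain N where N: "\<forall>n\<ge>N. norm q ^ n < e"
        unfolding eventually_sequentially ..
      define F where "F = (\<lambda>k. q powi k) ` {- int N .. int N}"
      have "finite (F - {z})"
        by (simp add: F_def)
      then have "open (- (F - {z}))"
        using finite_imp_closed open_Compl by blast
      then have "eventually (\<lambda>x. x \<in> - (F - {z}) - {z}) (at z)"
        by (intro eventually_at_in_open) auto
      moreover have "eventually (\<lambda>x. x \<in> ball z (r / 2) - {z}) (at z)"
        using r by (intro eventually_at_in_open) auto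
      ultimately show ?thesis
      proof eventually_elim
        case (elim x)
        have "norm z \<le> norm x + norm (z - x)" "norm x \<le> norm z + norm (x - z)"
          by (metis add.commute norm_triangle_sub)+
        then have nx: "r / 2 < norm x" "norm x < 2 * r"
          using elim(2) r by (auto simp: dist_norm norm_minus_commute r_def)
        have "x \<noteq> q powi k" for k
        proof
          assume k: "x = q powi k"
          have "k \<in> {- int N .. int N}"
          proof (cases "k \<ge> 0")
            case True
            then obtain n where n: "k = int n"
              using nonneg_int_cases by blast
            have "norm q ^ n > e"
              using nx(1) k n by (simp add: e_def norm_power)
            then have "n < N"
              using N[rule_format, of n] by (meson not_less order.asym)
            then show ?thesis
              using n by simp
          next
            case False
            then obtain n where n: "k = - int n"
              by (metis int_cases2 of_nat_0_le_iff)
            have "norm x * norm q ^ n = 1"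
              using k n \<open>q \<noteq> 0\<close> by (simp add: power_int_minus norm_power norm_inverse)
            moreover have "norm x * norm q ^ n < 2 * r * norm q ^ n"
              using nx(2) \<open>q \<noteq> 0\<close> by simp
            ultimately have "norm q ^ n > 1 / (2 * r)"
              using r by (simp add: field_simps)
            then have "n < N"
              using N[rule_format, of n] unfolding e_def by (smt (verit) not_less)
            then show ?thesis
              using n by simp
          qed
          then have "x \<in> F"
            using k by (auto simp: F_def)
          then show False
            using elim(1) by auto
        qed
        then show ?case
          using nx r by (auto simp: generic_def)
      qed
    qed
    then show ?thesis
      by (subst eventually_cosparse_open_eq) auto
  qed
  show ?thesis
  proof (cases "norm q < 1")
    case True
    then show ?thesis
      using * assms by (auto simp: admissible_def)
  next
    case False
    then have "norm (inverse q) < 1"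
      using assms by (auto simp: admissible_def norm_inverse intro: inverse_less_1_iff[THEN iffD2])
    then show ?thesis
      using *[of "inverse q"] assms by (simp add: generic_inverse admissible_def)
  qed
qed

lemma qpoch_inf_generic:
  assumes "q \<noteq> 0" "norm q < 1" "x \<in> generic q"
  shows "qpoch_inf (q powi k * x) q \<noteq> 0" "qpoch_inf (q powi k / x) q \<noteq> 0"
proof -
  have x: "x \<noteq> 0" "\<And>k. x \<noteq> q powi k"
    using assms(3) by (auto simp: generic_def)
  show "qpoch_inf (q powi k * x) q \<noteq> 0"
  proof (rule qpoch_inf_nonzero[OF assms(2)])
    fix j show "q ^ j * (q powi k * x) \<noteq> 1"
    proof
      assume "q ^ j * (q powi k * x) = 1"
      then have "x = q powi (- k - int j)"
        using assms(1) by (simp add: power_int_diff power_int_minus field_simps)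
      then show False
        using x by blast
    qed
  qed
  show "qpoch_inf (q powi k / x) q \<noteq> 0"
  proof (rule qpoch_inf_nonzero[OF assms(2)])
    fix j show "q ^ j * (q powi k / x) \<noteq> 1"
    proof
      assume "q ^ j * (q powi k / x) = 1"
      then have "x = q powi (k + int j)"
        using assms(1) x by (simp add: power_int_add field_simps)
      then show False
        using x by blast
    qed
  qed
qed

lemma hahn_series:
  assumes q: "norm q < 1" and y: "qpoch_inf (q * y) q \<noteq> 0"
  shows "suminf (\<lambda>n. (-1) ^ n * (q ^ (n * (n + 1) div 2) * u ^ n / (qpoch q q n * qpoch (q * y) q n)))
    = hahn q u y / qpoch_inf (q * y) q"
proof -
  have "(-1) ^ n * (q ^ (n * (n + 1) div 2) * u ^ n / (qpoch q q n * qpoch (q * y) q n))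
      = hcoeff q y n * u ^ n / qpoch_inf (q * y) q" for n
  proof -
    have split: "qpoch_inf (q * y) q = qpoch (q * y) q n * qpoch_inf (q ^ Suc n * y) q"
      using qpoch_inf_split[OF q, of "q * y" n] by (simp add: mult_ac)
    then have "qpoch (q * y) q n \<noteq> 0" "qpoch_inf (q ^ Suc n * y) q \<noteq> 0"
      using y by auto
    then show ?thesis
      unfolding hcoeff_def split by simp
  qed
  then show ?thesis
    unfolding hahn_def using suminf_divide[OF summable_hahn[OF q]] by simp
qed

lemma J_small:
  assumes "norm q < 1" "qpoch_inf (q * y) q \<noteq> 0"
  shows "J x y q = hahn q x y"
  unfolding J_def if_P[OF assms(1)] hahn_series[OF assms] using assms(2) by simp

text \<open>With p = 1/q the factors x^n y^(-n) and (p/y;p)_n make the series that of H in base p at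
  \<open>(x/y, 1/y)\<close>. The two products in the denominator together form a theta function of
  \<open>y\<close>, which can be combined with the theta factor of a block.\<close>

lemma J_large:
  assumes "norm q > 1" "qpoch_inf (inverse q * inverse y) (inverse q) \<noteq> 0"
  shows "J x y q = hahn (inverse q) (x * inverse y) (inverse y)
    / (qpoch_inf y (inverse q) * qpoch_inf (inverse q * inverse y) (inverse q))"
proof -
  have "norm (inverse q) < 1"
    using assms(1) by (simp add: norm_inverse inverse_less_1_iff)
  from hahn_series[OF this assms(2), of "x * inverse y"] show ?thesis
    using assms(1) by (simp add: J_def Let_def power_mult_distrib mult.assoc)
qed

lemma theta_small:
  assumes "norm h < 1" "h\<^sup>2 = q" "a = - h * z" "b = - h / z"
  shows "theta h z = qpoch_inf a q * qpoch_inf b q"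
  using assms by (simp add: theta_def)

lemma theta_large:
  assumes "norm h > 1" "h\<^sup>2 = inverse q" "a = - inverse h * z" "b = - inverse h / z"
  shows "theta h z = inverse (qpoch_inf a q * qpoch_inf b q)"
  using assms by (simp add: theta_def power_inverse)

lemma block_A_small:
  assumes "q \<noteq> 0" "norm q < 1" "x \<in> generic q"
  shows "block_A q m x = x powi (2 * m) * hahn q (q powi m * x\<^sup>2) x
    / (qpoch_inf (q * x) q * qpoch_inf (1 / x) q)\<^sup>2"
proof -
  define s where "s = csqrt q"
  have h: "norm s < 1" "s \<noteq> 0" "s\<^sup>2 = q"
    using assms by (auto simp: s_def)
  have "theta s (- s * x) = qpoch_inf (q * x) q * qpoch_inf (1 / x) q"
    using h generic_nonzero[OF assms(3)] by (intro theta_small) (auto simp: power2_eq_square)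
  moreover have "qpoch_inf (q * x) q \<noteq> 0"
    using qpoch_inf_generic(1)[OF assms, of 1] by simp
  ultimately show ?thesis
    unfolding block_A_def s_def[symmetric] by (simp add: J_small assms power_int_minus divide_inverse)
qed

lemma block_B_small:
  assumes "q \<noteq> 0" "norm q < 1" "x \<in> generic q"
  shows "block_B q m x =
    qpoch_inf x q * qpoch_inf (q / x) q * x powi m * hahn q (q powi m * x) (1 / x)"
proof -
  define s where "s = csqrt q"
  have h: "norm s < 1" "s \<noteq> 0" "s\<^sup>2 = q"
    using assms by (auto simp: s_def)
  have "theta s (- inverse s * x) = qpoch_inf x q * qpoch_inf (q / x) q"
    using h generic_nonzero[OF assms(3)]
    by (intro theta_small) (auto simp: power2_eq_square divide_simps)
  moreover have "qpoch_inf (q * inverse x) q \<noteq> 0"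
    using qpoch_inf_generic(2)[OF assms, of 1] by (simp add: divide_inverse)
  ultimately show ?thesis
    unfolding block_B_def s_def[symmetric] by (simp add: J_small assms inverse_eq_divide)
qed

text \<open>For A the inverted theta factor enters as the square of (x;q)_inf (q/x;q)_inf and one
  power is cancelled by the denominator from \<open>J_large\<close>, which leaves the factor of B.
  For B the inverted theta factor and the denominator from \<open>J_large\<close> combine to the
  inverse square that belongs to A.\<close>

lemma block_inverse_small:
  assumes "q \<noteq> 0" "norm q < 1" "x \<in> generic q"
  shows "block_A (inverse q) m x = x powi (3 * m) * block_B q (- m) x"
    and "block_B (inverse q) m x = x powi (3 * m) * block_A q (- m) x"
proof -
  define h where "h = csqrt (inverse q)"
  have q1: "norm (inverse q) > 1"
    using assms by (simp add: norm_inverse one_less_inverse_iff)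
  have h: "norm h > 1" "h \<noteq> 0" "h\<^sup>2 = inverse q"
    using q1 assms(1) by (auto simp: h_def)
  have x: "x \<noteq> 0"
    using assms(3) by (rule generic_nonzero)
  define a b c d where "a = qpoch_inf x q" and "b = qpoch_inf (q / x) q"
    and "c = qpoch_inf (q * x) q" and "d = qpoch_inf (1 / x) q"
  note abcd = this
  have nz: "a \<noteq> 0" "b \<noteq> 0" "c \<noteq> 0" "d \<noteq> 0"
    using qpoch_inf_generic[OF assms, of 0] qpoch_inf_generic[OF assms, of 1] by (simp_all add: abcd)
  have q: "q = inverse h * inverse h"
    using h(3) by (metis inverse_inverse_eq inverse_mult_distrib power2_eq_square)
  have m: "inverse q powi m = q powi (- m)"
    by (simp add: power_int_inverse power_int_minus)
  have x3: "x powi (3 * m) = x powi (2 * m) * x powi m" "x powi (- m) * x powi m = 1"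
    "x powi (2 * m) * x powi (2 * (- m)) = 1"
    using x by (simp_all add: power_int_minus flip: power_int_add)
  have "theta h (- h * x) = inverse (a * b)"
    unfolding abcd using h x by (intro theta_large) (simp_all add: q divide_simps)
  then have "theta h (- h * x) powi (-2) = (a * b)\<^sup>2"
    by (simp add: power_int_minus power_mult_distrib power_inverse)
  moreover have "J (inverse q powi m * x\<^sup>2) x (inverse q) = hahn q (q powi (- m) * x) (1 / x) / (a * b)"
  proof -
    have "x\<^sup>2 * inverse x = x"
      using x by (simp add: power2_eq_square)
    then show ?thesis
      using J_large[OF q1, of x "inverse q powi m * x\<^sup>2"] nz
      by (simp add: abcd m divide_inverse mult.assoc)
  qed
  ultimately have "block_A (inverse q) m x = (a * b)\<^sup>2 * x powi (2 * m) * (hahn q (q powi (- m) * x) (1 / x) / (a * b))"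
    unfolding block_A_def h_def[symmetric] by simp
  also have "\<dots> = x powi (2 * m) * (x powi (- m) * x powi m) * (a * b * hahn q (q powi (- m) * x) (1 / x))"
    using nz x3(2) by (simp add: power2_eq_square)
  also have "\<dots> = x powi (3 * m) * block_B q (- m) x"
    unfolding block_B_small[OF assms] x3(1) by (simp only: abcd mult_ac)
  finally show "block_A (inverse q) m x = x powi (3 * m) * block_B q (- m) x" .
  have "theta h (- inverse h * x) = inverse (c * d)"
    unfolding abcd using h x by (intro theta_large) (simp_all add: q divide_simps)
  moreover have "J (inverse q powi m * x) (inverse x) (inverse q) = hahn q (q powi (- m) * x\<^sup>2) x / (c * d)"
    using J_large[OF q1, of "inverse x" "inverse q powi m * x"] nz
    by (simp add: abcd m divide_inverse power2_eq_square mult_ac)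
  ultimately have "block_B (inverse q) m x = inverse (c * d) * x powi m * (hahn q (q powi (- m) * x\<^sup>2) x / (c * d))"
    unfolding block_B_def h_def[symmetric] by simp
  also have "\<dots> = x powi m * (x powi (2 * m) * x powi (2 * (- m))) * (hahn q (q powi (- m) * x\<^sup>2) x / (c * d)\<^sup>2)"
    using nz x3(3) by (simp add: power2_eq_square divide_inverse)
  also have "\<dots> = x powi (3 * m) * block_A q (- m) x"
    unfolding block_A_small[OF assms] x3(1) by (simp only: abcd mult_ac times_divide_eq_right)
  finally show "block_B (inverse q) m x = x powi (3 * m) * block_A q (- m) x" .
qed

section \<open>Difference equations\<close>

lemma power_int_double:
  fixes x :: "'a :: field"
  assumes "x \<noteq> 0"
  shows "x powi (2 * m) = x powi m * x powi m"
  using power_int_add[of x m m] assms by simp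

lemma power_int_triple:
  fixes x :: "'a :: field"
  assumes "x \<noteq> 0"
  shows "x powi (3 * m) = x powi m * x powi m * x powi m"
proof -
  have "x powi (3 * m) = x powi (2 * m + m)"
    by simp
  then show ?thesis
    using power_int_add[of x "2 * m" m] power_int_double[OF assms, of m] assms by simp
qed

text \<open>This is \<open>hahn_rec\<close> at \<open>(u, y) = (q^m x^2, x)\<close> for A and at
  \<open>(q^m x, 1/x)\<close> for B. The prefactors x^(2m) and x^m turn the two instances into the
  same recurrence.\<close>

lemma small_rec:
  assumes "q \<noteq> 0" "norm q < 1" "x \<in> generic q"
  shows "block_A q (m + 2) x = (x\<^sup>2 + x - q powi (m + 1) * x ^ 3) * block_A q (m + 1) x - x ^ 3 * block_A q m x"
    and "block_B q (m + 2) x = (x\<^sup>2 + x - q powi (m + 1) * x ^ 3) * block_B q (m + 1) x - x ^ 3 * block_B q m x"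
proof -
  have x: "x \<noteq> 0"
    using assms(3) by (rule generic_nonzero)
  define M where "M = q powi m"
  have M: "q powi (m + 1) = q * M" "q powi (m + 2) = q * (q * M)"
    using assms(1) by (simp_all add: M_def power_int_add power2_eq_square)
  define X where "X = x powi m"
  have X: "x powi (2 * m) = X * X" "x powi (2 * (m + 1)) = X * X * x ^ 2" "x powi (2 * (m + 2)) = X * X * x ^ 4"
    "x powi (m + 1) = X * x" "x powi (m + 2) = X * x ^ 2"
    unfolding power_int_double[OF x] X_def using x
    by (simp_all add: power_int_add power2_eq_square power4_eq_xxxx)
  define u where "u = M * x\<^sup>2"
  have u: "q * M * x\<^sup>2 = q * u" "q * (q * M) * x\<^sup>2 = q * (q * u)"
    by (simp_all add: u_def)
  show "block_A q (m + 2) x = (x\<^sup>2 + x - q powi (m + 1) * x ^ 3) * block_A q (m + 1) x - x ^ 3 * block_A q m x"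
  proof -
    have "(X * X * x ^ 4) * hahn q (q * (q * u)) x = 
       (x\<^sup>2 + x - q * M * x ^ 3) * (X * X * x\<^sup>2 * hahn q (q * u) x) - x ^ 3 * (X * X * hahn q u x)"
      using hahn_rec[OF assms(2), of u x] unfolding u_def by algebra
    then show ?thesis
      unfolding block_A_small[OF assms] M X M_def[symmetric] u u_def[symmetric]
      by (simp add: diff_divide_distrib)
  qed
  define v where "v = M * x"
  have v: "q * M * x = q * v" "q * (q * M) * x = q * (q * v)"
    by (simp_all add: v_def)
  show "block_B q (m + 2) x = (x\<^sup>2 + x - q powi (m + 1) * x ^ 3) * block_B q (m + 1) x - x ^ 3 * block_B q m x"
  proof -
    \<comment> \<open>Treating 1/x as a variable subject to \<open>x * y = 1\<close> makes the claim
      a polynomial consequence of \<open>hahn_rec\<close>.\<close>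
    define y where "y = 1 / x"
    have "x * y = 1"
      using x by (simp add: y_def)
    then have "X * x ^ 2 * hahn q (q * (q * v)) y = 
       (x\<^sup>2 + x - q * M * x ^ 3) * (X * x * hahn q (q * v) y) - x ^ 3 * (X * hahn q v y)"
      using hahn_rec[OF assms(2), of v y] unfolding v_def by algebra
    from arg_cong[OF this, of "\<lambda>t. qpoch_inf x q * qpoch_inf (q / x) q * t"]
    show ?thesis
      unfolding block_B_small[OF assms] M X M_def[symmetric] X_def[symmetric] v v_def[symmetric] y_def[symmetric]
      by (simp add: algebra_simps)
  qed
qed

text \<open>The shift \<open>x -> q x\<close> takes \<open>(u, y)\<close> to
  \<open>(q^2 u, q y)\<close> for A, where \<open>hahn_shift_u\<close> brings back the old
  \<open>y\<close>, and to \<open>(q u, y/q)\<close> for B, where \<open>hahn_shift_y\<close> does.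
  In both cases \<open>hahn_rec\<close> then removes the value at q^2 u.\<close>

lemma small_first:
  assumes "q \<noteq> 0" "norm q < 1" "x \<in> generic q"
  shows "x ^ 3 * block_A q m (q * x) = - (q powi m) * x\<^sup>2 * block_A q m x
            + (q powi m - q * (q powi m)\<^sup>2 * x\<^sup>2) * block_A q (m + 1) x"
    and "x ^ 3 * block_B q m (q * x) = - (q powi m) * x\<^sup>2 * block_B q m x
            + (q powi m - q * (q powi m)\<^sup>2 * x\<^sup>2) * block_B q (m + 1) x"
proof -
  have x: "x \<noteq> 0"
    using assms(3) by (rule generic_nonzero)
  have qx: "q * x \<in> generic q"
    using generic_mult assms by blast
  define M where "M = q powi m"
  have M: "q powi (m + 1) = q * M"
    using assms(1) by (simp_all add: M_def power_int_add)
  define X where "X = x powi m"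
  have X: "x powi (2 * m) = X * X" "x powi (2 * (m + 1)) = X * X * x ^ 2" "x powi (m + 1) = X * x" 
    "(q * x) powi m = M * X" "(q * x) powi (2 * m) = M * X * (M * X)"
    unfolding power_int_double[OF x] power_int_double[OF generic_nonzero[OF qx]] X_def M_def using x
    by (simp_all add: power_int_add power_int_mult_distrib power2_eq_square)
  define y where "y = 1 / x"
  have xy: "x * y = 1"
    using x by (simp add: y_def)
  define a b c d where "a = qpoch_inf x q" and "b = qpoch_inf (q / x) q"
    and "c = qpoch_inf (q * x) q" and "d = qpoch_inf (1 / x) q"
  note abcd = this
  have nz: "a \<noteq> 0" "b \<noteq> 0" "c \<noteq> 0" "d \<noteq> 0"
    using qpoch_inf_generic[OF assms, of 0] qpoch_inf_generic[OF assms, of 1] by (simp_all add: abcd)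
  have ac: "a = (1 - x) * c" "d = (1 - y) * b"
    using qpoch_inf_Suc[OF assms(2), of x] qpoch_inf_Suc[OF assms(2), of y] by (simp_all add: abcd y_def)
  define c2 d2 where "c2 = qpoch_inf (q * (q * x)) q" and "d2 = qpoch_inf (1 / (q * x)) q"
  have c2: "c = (1 - q * x) * c2"
    using qpoch_inf_Suc[OF assms(2), of "q * x"] by (simp add: c2_def c_def)
  have "d2 = (1 - 1 / (q * x)) * d"
    using qpoch_inf_Suc[OF assms(2), of "1 / (q * x)"] assms(1) by (simp add: d2_def d_def)
  then have "q * x * d2 = (q * x - 1) * d"
    using x assms(1) by (simp add: field_simps)
  \<comment> \<open>Quasi-periodicity of the theta function under \<open>x -> q x\<close>; its
    square supplies the factor (qx)^2 in A.\<close>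
  then have "q * x * (c2 * d2) = - (c * d)"
    unfolding c2 by algebra
  then have cd2: "(c * d)\<^sup>2 = (q * x)\<^sup>2 * (c2 * d2)\<^sup>2"
    by algebra
  then have "c2 * d2 \<noteq> 0"
    using nz by auto
  show "x ^ 3 * block_A q m (q * x) = - (q powi m) * x\<^sup>2 * block_A q m x
            + (q powi m - q * (q powi m)\<^sup>2 * x\<^sup>2) * block_A q (m + 1) x"
  proof -
    define u where "u = M * x\<^sup>2"
    have u: "q * M * x\<^sup>2 = q * u" "M * (q * x)\<^sup>2 = q * (q * u)"
      by (simp_all add: u_def power2_eq_square)
    have A2: "block_A q m (q * x) = (q * x)\<^sup>2 * (M * X * (M * X)) * hahn q (q * (q * u)) (q * x) / (c * d)\<^sup>2"
      unfolding cd2 block_A_small[OF assms(1,2) qx] M X M_def[symmetric] u c2_def[symmetric] d2_def[symmetric]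
      using x assms(1) by simp
    have "x ^ 3 * ((q * x)\<^sup>2 * (M * X * (M * X)) * hahn q (q * (q * u)) (q * x)) =
        - M * x\<^sup>2 * (X * X * hahn q u x) + (M - q * M\<^sup>2 * x\<^sup>2) * (X * X * x\<^sup>2 * hahn q (q * u) x)"
      using hahn_rec[OF assms(2), of u x] hahn_shift_u[OF assms(2), of "q * u" x] unfolding u_def by algebra
    then show ?thesis
      unfolding A2 unfolding block_A_small[OF assms] M X M_def[symmetric] u u_def[symmetric] c_def[symmetric] d_def[symmetric]
      by (simp add: diff_divide_distrib flip: minus_divide_left)
  qed
  define v where "v = M * x"
  have v: "q * M * x = q * v" "M * (q * x) = q * v"
    by (simp_all add: v_def)
  show "x ^ 3 * block_B q m (q * x) = - (q powi m) * x\<^sup>2 * block_B q m x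
            + (q powi m - q * (q powi m)\<^sup>2 * x\<^sup>2) * block_B q (m + 1) x"
  proof -
    define z where "z = 1 / (q * x)"
    have z: "q * z = y" "q / (q * x) = 1 / x"
      using x assms(1) by (simp_all add: y_def z_def)
    have B2: "block_B q m (q * x) = c * d * (M * X) * hahn q (q * v) z"
      unfolding block_B_small[OF assms(1,2) qx] M X M_def[symmetric] v z(2) z_def[symmetric] 
         c_def[symmetric] d_def[symmetric] ..
    have "x ^ 3 * (c * d * (M * X) * hahn q (q * v) z) =
        - M * x\<^sup>2 * (a * b * X * hahn q v y) + (M - q * M\<^sup>2 * x\<^sup>2) * (a * b * (X * x) * hahn q (q * v) y)"
      unfolding ac
      using hahn_rec[OF assms(2), of v y] hahn_shift_y[OF assms(2), of "q * v" z] xy unfolding z v_def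
      by algebra
    then show ?thesis
      unfolding B2 unfolding block_B_small[OF assms] M X M_def[symmetric] X_def[symmetric] v v_def[symmetric] 
         a_def[symmetric] b_def[symmetric] y_def[symmetric] .
  qed
qed

lemma int_shift_invariant:
  fixes f :: "int \<Rightarrow> 'a"
  assumes "\<And>m. f (m + 1) = f m"
  shows "f m = f n"
proof -
  have "f k = f 0" for k
  proof (induction k rule: int_induct[of _ 0])
    case (step2 i)
    then show ?case using assms[of "i - 1"] by simp
  qed (use assms in auto)
  then show ?thesis by metis
qed

lemma small_wronskian:
  assumes "q \<noteq> 0" "norm q < 1" "x \<in> generic q"
  shows "block_A q m x * block_B q (m + 1) x - block_B q m x * block_A q (m + 1) x = x powi (3 * m + 3)"
proof -
  have x: "x \<noteq> 0"
    using assms(3) by (rule generic_nonzero)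
  \<comment> \<open>The recurrence multiplies the determinant by x^3 at each step, so this quotient
    does not depend on \<open>m\<close>.\<close>
  define D where "D m = (block_A q m x * block_B q (m + 1) x - block_B q m x * block_A q (m + 1) x) / x powi (3 * m)" for m
  have x3: "x powi (3 * (k + 1)) = x ^ 3 * x powi (3 * k)" for k
    unfolding power_int_triple[OF x] using x by (simp add: power_int_add power3_eq_cube)
  have "D (k + 1) = D k" for k
  proof -
    have k2: "k + 1 + 1 = k + 2" by simp
    have "block_A q (k + 1) x * block_B q (k + 2) x - block_B q (k + 1) x * block_A q (k + 2) x
        = x ^ 3 * (block_A q k x * block_B q (k + 1) x - block_B q k x * block_A q (k + 1) x)"
      using small_rec[OF assms, of k] by algebra
    then show ?thesis
      unfolding D_def x3 k2 using x by simp
  qed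
  then have const: "D k = D 0" for k
    by (rule int_shift_invariant)
  define a b c d where "a = qpoch_inf x q" and "b = qpoch_inf (q / x) q"
    and "c = qpoch_inf (q * x) q" and "d = qpoch_inf (1 / x) q"
  note abcd = this
  have nz: "a \<noteq> 0" "b \<noteq> 0" "c \<noteq> 0" "d \<noteq> 0"
    using qpoch_inf_generic[OF assms, of 0] qpoch_inf_generic[OF assms, of 1] by (simp_all add: abcd)
  have ac: "a = (1 - x) * c" "d = (1 - 1 / x) * b"
    using qpoch_inf_Suc[OF assms(2), of x] qpoch_inf_Suc[OF assms(2), of "1 / x"] by (simp_all add: abcd)
  \<comment> \<open>Here \<open>w\<close> plays the role of q^m. Unlike the separate blocks, this
    normalised determinant has no remaining power of x depending on \<open>m\<close> and is
    continuous at w = 0, which makes the limit available.\<close>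
  define E where "E w = (x * hahn q (w * x\<^sup>2) x * hahn q (q * w * x) (1 / x)
      - x\<^sup>2 * hahn q (w * x) (1 / x) * hahn q (q * w * x\<^sup>2) x) * (a * b / (c * d)\<^sup>2)" for w
  have DE: "D (int n) = E (q ^ n)" for n
  proof -
    define X where "X = x ^ n"
    have X: "x powi (2 * int n) = X * X" "x powi (2 * (int n + 1)) = X * X * x\<^sup>2" "x powi int n = X"
       "x powi (int n + 1) = X * x" "x powi (3 * int n) = X * X * X" "q powi (int n + 1) = q * q ^ n"
      unfolding power_int_double[OF x] power_int_triple[OF x] X_def using x assms(1)
      by (simp_all add: power_int_add power2_eq_square)
    have "X \<noteq> 0"
      using x by (simp add: X_def)
    then have alg: "(X * X * h1 / K * (a * b * (X * x) * h2) - a * b * X * h3 * (X * X * x\<^sup>2 * h4 / K)) / (X * X * X)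
        = (x * h1 * h2 - x\<^sup>2 * h3 * h4) * (a * b / K)" for h1 h2 h3 h4 K
      by (cases "K = 0") (simp_all add: divide_simps, simp add: algebra_simps)
    show ?thesis
      unfolding D_def E_def block_A_small[OF assms] block_B_small[OF assms] X power_int_of_nat X_def[symmetric] abcd[symmetric]
      by (rule alg)
  qed
  have cont: "isCont (\<lambda>w. hahn q (w * s) y) 0" "isCont (\<lambda>w. hahn q (q * w * s) y) 0" for s y
    using isCont_o2[OF _ isCont_hahn[OF assms(2)], of 0 "\<lambda>w. w * s"] 
      isCont_o2[OF _ isCont_hahn[OF assms(2)], of 0 "\<lambda>w. q * w * s"] by simp_all
  have "isCont E 0"
    unfolding E_def by (intro continuous_intros cont)
  moreover have "(\<lambda>n. q ^ n) \<longlonglongrightarrow> 0"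
    using assms(2) by (rule LIMSEQ_power_zero)
  ultimately have "(\<lambda>n. E (q ^ n)) \<longlonglongrightarrow> E 0"
    by (rule isCont_tendsto_compose)
  then have "D 0 = E 0"
    unfolding DE[symmetric] const[of "int _"] by (simp add: LIMSEQ_const_iff)
  \<comment> \<open>At w = 0 each series reduces to its constant term (qy;q)_inf, which is
    \<open>c\<close> for y = x and \<open>b\<close> for y = 1/x. The relations between
    \<open>a\<close>, \<open>c\<close> and between \<open>d\<close>, \<open>b\<close> then cancel
    every infinite product.\<close>
  also have "E 0 = (x * c * b - x\<^sup>2 * b * c) * (a * b / (c * d)\<^sup>2)"
    by (simp add: E_def hahn_0 abcd)
  also have "\<dots> = x ^ 3"
  proof -
    have "1 - x \<noteq> 0" "x - 1 \<noteq> 0"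
      using nz ac by auto
    then show ?thesis
      using nz x unfolding ac by (simp add: divide_simps) (simp add: power2_eq_square power3_eq_cube algebra_simps)
  qed
  finally have "D m = x ^ 3"
    using const by metis
  then show ?thesis
    using x by (simp add: D_def power_int_add divide_simps mult_ac)
qed

section \<open>Extension of the difference equations to |q| > 1\<close>

lemma admissible_cases:
  assumes "admissible q"
  obtains (small) "q \<noteq> 0" "norm q < 1" | (large) p where "p \<noteq> 0" "norm p < 1" "q = inverse p"
proof (cases "norm q < 1")
  case True
  then show ?thesis
    using assms small by (simp add: admissible_def)
next
  case False
  then have "norm (inverse q) < 1"
    using assms by (auto simp: admissible_def norm_inverse intro: inverse_less_1_iff[THEN iffD2])
  then show ?thesis
    using assms large[of "inverse q"] by (simp add: admissible_def)
qed

lemma admissible_inverse: "admissible q \<Longrightarrow> admissible (inverse q)"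
  by (auto simp: admissible_def norm_inverse)

lemma block_inverse:
  assumes "admissible q" "x \<in> generic q"
  shows "block_A (inverse q) m x = x powi (3 * m) * block_B q (- m) x"
    and "block_B (inverse q) m x = x powi (3 * m) * block_A q (- m) x"
proof -
  have x: "x \<noteq> 0"
    using assms(2) by (rule generic_nonzero)
  then have powi: "x powi (3 * m) * x powi (3 * (- m)) = 1"
    by (simp flip: power_int_add)
  have "block_A (inverse q) m x = x powi (3 * m) * block_B q (- m) x \<and>
    block_B (inverse q) m x = x powi (3 * m) * block_A q (- m) x"
    using assms(1)
  proof (cases rule: admissible_cases)
    case small
    then show ?thesis
      using block_inverse_small assms(2) by blast
  next
    case (large p)
    then have "x \<in> generic p"
      using assms(2) by (simp add: generic_inverse)
    from block_inverse_small[OF large(1,2) this, of "- m"] show ?thesis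
      using powi by (simp add: large(3) flip: mult.assoc)
  qed
  then show "block_A (inverse q) m x = x powi (3 * m) * block_B q (- m) x"
    and "block_B (inverse q) m x = x powi (3 * m) * block_A q (- m) x"
    by blast+
qed

text \<open>Reading the recurrence backwards interchanges the outer coefficients 1 and x^3; the
  weight x^(3m) restores their places, and \<open>m -> -m\<close> turns q^(m+1) into its
  inverse.\<close>

lemma rec_inverse:
  fixes g :: "int \<Rightarrow> complex"
  assumes "p \<noteq> 0" "x \<noteq> 0"
    and "\<And>m. g (m + 2) = (x\<^sup>2 + x - p powi (m + 1) * x ^ 3) * g (m + 1) - x ^ 3 * g m"
  shows "x powi (3 * (m + 2)) * g (- (m + 2)) =
    (x\<^sup>2 + x - inverse p powi (m + 1) * x ^ 3) * (x powi (3 * (m + 1)) * g (- (m + 1)))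
      - x ^ 3 * (x powi (3 * m) * g (- m))"
proof -
  have p: "inverse p powi (m + 1) = p powi (- m - 1)"
    by (simp add: power_int_inverse flip: power_int_minus)
  have X: "x powi (3 * (m + 1)) = x ^ 3 * x powi (3 * m)" "x powi (3 * (m + 2)) = x ^ 6 * x powi (3 * m)"
    using assms(2) by (simp_all add: power_int_add distrib_left)
  have i: "- (m + 2) + 2 = - m" "- (m + 2) + 1 = - m - 1" "- (m + 1) = - m - 1"
    by simp_all
  show ?thesis
    using assms(3)[of "- (m + 2)"] unfolding p X i by algebra
qed

lemma block_rec:
  assumes "admissible q" "x \<in> generic q"
  shows "block_A q (m + 2) x = (x\<^sup>2 + x - q powi (m + 1) * x ^ 3) * block_A q (m + 1) x - x ^ 3 * block_A q m x"
    and "block_B q (m + 2) x = (x\<^sup>2 + x - q powi (m + 1) * x ^ 3) * block_B q (m + 1) x - x ^ 3 * block_B q m x"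
proof -
  have "block_A q (m + 2) x = (x\<^sup>2 + x - q powi (m + 1) * x ^ 3) * block_A q (m + 1) x - x ^ 3 * block_A q m x \<and>
    block_B q (m + 2) x = (x\<^sup>2 + x - q powi (m + 1) * x ^ 3) * block_B q (m + 1) x - x ^ 3 * block_B q m x"
    using assms(1)
  proof (cases rule: admissible_cases)
    case small
    then show ?thesis
      using small_rec assms(2) by blast
  next
    case (large p)
    then have g: "x \<in> generic p"
      using assms(2) by (simp add: generic_inverse)
    show ?thesis
      using rec_inverse[where g = "\<lambda>m. block_A p m x", OF large(1) generic_nonzero[OF g] small_rec(1)[OF large(1,2) g]]
        rec_inverse[where g = "\<lambda>m. block_B p m x", OF large(1) generic_nonzero[OF g] small_rec(2)[OF large(1,2) g]]
      unfolding large(3) block_inverse_small[OF large(1,2) g] by blast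
  qed
  then show "block_A q (m + 2) x = (x\<^sup>2 + x - q powi (m + 1) * x ^ 3) * block_A q (m + 1) x - x ^ 3 * block_A q m x"
    "block_B q (m + 2) x = (x\<^sup>2 + x - q powi (m + 1) * x ^ 3) * block_B q (m + 1) x - x ^ 3 * block_B q m x"
    by blast+
qed

text \<open>For |q| > 1 the inversion both swaps the two blocks and reverses the order of the two
  rows. The two signs cancel, and the weights x^(3m) and x^(3(m+1)) account for the power of
  \<open>x\<close>.\<close>

lemma block_wronskian:
  assumes "admissible q" "x \<in> generic q"
  shows "block_A q m x * block_B q (m + 1) x - block_B q m x * block_A q (m + 1) x = x powi (3 * m + 3)"
  using assms(1)
proof (cases rule: admissible_cases)
  case small
  then show ?thesis
    using small_wronskian assms(2) by blast
next
  case (large p)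
  then have g: "x \<in> generic p"
    using assms(2) by (simp add: generic_inverse)
  have x: "x \<noteq> 0"
    using assms(2) by (rule generic_nonzero)
  have "block_A p (- (m + 1)) x * block_B p (- m) x - block_B p (- (m + 1)) x * block_A p (- m) x = x powi (- (3 * m))"
    using small_wronskian[OF large(1,2) g, of "- (m + 1)"] by simp
  moreover have "x powi (3 * m) * x powi (- (3 * m)) = 1" "x powi (3 * m + 3) = x powi (3 * (m + 1))"
    using x by (simp_all add: distrib_left flip: power_int_add)
  moreover have "x powi (3 * m) * block_B p (- m) x * (x powi (3 * (m + 1)) * block_A p (- (m + 1)) x)
      - x powi (3 * m) * block_A p (- m) x * (x powi (3 * (m + 1)) * block_B p (- (m + 1)) x)
    = x powi (3 * (m + 1)) * (x powi (3 * m) *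
       (block_A p (- (m + 1)) x * block_B p (- m) x - block_B p (- (m + 1)) x * block_A p (- m) x))"
    by (simp only: right_diff_distrib mult_ac)
  ultimately show ?thesis
    unfolding large(3) block_inverse_small[OF large(1,2) g] by simp
qed

text \<open>In base 1/p the shift leads from \<open>p * x\<close> back to \<open>x\<close>, so
  \<open>g\<close> is to be recovered from \<open>g'\<close>, the values at \<open>p * x\<close>.
  Two instances of the relation together with the recurrence allow this.\<close>

lemma first_inverse:
  fixes g g' :: "int \<Rightarrow> complex"
  assumes "p \<noteq> 0" "x \<noteq> 0"
    and rec: "\<And>m. g (m + 2) = (x\<^sup>2 + x - p powi (m + 1) * x ^ 3) * g (m + 1) - x ^ 3 * g m"
    and first: "\<And>m. x ^ 3 * g' m = - (p powi m) * x\<^sup>2 * g m + (p powi m - p * (p powi m)\<^sup>2 * x\<^sup>2) * g (m + 1)"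
  shows "(p * x) ^ 3 * (x powi (3 * m) * g (- m)) =
     - (inverse p powi m) * (p * x)\<^sup>2 * ((p * x) powi (3 * m) * g' (- m))
     + (inverse p powi m - inverse p * (inverse p powi m)\<^sup>2 * (p * x)\<^sup>2) *
       ((p * x) powi (3 * (m + 1)) * g' (- (m + 1)))"
proof -
  \<comment> \<open>The smaller of the two reversed indices -(m+1) and -m, so that
    \<open>first\<close> is needed at \<open>k\<close> and \<open>k + 1\<close> and the recurrence
    at \<open>k\<close>.\<close>
  define k where "k = - (m + 1)"
  define P where "P = p powi k"
  define X where "X = x powi (3 * m)"
  have P: "p powi (k + 1) = p * P" "P \<noteq> 0"
    using assms(1) by (simp_all add: P_def power_int_add)
  have ip: "inverse p powi m = p * P"
    unfolding P(1)[symmetric] k_def by (simp add: power_int_inverse flip: power_int_minus)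
  have "(p * x) powi (3 * m) * (p * P) ^ 3 = X"
  proof -
    have "p powi (3 * m) * (p powi (k + 1)) ^ 3 = 1"
      unfolding power_int_triple[OF assms(1)] k_def using assms(1) 
      by (simp add: power_int_minus field_simps power3_eq_cube)
    then show ?thesis
      unfolding P(1) X_def by (simp add: power_int_mult_distrib mult_ac)
  qed
  moreover have "(p * x) powi (3 * (m + 1)) = (p * x) ^ 3 * (p * x) powi (3 * m)"
    using assms(1,2) by (simp add: power_int_add distrib_left)
  moreover define Y where "Y = (p * x) powi (3 * m)"
  ultimately have Y: "X = Y * (p * P) ^ 3" "(p * x) powi (3 * (m + 1)) = (p * x) ^ 3 * Y"
    by simp_all
  have i: "- m = k + 1" "- (m + 1) = k" "k + 1 + 1 = k + 2"
    by (simp_all add: k_def)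
  have e: "x ^ 3 * g' k = - P * x\<^sup>2 * g k + (P - p * P\<^sup>2 * x\<^sup>2) * g (k + 1)"
    "x ^ 3 * g' (k + 1) = - (p * P) * x\<^sup>2 * g (k + 1) + (p * P - p * (p * P)\<^sup>2 * x\<^sup>2) * g (k + 2)"
    "g (k + 2) = (x\<^sup>2 + x - p * P * x ^ 3) * g (k + 1) - x ^ 3 * g k"
    using first[of k] first[of "k + 1"] rec[of k] unfolding P(1) i(3) P_def[symmetric] by simp_all
  \<comment> \<open>The extra factor \<open>x\<close> completes the powers needed to have both
    values of \<open>g'\<close> multiplied by x^3, as in \<open>first\<close>.\<close>
  have "x * ((p * x) ^ 3 * (Y * (p * P) ^ 3 * g (k + 1))) =
     x * (- (p * P) * (p * x)\<^sup>2 * (Y * g' (k + 1)) + (p * P - P * (p * P) * (p * x)\<^sup>2) * ((p * x) ^ 3 * Y * g' k))"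
  proof -
    have "x * (- (p * P) * (p * x)\<^sup>2 * (Y * g' (k + 1)) + (p * P - P * (p * P) * (p * x)\<^sup>2) * ((p * x) ^ 3 * Y * g' k))
       = Y * ((p * P - P * (p * P) * (p * x)\<^sup>2) * p ^ 3 * x * (x ^ 3 * g' k) - (p * P) * p\<^sup>2 * (x ^ 3 * g' (k + 1)))"
      by (simp add: algebra_simps power2_eq_square power3_eq_cube)
    also have "\<dots> = x * ((p * x) ^ 3 * (Y * (p * P) ^ 3 * g (k + 1)))"
      unfolding e by (simp add: algebra_simps power2_eq_square power3_eq_cube)
    finally show ?thesis ..
  qed
  then have "(p * x) ^ 3 * (Y * (p * P) ^ 3 * g (k + 1)) =
     - (p * P) * (p * x)\<^sup>2 * (Y * g' (k + 1)) + (p * P - P * (p * P) * (p * x)\<^sup>2) * ((p * x) ^ 3 * Y * g' k)"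
    using assms(2) by simp
  moreover have "inverse p * (p * P)\<^sup>2 = P * (p * P)"
    using assms(1) by (simp add: power2_eq_square)
  ultimately show ?thesis
    unfolding ip i X_def[symmetric] Y(2) Y_def[symmetric] unfolding Y(1) by simp
qed

lemma block_first:
  assumes "admissible q" "x \<in> generic q"
  shows "x ^ 3 * block_A q m (q * x) = - (q powi m) * x\<^sup>2 * block_A q m x
            + (q powi m - q * (q powi m)\<^sup>2 * x\<^sup>2) * block_A q (m + 1) x"
    and "x ^ 3 * block_B q m (q * x) = - (q powi m) * x\<^sup>2 * block_B q m x
            + (q powi m - q * (q powi m)\<^sup>2 * x\<^sup>2) * block_B q (m + 1) x"
proof -
  have "x ^ 3 * block_A q m (q * x) = - (q powi m) * x\<^sup>2 * block_A q m x
            + (q powi m - q * (q powi m)\<^sup>2 * x\<^sup>2) * block_A q (m + 1) x \<and>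
       x ^ 3 * block_B q m (q * x) = - (q powi m) * x\<^sup>2 * block_B q m x
            + (q powi m - q * (q powi m)\<^sup>2 * x\<^sup>2) * block_B q (m + 1) x"
    using assms(1)
  proof (cases rule: admissible_cases)
    case small
    then show ?thesis
      using small_first assms(2) by blast
  next
    case (large p)
    \<comment> \<open>In terms of p = 1/q the pair of points \<open>x\<close>, \<open>q * x\<close>
      is \<open>p * y\<close>, \<open>y\<close>, which is the form of
      \<open>first_inverse\<close>.\<close>
    define y where "y = q * x"
    have x: "x = p * y" 
      using large by (simp add: y_def)
    have "q \<noteq> 0"
      using assms(1) by (simp add: admissible_def)
    then have "y \<in> generic q"
      unfolding y_def using assms(2) by (rule generic_mult)
    then have y: "y \<in> generic p" and gx: "p * y \<in> generic p"
      using assms(2) by (simp_all add: large(3) generic_inverse flip: x)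
    show ?thesis
      using first_inverse[where g = "\<lambda>m. block_A p m y", OF large(1) generic_nonzero[OF y] small_rec(1)[OF large(1,2) y]
           small_first(1)[OF large(1,2) y]]
        first_inverse[where g = "\<lambda>m. block_B p m y", OF large(1) generic_nonzero[OF y] small_rec(2)[OF large(1,2) y]
           small_first(2)[OF large(1,2) y]]
      unfolding y_def[symmetric] unfolding x large(3) block_inverse_small[OF large(1,2) y] block_inverse_small[OF large(1,2) gx]
      by blast
  qed
  then show "x ^ 3 * block_A q m (q * x) = - (q powi m) * x\<^sup>2 * block_A q m x
            + (q powi m - q * (q powi m)\<^sup>2 * x\<^sup>2) * block_A q (m + 1) x"
    "x ^ 3 * block_B q m (q * x) = - (q powi m) * x\<^sup>2 * block_B q m x
            + (q powi m - q * (q powi m)\<^sup>2 * x\<^sup>2) * block_B q (m + 1) x"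
    by blast+
qed

section \<open>Meromorphy of the blocks\<close>

lemma meromorphic_qpoch_inf:
  assumes "norm q < 1" "f holomorphic_on -{0}"
  shows "(\<lambda>x. qpoch_inf (f x) q) meromorphic_on -{0}"
proof -
  have "(\<lambda>x. qpoch_inf (f x) q) holomorphic_on -{0}"
    using holomorphic_on_compose_gen[OF assms(2) holomorphic_qpoch_inf[OF assms(1)] subset_UNIV]
    unfolding o_def .
  then show ?thesis
    by (intro analytic_on_imp_meromorphic_on) (simp add: analytic_on_open open_Compl)
qed

lemma meromorphic_hahn:
  assumes "norm q < 1" "f holomorphic_on -{0}" "g holomorphic_on -{0}"
  shows "(\<lambda>x. hahn q (f x) (g x)) meromorphic_on -{0}"
  using holomorphic_hahn[OF assms(1) _ assms(2,3)]
  by (intro analytic_on_imp_meromorphic_on) (simp add: analytic_on_open open_Compl)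

lemma small_mero_family:
  assumes "q \<noteq> 0" "norm q < 1"
  shows "mero_family (block_A q)" "mero_family (block_B q)"
proof -
  have gen: "\<forall>\<^sub>\<approx>x\<in>-{0}. x \<in> generic q"
    using assms by (intro eventually_generic) (auto simp: admissible_def)
  have A: "(\<lambda>x. x powi (2 * m) * hahn q (q powi m * x\<^sup>2) x / (qpoch_inf (q * x) q * qpoch_inf (1 / x) q)\<^sup>2)
      meromorphic_on -{0}" for m
    by (intro meromorphic_intros meromorphic_hahn meromorphic_qpoch_inf assms holomorphic_intros) auto
  have B: "(\<lambda>x. qpoch_inf x q * qpoch_inf (q / x) q * x powi m * hahn q (q powi m * x) (1 / x))
      meromorphic_on -{0}" for m
    by (intro meromorphic_intros meromorphic_hahn meromorphic_qpoch_inf assms holomorphic_intros) auto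
  have "block_A q m meromorphic_on -{0}" for m
  proof (subst meromorphic_on_cong'[OF _ refl])
    show "\<forall>\<^sub>\<approx>x\<in>-{0}. block_A q m x = x powi (2 * m) * hahn q (q powi m * x\<^sup>2) x / (qpoch_inf (q * x) q * qpoch_inf (1 / x) q)\<^sup>2"
      using gen by eventually_elim (rule block_A_small[OF assms])
  qed (rule A)
  moreover have "block_B q m meromorphic_on -{0}" for m
  proof (subst meromorphic_on_cong'[OF _ refl])
    show "\<forall>\<^sub>\<approx>x\<in>-{0}. block_B q m x = qpoch_inf x q * qpoch_inf (q / x) q * x powi m * hahn q (q powi m * x) (1 / x)"
      using gen by eventually_elim (rule block_B_small[OF assms])
  qed (rule B)
  ultimately show "mero_family (block_A q)" "mero_family (block_B q)"
    by (auto simp: mero_family_def)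
qed

lemma mero_family_block:
  assumes "admissible q"
  shows "mero_family (block_A q)" "mero_family (block_B q)"
proof -
  have "mero_family (block_A q) \<and> mero_family (block_B q)"
    using assms
  proof (cases rule: admissible_cases)
    case small
    then show ?thesis
      using small_mero_family by blast
  next
    case (large p)
    have gen: "\<forall>\<^sub>\<approx>x\<in>-{0}. x \<in> generic p"
      using large by (intro eventually_generic) (auto simp: admissible_def)
    have mero: "block_A p m meromorphic_on -{0}" "block_B p m meromorphic_on -{0}" for m
      using small_mero_family[OF large(1,2)] by (auto simp: mero_family_def)
    have "block_A q m meromorphic_on -{0}" for m
    proof (subst meromorphic_on_cong'[OF _ refl])
      show "\<forall>\<^sub>\<approx>x\<in>-{0}. block_A q m x = x powi (3 * m) * block_B p (- m) x"
        using gen unfolding large(3) by eventually_elim (rule block_inverse_small[OF large(1,2)])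
      show "(\<lambda>x. x powi (3 * m) * block_B p (- m) x) meromorphic_on -{0}"
        by (intro meromorphic_intros mero)
    qed
    moreover have "block_B q m meromorphic_on -{0}" for m
    proof (subst meromorphic_on_cong'[OF _ refl])
      show "\<forall>\<^sub>\<approx>x\<in>-{0}. block_B q m x = x powi (3 * m) * block_A p (- m) x"
        using gen unfolding large(3) by eventually_elim (rule block_inverse_small[OF large(1,2)])
      show "(\<lambda>x. x powi (3 * m) * block_A p (- m) x) meromorphic_on -{0}"
        by (intro meromorphic_intros mero)
    qed
    ultimately show ?thesis
      by (auto simp: mero_family_def)
  qed
  then show "mero_family (block_A q)" "mero_family (block_B q)"
    by blast+
qed

section \<open>Operators\<close>

lemma eval3_pCons: "eval3 (pCons a p) x M q = poly (poly a [:M:]) q + x * eval3 p x M q"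
  by (simp add: eval3_def)

lemma eval3_smult: "eval3 (smult c p) x M q = poly (poly c [:M:]) q * eval3 p x M q"
  by (simp add: eval3_def)

lemma eval3_0 [simp]: "eval3 0 x M q = 0"
  by (simp add: eval3_def)

lemma eval3_1 [simp]: "eval3 1 x M q = 1"
  by (simp add: eval3_def)

lemma eval3_add [simp]: "eval3 (a + b) x M q = eval3 a x M q + eval3 b x M q"
  by (simp add: eval3_def)

lemma eval3_minus [simp]: "eval3 (- a) x M q = - eval3 a x M q"
  by (simp add: eval3_def)

lemma eval3_mult [simp]: "eval3 (a * b) x M q = eval3 a x M q * eval3 b x M q"
  by (simp add: eval3_def)

lemma eval3_prod: "eval3 (prod g K) x M q = (\<Prod>k\<in>K. eval3 (g k) x M q)"
  by (induction K rule: infinite_finite_induct) auto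

lemma poly_poly_const: "poly (poly a c) q = poly (poly a [:poly c q:]) q"
  for a :: "complex poly poly"
  by (induction a) auto

lemma eval3_shift: "eval3 (poly3_shift i j p) x M q = eval3 p (q ^ i * x) (q ^ j * M) q"
proof (induction p)
  case 0
  then show ?case by (simp add: poly3_shift_def)
next
  case (pCons a p)
  have "poly3_shift i j (pCons a p) = [:pcompose a [:0, [:0, 1:] ^ j:]:] + [:0, [:[:0, 1:] ^ i:]:] * poly3_shift i j p"
    unfolding poly3_shift_def by (subst map_poly_pCons) (auto simp: pcompose_pCons pcompose_0)
  moreover have "poly (poly (pcompose a [:0, [:0, 1:] ^ j:]) [:M:]) q = poly (poly a [:q ^ j * M:]) q"
    unfolding poly_pcompose
    by (subst poly_poly_const) (simp add: poly_monom mult.commute flip: monom_altdef)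
  ultimately show ?case
    using pCons by (simp add: eval3_pCons eval3_smult)
qed

text \<open>Freezing \<open>x\<close> and \<open>q\<close> leaves a univariate polynomial in M, to
  which the irreducibility of the recurrence in \<open>m\<close> can be applied.\<close>

lemma eval3_poly_M: "\<exists>P. \<forall>M. poly P M = eval3 p x M q"
proof (induction p)
  case 0
  show ?case by (rule exI[of _ 0]) simp
next
  case (pCons a p)
  from pCons.IH obtain P where P: "\<forall>M. poly P M = eval3 p x M q" ..
  have "poly (map_poly (\<lambda>c. poly c q) b) M = poly (poly b [:M:]) q" for b :: "complex poly poly" and M
    by (induction b) (auto simp: map_poly_pCons)
  then show ?case
    using P by (intro exI[of _ "map_poly (\<lambda>c. poly c q) a + smult x P"]) (simp add: eval3_pCons)
qed

lemma eval3_eq_0_imp: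
  assumes S: "infinite S" and T: "\<And>q. q \<in> S \<Longrightarrow> infinite (T q)"
    and eval: "\<And>q x M. q \<in> S \<Longrightarrow> x \<in> T q \<Longrightarrow> eval3 p x M q = 0"
  shows "p = 0"
proof -
  have inf0: "r = 0" if "infinite U" "\<And>z. z \<in> U \<Longrightarrow> poly r z = 0" for U and r :: "complex poly"
  proof (rule ccontr)
    assume "r \<noteq> 0"
    then have "finite {z. poly r z = 0}" by (rule poly_roots_finite)
    with that show False by (metis (mono_tags, lifting) finite_subset mem_Collect_eq subsetI)
  qed
  have 1: "poly (poly (coeff p i) [:M:]) q = 0" if q: "q \<in> S" for i M q
  proof -
    define r where "r = map_poly (\<lambda>c. poly (poly c [:M:]) q) p"
    have "poly r x = eval3 p x M q" for x
      unfolding r_def by (induction p) (auto simp: map_poly_pCons eval3_pCons)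
    then have "r = 0"
      using inf0[OF T[OF q]] eval[OF q] by metis
    then have "coeff r i = 0" by simp
    then show ?thesis by (simp add: r_def coeff_map_poly)
  qed
  have 2: "poly (coeff (coeff p i) j) q = 0" if q: "q \<in> S" for i j q
  proof -
    define r where "r = map_poly (\<lambda>c. poly c q) (coeff p i)"
    have "poly (map_poly (\<lambda>c. poly c q) b) M = poly (poly b [:M:]) q" for b :: "complex poly poly" and M
      by (induction b) (auto simp: map_poly_pCons)
    then have "r = 0"
      using inf0[of UNIV r] 1[OF q] by (simp add: r_def infinite_UNIV_char_0)
    then have "coeff r j = 0" by simp
    then show ?thesis by (simp add: r_def coeff_map_poly)
  qed
  have "coeff (coeff p i) j = 0" for i j
    using inf0[OF S 2] by simp
  then show ?thesis
    by (simp add: poly_eq_iff)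
qed

text \<open>Reduces laws about nested polynomials, such as those of \<open>poly3_shift\<close>, to
  the corresponding substitutions in functions.\<close>

lemma eval3_eqI:
  assumes "\<And>x M q. eval3 a x M q = eval3 b x M q"
  shows "a = b"
proof -
  have "a + - b = 0"
    by (rule eval3_eq_0_imp[of UNIV "\<lambda>_. UNIV"])
       (simp_all add: assms infinite_UNIV_char_0 del: add_uminus_conv_diff)
  then show ?thesis by simp
qed

text \<open>The points at which \<open>rf_eval\<close> is determined. It is compatible with the
  field operations only at such points.\<close>

definition regular :: "rf \<Rightarrow> complex \<Rightarrow> complex \<Rightarrow> complex \<Rightarrow> bool" where
  "regular r x M q \<longleftrightarrow> (\<exists>a b. r = Fract a b \<and> eval3 b x M q \<noteq> 0)"

lemma regularE:
  assumes "regular r x M q"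
  obtains a b where "r = Fract a b" "b \<noteq> 0" "eval3 b x M q \<noteq> 0"
  using assms unfolding regular_def by (metis eval3_0)

text \<open>By cross multiplication all representations with nonvanishing denominator at the point
  give the same value, so the definite description is resolved.\<close>

lemma rf_eval_Fract:
  assumes "eval3 b x M q \<noteq> 0"
  shows "rf_eval (Fract a b) x M q = eval3 a x M q / eval3 b x M q"
  unfolding rf_eval_def
proof (rule the_equality)
  show "\<exists>a' b'. Fract a b = Fract a' b' \<and> eval3 b' x M q \<noteq> 0 \<and> eval3 a x M q / eval3 b x M q = eval3 a' x M q / eval3 b' x M q"
    using assms by blast
  fix v assume "\<exists>a' b'. Fract a b = Fract a' b' \<and> eval3 b' x M q \<noteq> 0 \<and> v = eval3 a' x M q / eval3 b' x M q"
  then obtain a' b' where *: "Fract a b = Fract a' b'" "eval3 b' x M q \<noteq> 0" "v = eval3 a' x M q / eval3 b' x M q"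
    by blast
  have "b \<noteq> 0" "b' \<noteq> 0"
    using assms * by auto
  then have "a * b' = a' * b"
    using *(1) by (simp add: eq_fract)
  then have "eval3 a x M q * eval3 b' x M q = eval3 a' x M q * eval3 b x M q"
    by (metis eval3_mult)
  then show "v = eval3 a x M q / eval3 b x M q"
    using assms *(2,3) by (simp add: frac_eq_eq)
qed

lemma regular_Fract: "eval3 b x M q \<noteq> 0 \<Longrightarrow> regular (Fract a b) x M q"
  by (auto simp: regular_def)

lemma regular_poly [simp]: "regular (Fract a 1) x M q"
  by (rule regular_Fract) simp

lemma rf_eval_poly: "rf_eval (Fract a 1) x M q = eval3 a x M q"
  by (simp add: rf_eval_Fract)

lemma regular_0 [simp]: "regular 0 x M q" and rf_eval_0 [simp]: "rf_eval 0 x M q = 0"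
  by (simp_all add: Zero_fract_def rf_eval_poly)

lemma regular_1 [simp]: "regular 1 x M q" and rf_eval_1 [simp]: "rf_eval 1 x M q = 1"
  by (simp_all add: One_fract_def rf_eval_poly)

lemma regular_x [simp]: "regular x_rf x M q" and rf_eval_x [simp]: "rf_eval x_rf x M q = x"
  and regular_M [simp]: "regular M_rf x M q" and rf_eval_M [simp]: "rf_eval M_rf x M q = M"
  and regular_q [simp]: "regular q_rf x M q" and rf_eval_q [simp]: "rf_eval q_rf x M q = q"
  by (simp_all add: x_rf_def M_rf_def q_rf_def rf_eval_poly eval3_def)

lemma
  assumes "regular r x M q" "regular s x M q"
  shows regular_add: "regular (r + s) x M q"
    and rf_eval_add: "rf_eval (r + s) x M q = rf_eval r x M q + rf_eval s x M q"
    and regular_mult: "regular (r * s) x M q"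
    and rf_eval_mult: "rf_eval (r * s) x M q = rf_eval r x M q * rf_eval s x M q"
proof -
  obtain a b where r: "r = Fract a b" "b \<noteq> 0" "eval3 b x M q \<noteq> 0"
    using assms(1) by (rule regularE)
  obtain c d where s: "s = Fract c d" "d \<noteq> 0" "eval3 d x M q \<noteq> 0"
    using assms(2) by (rule regularE)
  show "regular (r + s) x M q" "regular (r * s) x M q"
    using r s by (auto intro!: regular_Fract)
  show "rf_eval (r + s) x M q = rf_eval r x M q + rf_eval s x M q"
    "rf_eval (r * s) x M q = rf_eval r x M q * rf_eval s x M q"
    using r s by (simp_all add: rf_eval_Fract add_frac_eq mult_ac)
qed

lemma
  assumes "regular r x M q"
  shows regular_minus: "regular (- r) x M q"
    and rf_eval_minus: "rf_eval (- r) x M q = - rf_eval r x M q"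
proof -
  obtain a b where r: "r = Fract a b" "b \<noteq> 0" "eval3 b x M q \<noteq> 0"
    using assms(1) by (rule regularE)
  then show "regular (- r) x M q" "rf_eval (- r) x M q = - rf_eval r x M q"
    by (simp_all add: rf_eval_Fract regular_Fract)
qed

lemma
  assumes "regular r x M q" "rf_eval r x M q \<noteq> 0"
  shows regular_inverse: "regular (inverse r) x M q"
    and rf_eval_inverse: "rf_eval (inverse r) x M q = inverse (rf_eval r x M q)"
proof -
  obtain a b where r: "r = Fract a b" "b \<noteq> 0" "eval3 b x M q \<noteq> 0"
    using assms(1) by (rule regularE)
  then have "eval3 a x M q \<noteq> 0"
    using assms(2) by (auto simp: rf_eval_Fract)
  then show "regular (inverse r) x M q" "rf_eval (inverse r) x M q = inverse (rf_eval r x M q)"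
    using r by (simp_all add: rf_eval_Fract regular_Fract)
qed

lemma
  assumes "regular r x M q"
  shows regular_power: "regular (r ^ n) x M q"
    and rf_eval_power: "rf_eval (r ^ n) x M q = rf_eval r x M q ^ n"
  using assms by (induction n) (simp_all add: regular_mult rf_eval_mult)

lemma
  assumes "regular r (q ^ i * x) (q ^ j * M) q"
  shows regular_shift: "regular (rf_shift i j r) x M q"
    and rf_eval_shift: "rf_eval (rf_shift i j r) x M q = rf_eval r (q ^ i * x) (q ^ j * M) q"
proof -
  obtain a b where r: "r = Fract a b" "b \<noteq> 0" "eval3 b (q ^ i * x) (q ^ j * M) q \<noteq> 0"
    using assms(1) by (rule regularE)
  then show "regular (rf_shift i j r) x M q" "rf_eval (rf_shift i j r) x M q = rf_eval r (q ^ i * x) (q ^ j * M) q"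
    by (simp_all add: rf_eval_Fract regular_Fract rf_shift_Fract eval3_shift)
qed

text \<open>Source of the polynomials D in \<open>annihilator\<close>: a fixed denominator controls
  regularity at all points simultaneously.\<close>

lemma rf_denominator: "\<exists>D. D \<noteq> 0 \<and> (\<forall>x M q. eval3 D x M q \<noteq> 0 \<longrightarrow> regular r x M q)"
proof (cases r)
  case (Fract a b)
  then show ?thesis
    by (auto intro!: exI[of _ b] regular_Fract)
qed

lemma poly3_shift_add: "poly3_shift i j (a + b) = poly3_shift i j a + poly3_shift i j b"
  by (rule eval3_eqI) (simp add: eval3_shift)

lemma poly3_shift_shift: "poly3_shift i j (poly3_shift k l a) = poly3_shift (i + k) (j + l) a"
  by (rule eval3_eqI) (simp add: eval3_shift power_add mult_ac)

lemma rf_shift_add: "rf_shift i j (r + s) = rf_shift i j r + rf_shift i j s"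
  by (cases r; cases s) (simp add: rf_shift_Fract poly3_shift_add poly3_shift_mult poly3_shift_eq_0_iff)

lemma rf_shift_mult: "rf_shift i j (r * s) = rf_shift i j r * rf_shift i j s"
  by (cases r; cases s) (simp add: rf_shift_Fract poly3_shift_mult poly3_shift_eq_0_iff)

lemma rf_shift_shift: "rf_shift i j (rf_shift k l r) = rf_shift (i + k) (j + l) r"
  by (cases r) (simp add: rf_shift_Fract poly3_shift_shift poly3_shift_eq_0_iff)

lemma rf_shift_0_0 [simp]: "rf_shift 0 0 r = r"
proof -
  have "poly3_shift 0 0 a = a" for a
    by (rule eval3_eqI) (simp add: eval3_shift)
  then show ?thesis
    by (cases r) (simp add: rf_shift_Fract)
qed

section \<open>The operator algebra and its action on functions\<close>

abbreviation (input) single where "single \<equiv> Poly_Mapping.single"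
abbreviation (input) lookup where "lookup \<equiv> Poly_Mapping.lookup"
abbreviation (input) keys where "keys \<equiv> Poly_Mapping.keys"

lemma poly_mapping_sum_single: "P = (\<Sum>k\<in>keys P. single k (lookup P k))"
proof (rule poly_mapping_eqI)
  fix k
  have "(\<Sum>l\<in>keys P. lookup (single l (lookup P l)) k) = (\<Sum>l\<in>keys P. if l = k then lookup P l else 0)"
    by (intro sum.cong) (auto simp: lookup_single)
  then show "lookup P k = lookup (\<Sum>k\<in>keys P. single k (lookup P k)) k"
    by (simp add: lookup_sum not_in_keys_iff_lookup_eq_zero)
qed

lemma pair_mapping_induct [case_names zero single add]:
  fixes P :: "('a \<times> 'b) \<Rightarrow>\<^sub>0 'c :: comm_monoid_add"
  assumes "Q 0" "\<And>i j r. Q (single (i, j) r)" "\<And>P P'. Q P \<Longrightarrow> Q P' \<Longrightarrow> Q (P + P')"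
  shows "Q P"
proof -
  have "Q (\<Sum>k\<in>K. single k (lookup P k))" if "finite K" for K
    using that by (induction K rule: finite_induct) (auto intro: assms simp: split_paired_all)
  then show ?thesis
    by (subst poly_mapping_sum_single) simp
qed

text \<open>The support of a sum may be smaller than the union of the supports. Summing over a
  common finite superset makes additivity a termwise statement.\<close>

lemma op_mult_superset:
  assumes "finite K" "keys P \<subseteq> K" "finite L" "keys Q \<subseteq> L"
  shows "P \<star> Q = (\<Sum>(i, j)\<in>K. \<Sum>(k, l)\<in>L. single (i + k, j + l) (lookup P (i, j) * rf_shift i j (lookup Q (k, l))))"
proof -
  have "(\<Sum>(k, l)\<in>L. single (i + k, j + l) (lookup P (i, j) * rf_shift i j (lookup Q (k, l)))) =
     (\<Sum>(k, l)\<in>keys Q. single (i + k, j + l) (lookup P (i, j) * rf_shift i j (lookup Q (k, l))))" for i j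
    using assms(3,4) by (intro sum.mono_neutral_right) (auto simp: in_keys_iff)
  then show ?thesis
    unfolding op_mult_def using assms(1,2)
    by (simp, intro sum.mono_neutral_left) (auto simp: in_keys_iff)
qed

lemma op_mult_add_left: "(P + P') \<star> Q = P \<star> Q + P' \<star> Q"
proof -
  define K where "K = keys P \<union> keys P'"
  have K: "finite K" "keys (P + P') \<subseteq> K" "keys P \<subseteq> K" "keys P' \<subseteq> K"
    using keys_add[of P P'] by (auto simp: K_def)
  have "(P + P') \<star> Q = (\<Sum>k\<in>K. \<Sum>l\<in>keys Q.
          (case k of (i, j) \<Rightarrow> case l of (k, l) \<Rightarrow> single (i + k, j + l) (lookup P (i, j) * rf_shift i j (lookup Q (k, l)))) +
          (case k of (i, j) \<Rightarrow> case l of (k, l) \<Rightarrow> single (i + k, j + l) (lookup P' (i, j) * rf_shift i j (lookup Q (k, l)))))"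
    unfolding op_mult_superset[OF K(1,2) finite_keys order_refl]
    by (intro sum.cong refl) (auto simp: lookup_add distrib_right single_add split: prod.splits intro!: sum.cong)
  also have "\<dots> = P \<star> Q + P' \<star> Q"
    unfolding op_mult_superset[OF K(1,3) finite_keys order_refl] op_mult_superset[OF K(1,4) finite_keys order_refl]
    by (simp add: sum.distrib case_prod_unfold)
  finally show ?thesis .
qed

lemma op_mult_add_right: "Q \<star> (P + P') = Q \<star> P + Q \<star> P'"
proof -
  define K where "K = keys P \<union> keys P'"
  have K: "finite K" "keys (P + P') \<subseteq> K" "keys P \<subseteq> K" "keys P' \<subseteq> K"
    using keys_add[of P P'] by (auto simp: K_def)
  show ?thesis
    unfolding op_mult_superset[OF finite_keys order_refl K(1,2)] op_mult_superset[OF finite_keys order_refl K(1,3)] 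
      op_mult_superset[OF finite_keys order_refl K(1,4)]
    by (simp add: lookup_add rf_shift_add distrib_left single_add sum.distrib case_prod_unfold)
qed

lemma op_mult_0_left [simp]: "0 \<star> Q = 0" and op_mult_0_right [simp]: "Q \<star> 0 = 0"
  by (simp_all add: op_mult_def)

text \<open>By additivity in each factor only monomials matter; for them associativity says that
  shifts are multiplicative and compose by adding exponents.\<close>

lemma op_mult_assoc: "(P \<star> Q) \<star> R = P \<star> (Q \<star> R)"
proof (induction P rule: pair_mapping_induct)
  case (single i j r)
  show ?case
  proof (induction Q rule: pair_mapping_induct)
    case (single k l s)
    show ?case
    proof (induction R rule: pair_mapping_induct)
      case (single k' l' t)
      then show ?case
        by (simp add: op_mult_single rf_shift_mult rf_shift_shift mult_ac add_ac)
    qed (simp_all add: op_mult_add_right)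
  qed (simp_all add: op_mult_add_right op_mult_add_left)
qed (simp_all add: op_mult_add_left)

definition op_regular :: "qop \<Rightarrow> complex \<Rightarrow> complex \<Rightarrow> complex \<Rightarrow> bool" where
  "op_regular P x M q \<longleftrightarrow> (\<forall>k. regular (lookup P k) x M q)"

lemma op_regular_0 [simp]: "op_regular 0 x M q"
  by (simp add: op_regular_def)

lemma op_regular_single: "op_regular (single k r) x M q \<longleftrightarrow> regular r x M q"
  by (auto simp: op_regular_def lookup_single when_def)

lemma op_regular_add: "op_regular P x M q \<Longrightarrow> op_regular Q x M q \<Longrightarrow> op_regular (P + Q) x M q"
  by (auto simp: op_regular_def lookup_add regular_add)

lemma op_regular_sum: "(\<And>k. k \<in> K \<Longrightarrow> op_regular (P k) x M q) \<Longrightarrow> op_regular (sum P K) x M q"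
  by (induction K rule: infinite_finite_induct) (auto simp: op_regular_add)

lemma op_denominator: "\<exists>D. D \<noteq> 0 \<and> (\<forall>x M q. eval3 D x M q \<noteq> 0 \<longrightarrow> op_regular P x M q)"
proof (induction P rule: pair_mapping_induct)
  case zero
  then show ?case by (auto intro!: exI[of _ 1])
next
  case (single i j r)
  then show ?case unfolding op_regular_single by (rule rf_denominator)
next
  case (add P P')
  then obtain D D' where "D \<noteq> 0" "D' \<noteq> 0" "\<forall>x M q. eval3 D x M q \<noteq> 0 \<longrightarrow> op_regular P x M q"
    "\<forall>x M q. eval3 D' x M q \<noteq> 0 \<longrightarrow> op_regular P' x M q" by blast
  then show ?case
    by (intro exI[of _ "D * D'"]) (auto simp: op_regular_add)
qed

lemma apply_op_superset:
  assumes "finite K" "keys P \<subseteq> K"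
  shows "apply_op P q f m x = (\<Sum>(i, j)\<in>K. rf_eval (lookup P (i, j)) x (q powi m) q * f (m + int j) (q ^ i * x))"
  unfolding apply_op_def using assms by (intro sum.mono_neutral_left) (auto simp: in_keys_iff)

lemma apply_op_0 [simp]: "apply_op 0 q f m x = 0"
  by (simp add: apply_op_def)

lemma apply_op_add:
  assumes "op_regular P x (q powi m) q" "op_regular Q x (q powi m) q"
  shows "apply_op (P + Q) q f m x = apply_op P q f m x + apply_op Q q f m x"
proof -
  define K where "K = keys P \<union> keys Q"
  have K: "finite K" "keys (P + Q) \<subseteq> K" "keys P \<subseteq> K" "keys Q \<subseteq> K"
    using keys_add[of P Q] by (auto simp: K_def)
  show ?thesis
    unfolding apply_op_superset[OF K(1,2)] apply_op_superset[OF K(1,3)] apply_op_superset[OF K(1,4)]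
    using assms by (simp add: lookup_add rf_eval_add op_regular_def distrib_right sum.distrib case_prod_unfold)
qed

lemma apply_op_sum:
  assumes "\<And>k. k \<in> K \<Longrightarrow> op_regular (P k) x (q powi m) q"
  shows "apply_op (sum P K) q f m x = (\<Sum>k\<in>K. apply_op (P k) q f m x)"
  using assms by (induction K rule: infinite_finite_induct) (auto simp: apply_op_add op_regular_sum)

lemma apply_op_single:
  "apply_op (single (i, j) r) q f m x = rf_eval r x (q powi m) q * f (m + int j) (q ^ i * x)"
  by (subst apply_op_superset[of "{(i, j)}"]) auto

text \<open>The product acts as composition: evaluating a shifted coefficient at a point is
  evaluating the coefficient at the shifted point. Regularity of \<open>Q\<close> is therefore
  needed at every point reached by a monomial of \<open>P\<close>.\<close>

lemma
  assumes "q \<noteq> 0" "op_regular P x (q powi m) q"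
    and "\<And>i j. (i, j) \<in> keys P \<Longrightarrow> op_regular Q (q ^ i * x) (q powi (m + int j)) q"
  shows apply_op_mult: "apply_op (P \<star> Q) q f m x =
      (\<Sum>(i, j)\<in>keys P. rf_eval (lookup P (i, j)) x (q powi m) q * apply_op Q q f (m + int j) (q ^ i * x))"
proof -
  have M: "q powi (m + int j) = q ^ j * q powi m" for j
    using assms(1) by (simp add: power_int_add)
  have reg: "regular (lookup P ij) x (q powi m) q" for ij
    using assms(2) unfolding op_regular_def ..
  have regQ: "regular (lookup Q kl) (q ^ i * x) (q ^ j * q powi m) q" if "(i, j) \<in> keys P" for i j kl
    using assms(3)[OF that] unfolding M op_regular_def ..
  have r: "op_regular (single (i + k, j + l) (lookup P (i, j) * rf_shift i j (lookup Q (k, l)))) x (q powi m) q"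
    if "(i, j) \<in> keys P" for i j k l
    using reg regQ[OF that] by (simp add: op_regular_single regular_mult regular_shift)
  have "apply_op (P \<star> Q) q f m x = (\<Sum>(i, j)\<in>keys P. \<Sum>(k, l)\<in>keys Q.
     apply_op (single (i + k, j + l) (lookup P (i, j) * rf_shift i j (lookup Q (k, l)))) q f m x)"
    unfolding op_mult_def case_prod_unfold
    by (subst apply_op_sum, use r in \<open>force intro!: op_regular_sum\<close>, intro sum.cong refl,
        subst apply_op_sum, use r in \<open>force intro!: op_regular_sum\<close>, rule refl)
  also have "\<dots> = (\<Sum>(i, j)\<in>keys P. rf_eval (lookup P (i, j)) x (q powi m) q * apply_op Q q f (m + int j) (q ^ i * x))"
    unfolding apply_op_single apply_op_def[of Q] M sum_distrib_left case_prod_unfold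
    by (intro sum.cong refl) (use reg regQ in \<open>auto simp: rf_eval_mult rf_eval_shift regular_shift power_add add_ac mult_ac\<close>)
  finally show "apply_op (P \<star> Q) q f m x =
      (\<Sum>(i, j)\<in>keys P. rf_eval (lookup P (i, j)) x (q powi m) q * apply_op Q q f (m + int j) (q ^ i * x))" .
qed

text \<open>The inductive rules allow multiples of generators only; associativity passes a left
  factor through them.\<close>

lemma left_ideal_mult:
  assumes "Q \<in> left_ideal G"
  shows "P \<star> Q \<in> left_ideal G"
  using assms
proof induction
  case (mult g Q)
  then show ?case by (simp add: left_ideal.mult flip: op_mult_assoc)
qed (auto intro: left_ideal.intros simp: op_mult_add_right)

text \<open>Makes negation a left multiplication, so that left ideals and annihilators are closed
  under differences.\<close>

lemma coeff_op_minus_one: "coeff_op (- 1) \<star> P = - P"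
proof (induction P rule: pair_mapping_induct)
  case (single i j r)
  have "single (0, 0) (- 1) \<star> single (i, j) r = - single (i, j) r"
    unfolding op_mult_single by (simp flip: single_uminus)
  then show ?case by (simp only: coeff_op_def)
qed (simp_all add: op_mult_add_right)

lemma coeff_op_one: "coeff_op 1 \<star> P = P"
proof (induction P rule: pair_mapping_induct)
  case (single i j r)
  then show ?case by (simp add: coeff_op_def op_mult_single)
qed (simp_all add: op_mult_add_right)

lemma left_ideal_gen: "g \<in> G \<Longrightarrow> g \<in> left_ideal G"
  using left_ideal.mult[of g G "coeff_op 1"] by (simp add: coeff_op_one)

lemma left_ideal_minus: "P \<in> left_ideal G \<Longrightarrow> - P \<in> left_ideal G"
  using left_ideal_mult[of P G "coeff_op (- 1)"] by (simp add: coeff_op_minus_one)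

lemma left_ideal_diff: "P \<in> left_ideal G \<Longrightarrow> Q \<in> left_ideal G \<Longrightarrow> P - Q \<in> left_ideal G"
  using left_ideal.add[OF _ left_ideal_minus] by fastforce

section \<open>Reduction modulo the ideal\<close>

lemma cosparse_scale:
  fixes c :: complex
  assumes "c \<noteq> 0" "\<forall>\<^sub>\<approx>x\<in>-{0}. P x"
  shows "\<forall>\<^sub>\<approx>x\<in>-{0}. P (c * x)"
proof -
  have "eventually (\<lambda>x. P (c * x)) (at z)" if "z \<noteq> 0" for z
  proof -
    have "eventually P (at (c * z))"
      using assms that by (intro eventually_cosparse_imp_eventually_at[OF assms(2)]) auto
    moreover have "filterlim (\<lambda>x. c * x) (at (c * z)) (at z)"
      unfolding filterlim_at
    proof
      show "\<forall>\<^sub>F x in at z. c * x \<in> UNIV \<and> c * x \<noteq> c * z"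
        using assms(1) by (auto simp: eventually_at_filter)
      show "(\<lambda>x. c * x) \<midarrow>z\<rightarrow> c * z"
        by (intro tendsto_intros)
    qed
    ultimately show ?thesis
      by (rule eventually_compose_filterlim)
  qed
  then show ?thesis
    by (subst eventually_cosparse_open_eq) (auto simp: open_Compl)
qed

text \<open>A sparse set is countable, and so is the union of the exceptional sets over all integers
  \<open>m\<close>; the complement stays uncountable.\<close>

lemma infinite_cosparse_family:
  fixes P :: "int \<Rightarrow> complex \<Rightarrow> bool"
  assumes "\<And>m. \<forall>\<^sub>\<approx>x\<in>-{0}. P m x"
  shows "infinite {x. \<forall>m. P m x}"
proof
  assume "finite {x. \<forall>m. P m x}"
  moreover have "countable (\<Union>m. (- {0}) \<inter> {x. \<not> P m x})"
    using assms by (intro countable_UN sparse_imp_countable) (auto simp: eventually_cosparse open_Compl)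
  ultimately have "countable ({x. \<forall>m. P m x} \<union> {0} \<union> (\<Union>m. (- {0}) \<inter> {x. \<not> P m x}))"
    by (intro countable_Un countable_finite[of "{x. \<forall>m. P m x}"] countable_finite[of "{0}"]) simp_all
  moreover have "{x. \<forall>m. P m x} \<union> {0} \<union> (\<Union>m. (- {0}) \<inter> {x. \<not> P m x}) = UNIV"
    by auto
  ultimately show False
    using uncountable_UNIV_complex by metis
qed

lemma infinite_admissible: "infinite {q. admissible q}"
proof
  assume fin: "finite {q. admissible q}"
  have "inj (\<lambda>n::nat. of_nat (n + 2) :: complex)"
    by (auto simp: inj_on_def)
  then have "infinite (range (\<lambda>n::nat. of_nat (n + 2) :: complex))"
    by (rule range_inj_infinite)
  moreover have "range (\<lambda>n::nat. of_nat (n + 2) :: complex) \<subseteq> {q. admissible q}"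
  proof safe
    fix n :: nat
    have "norm (of_nat (n + 2) :: complex) = real (n + 2)"
      by (rule norm_of_nat)
    moreover have "real (n + 2) \<noteq> 0" "real (n + 2) \<noteq> 1"
      by linarith+
    ultimately show "admissible (of_nat (n + 2))"
      unfolding admissible_def by (metis norm_zero)
  qed
  ultimately show False
    using fin finite_subset by blast
qed

lemma inj_powi:
  assumes "admissible q"
  shows "inj (\<lambda>n::nat. q powi int n)"
proof (rule injI)
  fix m n :: nat
  assume eq: "q powi int m = q powi int n"
  have q: "norm q > 0" "norm q \<noteq> 1"
    using assms by (auto simp: admissible_def)
  have "norm q ^ m = norm q ^ n"
    using arg_cong[OF eq, of norm] by (simp add: norm_power)
  then show "m = n"
    using q by (metis linorder_neq_iff power_strict_decreasing power_strict_increasing nle_le less_irrefl)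
qed

text \<open>The associated Riccati equation has no rational solution: in lowest terms the numerator
  and the denominator of a solution would have the same degree, but then the middle term has
  the largest degree.\<close>

lemma riccati_no_rational_solution:
  fixes a b L :: "complex poly"
  assumes q: "q \<noteq> 0" and c: "c \<noteq> 0" and L: "degree L = 1"
    and eq: "a * (a \<circ>\<^sub>p [:0, q:] + (b \<circ>\<^sub>p [:0, q:]) * L) + smult c (b * (b \<circ>\<^sub>p [:0, q:])) = 0"
  shows "a = 0 \<and> b = 0"
proof -
  define \<sigma> where "\<sigma> p = p \<circ>\<^sub>p [:0, q:]" for p :: "complex poly"
  have \<sigma>: "\<sigma> (p * r) = \<sigma> p * \<sigma> r" "degree (\<sigma> p) = degree p" "\<sigma> p = 0 \<longleftrightarrow> p = 0" 
      "\<sigma> 1 = 1" "\<sigma> (p + r) = \<sigma> p + \<sigma> r" for p r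
    using q by (auto simp: \<sigma>_def pcompose_mult degree_pcompose pcompose_eq_0_iff pcompose_add pcompose_1 intro: pcompose_eq_0)
  have eq: "a * (\<sigma> a + \<sigma> b * L) + smult c (b * \<sigma> b) = 0"
    using eq by (simp add: \<sigma>_def)
  show ?thesis
  proof (rule ccontr)
    assume nz: "\<not> (a = 0 \<and> b = 0)"
    have ab: "a \<noteq> 0" "b \<noteq> 0"
    proof -
      show "a \<noteq> 0"
      proof
        assume "a = 0"
        then have "b * \<sigma> b = 0"
          using eq c by simp
        then show False
          using \<open>a = 0\<close> nz \<sigma>(3)[of b] by simp
      qed
      show "b \<noteq> 0"
      proof
        assume "b = 0"
        then have "a * \<sigma> a = 0"
          using eq by (simp add: \<sigma>_def)
        then show False
          using \<open>b = 0\<close> nz \<sigma>(3)[of a] by simp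
      qed
    qed
    define g where "g = gcd a b"
    obtain a' b' where g: "a = a' * g" "b = b' * g" "coprime a' b'"
      using gcd_coprime_exists[of a b] ab unfolding g_def by auto
    have nz': "g \<noteq> 0" "a' \<noteq> 0" "b' \<noteq> 0"
      using ab g by auto
    have "(g * \<sigma> g) * (a' * (\<sigma> a' + \<sigma> b' * L) + smult c (b' * \<sigma> b')) = 0"
      using eq unfolding g \<sigma> by (simp add: algebra_simps)
    then have eq': "a' * (\<sigma> a' + \<sigma> b' * L) + smult c (b' * \<sigma> b') = 0"
      using nz' \<sigma>(3) by simp
    have "coprime (\<sigma> a') (\<sigma> b')"
    proof -
      obtain u v where "u * a' + v * b' = 1"
        using g(3) by (metis bezout_coefficients_fst_snd coprime_iff_gcd_eq_1)
      then have "\<sigma> u * \<sigma> a' + \<sigma> v * \<sigma> b' = 1"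
        using \<sigma> by metis
      then show ?thesis
        by (metis coprime_iff_gcd_eq_1 dvd_add dvd_mult gcd_dvd1 gcd_dvd2 is_unit_gcd)
    qed
    \<comment> \<open>The equation is read modulo a' and modulo the shift of b'. Coprimality removes
      the other factor, so a' and the shifted b' divide each other and have equal degrees.\<close>
    have "a' dvd smult c (b' * \<sigma> b')"
      using eq' by (metis dvd_add_right_iff dvd_0_right dvd_triv_left)
    then have "a' dvd b' * \<sigma> b'"
      using c by (simp add: dvd_smult_iff)
    then have "a' dvd \<sigma> b'"
      using g(3) by (simp add: coprime_dvd_mult_right_iff)
    have "\<sigma> b' dvd a' * \<sigma> a' + \<sigma> b' * (a' * L + smult c b')"
      using eq' by (simp add: algebra_simps)
    then have "\<sigma> b' dvd a' * \<sigma> a'"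
      by (simp add: dvd_add_left_iff)
    then have "\<sigma> b' dvd a'"
      using \<open>coprime (\<sigma> a') (\<sigma> b')\<close> by (simp add: coprime_dvd_mult_left_iff coprime_commute)
    have deg: "degree a' = degree b'"
      using dvd_imp_degree_le[OF \<open>a' dvd \<sigma> b'\<close>] dvd_imp_degree_le[OF \<open>\<sigma> b' dvd a'\<close>] nz' \<sigma>(2,3)
      by fastforce
    define d where "d = degree a'"
    have "L \<noteq> 0"
      using L by auto
    have "degree (a' * \<sigma> b' * L) = 2 * d + 1"
      using nz' \<sigma>(2,3) L \<open>L \<noteq> 0\<close> deg by (simp add: degree_mult_eq d_def)
    moreover have "a' * \<sigma> b' * L = - (a' * \<sigma> a' + smult c (b' * \<sigma> b'))"
      using eq' by (simp add: algebra_simps add_eq_0_iff)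
    moreover have "degree (- (a' * \<sigma> a' + smult c (b' * \<sigma> b'))) \<le> 2 * d"
      unfolding degree_minus using nz' \<sigma>(2,3) deg c
      by (intro degree_add_le) (simp_all add: degree_mult_eq d_def)
    ultimately show False
      by simp
  qed
qed

text \<open>No first-order relation with coefficients polynomial in q^m is compatible with the
  recurrence: the relation and its shift would give a rational solution of the Riccati
  equation.\<close>

lemma recurrence_irreducible:
  fixes u :: "int \<Rightarrow> complex" and a b :: "complex poly"
  assumes q: "admissible q" and x: "x \<noteq> 0"
    and rec: "\<And>m. u (m + 2) = (x\<^sup>2 + x - q powi (m + 1) * x ^ 3) * u (m + 1) - x ^ 3 * u m"
    and nz: "\<And>m. u m \<noteq> 0 \<or> u (m + 1) \<noteq> 0"
    and rel: "\<And>m. poly a (q powi m) * u m + poly b (q powi m) * u (m + 1) = 0"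
  shows "a = 0 \<and> b = 0"
proof (rule riccati_no_rational_solution)
  have q0: "q \<noteq> 0"
    using q by (simp add: admissible_def)
  show "q \<noteq> 0" by fact
  show "x ^ 3 \<noteq> 0" using x by simp
  define L where "L = [:x\<^sup>2 + x, - (q * x ^ 3):]"
  show "degree [:x\<^sup>2 + x, - (q * x ^ 3):] = 1"
    using x q0 by simp
  \<comment> \<open>The determinant of the relations at \<open>m\<close> and \<open>m + 1\<close>,
    written in u_m and u_(m+1) after eliminating u_(m+2). \<open>L\<close> is the middle coefficient
    of the recurrence as a polynomial in q^m. A nonzero pair in the kernel forces \<open>r\<close>
    to vanish at all q^m, which are infinitely many points.\<close>
  define r where "r = a * (a \<circ>\<^sub>p [:0, q:] + (b \<circ>\<^sub>p [:0, q:]) * L) + smult (x ^ 3) (b * (b \<circ>\<^sub>p [:0, q:]))"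
  have "poly r (q powi m) = 0" for m
  proof -
    define M where "M = q powi m"
    have qM: "q powi (m + 1) = q * M"
      using q0 by (simp add: M_def power_int_add)
    have i: "m + 1 + 1 = m + 2" by simp
    have e1: "poly a M * u m + poly b M * u (m + 1) = 0"
      using rel[of m] by (simp add: M_def)
    have e2: "poly a (q * M) * u (m + 1) + poly b (q * M) * ((x\<^sup>2 + x - q * M * x ^ 3) * u (m + 1) - x ^ 3 * u m) = 0"
      using rel[of "m + 1"] rec[of m] unfolding qM i by simp
    have r: "poly r M = poly a M * (poly a (q * M) + poly b (q * M) * (x\<^sup>2 + x - q * M * x ^ 3))
        + x ^ 3 * (poly b M * poly b (q * M))"
      by (simp add: r_def L_def poly_pcompose mult_ac algebra_simps)
    have "poly r M * u m = 0" "poly r M * u (m + 1) = 0"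
      unfolding r using e1 e2 by algebra+
    then show ?thesis
      using nz[of m] by (auto simp: M_def)
  qed
  then have "range (\<lambda>n::nat. q powi int n) \<subseteq> {z. poly r z = 0}"
    by blast
  moreover have "infinite (range (\<lambda>n::nat. q powi int n))"
    using inj_powi[OF q] by (rule range_inj_infinite)
  ultimately have "r = 0"
    using poly_roots_finite finite_subset by blast
  then show "a * (a \<circ>\<^sub>p [:0, q:] + (b \<circ>\<^sub>p [:0, q:]) * [:x\<^sup>2 + x, - (q * x ^ 3):]) + smult (x ^ 3) (b * (b \<circ>\<^sub>p [:0, q:])) = 0"
    by (simp add: r_def L_def)
qed

section \<open>The two generators in expanded form and their action\<close>

lemma op_mult_diff_left: "(P - Q) \<star> R = P \<star> R - Q \<star> R"
  using op_mult_add_left[of "P - Q" Q R] by simp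

lemma op_mult_diff_right: "R \<star> (P - Q) = R \<star> P - R \<star> Q"
  using op_mult_add_right[of R "P - Q" Q] by simp

lemma rf_shift_inverse: "rf_shift i j (inverse r) = inverse (rf_shift i j r)"
proof (cases "r = 0")
  case False
  have "rf_shift i j r * rf_shift i j (inverse r) = 1"
    using False by (simp flip: rf_shift_mult)
  then show ?thesis
    using inverse_unique by metis
qed simp

lemma rf_shift_power: "rf_shift i j (r ^ n) = rf_shift i j r ^ n"
  by (induction n) (simp_all add: rf_shift_mult)

lemma qop_one: "(1 :: qop) = single (0, 0) 1"
  by (simp flip: zero_prod_def)

lemma first_op_eq: "first_op =
    single (0, 0) (M_rf * x_rf ^ 2) + single (0, 1) (- M_rf + q_rf * M_rf ^ 2 * x_rf ^ 2) + single (1, 0) (x_rf ^ 3)"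
  by (simp add: first_op_def coeff_op_def S_m_def S_x_def op_mult_single)

lemma B_hat_eq: "B_hat =
    single (0, 0) 1 + single (0, 1) (q_rf * M_rf - inverse x_rf - inverse (x_rf ^ 2)) + single (0, 2) (inverse (x_rf ^ 3))"
proof -
  have "B_hat = single (0, 0) 1 - single (0, 1) (inverse (x_rf ^ 2)) - (single (0, 1) (inverse x_rf)
      - single (0, 2) (inverse x_rf * inverse (x_rf ^ 2))) + single (0, 1) (q_rf * M_rf)"
    by (simp add: B_hat_def qop_one coeff_op_def S_m_def op_mult_diff_left op_mult_diff_right op_mult_single
        rf_shift_inverse rf_shift_power rf_shift_mult rf_shift_x numeral_2_eq_2)
  moreover have "inverse x_rf * inverse (x_rf ^ 2) = inverse (x_rf ^ 3)"
    by (simp add: power2_eq_square power3_eq_cube)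
  ultimately show ?thesis
    by (simp add: single_diff single_add algebra_simps)
qed

lemmas regular_simps = regular_add rf_eval_add regular_mult rf_eval_mult regular_minus rf_eval_minus
  regular_power rf_eval_power regular_inverse rf_eval_inverse

lemma regular_diff: "regular r x M q \<Longrightarrow> regular s x M q \<Longrightarrow> regular (r - s) x M q"
  and rf_eval_diff: "regular r x M q \<Longrightarrow> regular s x M q \<Longrightarrow> rf_eval (r - s) x M q = rf_eval r x M q - rf_eval s x M q"
  using regular_add[OF _ regular_minus, of r x M q s] rf_eval_add[OF _ regular_minus, of r x M q s]
  by (simp_all add: rf_eval_minus)

lemma apply_first_op:
  "apply_op first_op q f m x = q powi m * x\<^sup>2 * f m x + (- (q powi m) + q * (q powi m)\<^sup>2 * x\<^sup>2) * f (m + 1) x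
     + x ^ 3 * f m (q * x)"
  unfolding first_op_eq
  by (simp add: apply_op_add op_regular_single op_regular_add apply_op_single regular_simps regular_diff rf_eval_diff)

lemma apply_B_hat:
  assumes "x \<noteq> 0"
  shows "apply_op B_hat q f m x = f m x + (q * q powi m - inverse x - inverse (x\<^sup>2)) * f (m + 1) x + inverse (x ^ 3) * f (m + 2) x"
  unfolding B_hat_eq using assms
  by (simp add: apply_op_add op_regular_single op_regular_add apply_op_single regular_simps regular_diff rf_eval_diff)

lemma apply_first_op_eq_0_iff:
  "apply_op first_op q f m x = 0 \<longleftrightarrow>
     x ^ 3 * f m (q * x) = - (q powi m) * x\<^sup>2 * f m x + (q powi m - q * (q powi m)\<^sup>2 * x\<^sup>2) * f (m + 1) x"
  unfolding apply_first_op by (simp add: algebra_simps add_eq_0_iff2)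

lemma apply_B_hat_eq_0_iff:
  assumes "x \<noteq> 0" "q \<noteq> 0"
  shows "apply_op B_hat q f m x = 0 \<longleftrightarrow>
     f (m + 2) x = (x\<^sup>2 + x - q powi (m + 1) * x ^ 3) * f (m + 1) x - x ^ 3 * f m x"
proof -
  have "x ^ 3 * apply_op B_hat q f m x = f (m + 2) x - ((x\<^sup>2 + x - q powi (m + 1) * x ^ 3) * f (m + 1) x - x ^ 3 * f m x)"
    unfolding apply_B_hat[OF assms(1)] using assms
    by (simp add: field_simps power_int_add power2_eq_square power3_eq_cube)
  then show ?thesis
    using assms(1) by (metis eq_iff_diff_eq_0 mult_eq_0_iff power_eq_0_iff)
qed

section \<open>Annihilators are left ideals\<close>

lemma annihilator_0: "0 \<in> annihilator f"
  by (auto simp: annihilator_def intro!: exI[of _ 1])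

lemma annihilator_add:
  assumes "P \<in> annihilator f" "Q \<in> annihilator f"
  shows "P + Q \<in> annihilator f"
proof -
  obtain D where D: "D \<noteq> 0" "\<And>q m. admissible q \<Longrightarrow>
      \<forall>\<^sub>\<approx>x\<in>-{0}. eval3 D x (q powi m) q \<noteq> 0 \<longrightarrow> apply_op P q (f q) m x = 0"
    using assms(1) unfolding annihilator_def by blast
  obtain D' where D': "D' \<noteq> 0" "\<And>q m. admissible q \<Longrightarrow>
      \<forall>\<^sub>\<approx>x\<in>-{0}. eval3 D' x (q powi m) q \<noteq> 0 \<longrightarrow> apply_op Q q (f q) m x = 0"
    using assms(2) unfolding annihilator_def by blast
  obtain E where E: "E \<noteq> 0" "\<And>x M q. eval3 E x M q \<noteq> 0 \<Longrightarrow> op_regular P x M q"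
    using op_denominator by blast
  obtain E' where E': "E' \<noteq> 0" "\<And>x M q. eval3 E' x M q \<noteq> 0 \<Longrightarrow> op_regular Q x M q"
    using op_denominator by blast
  have "\<forall>\<^sub>\<approx>x\<in>-{0}. eval3 (D * D' * E * E') x (q powi m) q \<noteq> 0 \<longrightarrow> apply_op (P + Q) q (f q) m x = 0"
    if "admissible q" for q m
    using D(2)[OF that, of m] D'(2)[OF that, of m]
    by eventually_elim (auto simp: apply_op_add E E')
  moreover have "D * D' * E * E' \<noteq> 0"
    using D D' E E' by simp
  ultimately show ?thesis
    unfolding annihilator_def by blast
qed

text \<open>The polynomial \<open>F\<close> collects the denominator of \<open>P\<close> and the
  shifts, by all monomials of \<open>P\<close>, of those belonging to \<open>Q\<close>. Its
  nonvanishing at a point thus gives regularity and the relation for \<open>Q\<close> at all shifted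
  points.\<close>

lemma annihilator_mult:
  assumes "Q \<in> annihilator f"
  shows "P \<star> Q \<in> annihilator f"
proof -
  obtain D where D: "D \<noteq> 0" "\<And>q m. admissible q \<Longrightarrow>
      \<forall>\<^sub>\<approx>x\<in>-{0}. eval3 D x (q powi m) q \<noteq> 0 \<longrightarrow> apply_op Q q (f q) m x = 0"
    using assms(1) unfolding annihilator_def by blast
  obtain E where E: "E \<noteq> 0" "\<And>x M q. eval3 E x M q \<noteq> 0 \<Longrightarrow> op_regular P x M q"
    using op_denominator by blast
  obtain E' where E': "E' \<noteq> 0" "\<And>x M q. eval3 E' x M q \<noteq> 0 \<Longrightarrow> op_regular Q x M q"
    using op_denominator by blast
  define F where "F = E * (\<Prod>ij\<in>keys P. poly3_shift (fst ij) (snd ij) (D * E'))"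
  have "F \<noteq> 0"
    using D E E' by (simp add: F_def poly3_shift_eq_0_iff)
  moreover have "\<forall>\<^sub>\<approx>x\<in>-{0}. eval3 F x (q powi m) q \<noteq> 0 \<longrightarrow> apply_op (P \<star> Q) q (f q) m x = 0"
    if q: "admissible q" for q m
  proof -
    have q0: "q \<noteq> 0"
      using q by (simp add: admissible_def)
    have M: "q powi (m + int j) = q ^ j * q powi m" for j
      using q0 by (simp add: power_int_add)
    have "\<forall>\<^sub>\<approx>x\<in>-{0}. eval3 D (q ^ fst ij * x) (q powi (m + int (snd ij))) q \<noteq> 0 \<longrightarrow>
        apply_op Q q (f q) (m + int (snd ij)) (q ^ fst ij * x) = 0" for ij
      using q0 by (intro cosparse_scale[OF _ D(2)[OF q]]) simp
    then have "\<forall>\<^sub>\<approx>x\<in>-{0}. \<forall>ij\<in>keys P. eval3 D (q ^ fst ij * x) (q powi (m + int (snd ij))) q \<noteq> 0 \<longrightarrow>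
        apply_op Q q (f q) (m + int (snd ij)) (q ^ fst ij * x) = 0"
      by (intro eventually_ball_finite) auto
    then show ?thesis
    proof eventually_elim
      case (elim x)
      show ?case
      proof
        assume "eval3 F x (q powi m) q \<noteq> 0"
        then have *: "eval3 E x (q powi m) q \<noteq> 0"
          "\<And>i j. (i, j) \<in> keys P \<Longrightarrow> eval3 (D * E') (q ^ i * x) (q powi (m + int j)) q \<noteq> 0"
          by (auto simp: F_def eval3_prod eval3_shift M)
        have "apply_op (P \<star> Q) q (f q) m x =
          (\<Sum>(i, j)\<in>keys P. rf_eval (lookup P (i, j)) x (q powi m) q * apply_op Q q (f q) (m + int j) (q ^ i * x))"
          using * by (intro apply_op_mult q0 E E') auto
        also have "\<dots> = 0"
          using * elim by (intro sum.neutral) fastforce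
        finally show "apply_op (P \<star> Q) q (f q) m x = 0" .
      qed
    qed
  qed
  ultimately show ?thesis
    unfolding annihilator_def by blast
qed

lemma left_ideal_subset_annihilator:
  assumes "G \<subseteq> annihilator f"
  shows "left_ideal G \<subseteq> annihilator f"
proof
  fix P assume "P \<in> left_ideal G"
  then show "P \<in> annihilator f"
    by induction (use assms in \<open>auto intro: annihilator_0 annihilator_add annihilator_mult\<close>)
qed

lemma annihilator_diff:
  assumes "P \<in> annihilator f" "Q \<in> annihilator f"
  shows "P - Q \<in> annihilator f"
  using annihilator_add[OF assms(1) annihilator_mult[OF assms(2), of "coeff_op (- 1)"]]
  by (simp add: coeff_op_minus_one)

section \<open>Normal forms with respect to 1 and S_m\<close>

definition normal_form :: "rf \<Rightarrow> rf \<Rightarrow> qop" where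
  "normal_form r s = single (0, 0) r + single (0, 1) s"

definition reducible :: "qop \<Rightarrow> bool" where
  "reducible P \<longleftrightarrow> (\<exists>r s. P - normal_form r s \<in> ideal_41)"

lemma coeff_op_single: "coeff_op r \<star> single k s = single k (r * s)"
  by (cases k) (simp add: coeff_op_def op_mult_single)

lemma first_op_in_ideal: "first_op \<in> ideal_41" and B_hat_in_ideal: "B_hat \<in> ideal_41"
  by (simp_all add: ideal_41_def left_ideal_gen)

lemma reducible_cong: "P - Q \<in> ideal_41 \<Longrightarrow> reducible Q \<Longrightarrow> reducible P"
  unfolding reducible_def ideal_41_def using left_ideal.add by fastforce

lemma reducible_add: "reducible P \<Longrightarrow> reducible Q \<Longrightarrow> reducible (P + Q)"
proof -
  assume "reducible P" "reducible Q"
  then obtain r s r' s' where "P - normal_form r s \<in> ideal_41" "Q - normal_form r' s' \<in> ideal_41"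
    unfolding reducible_def by blast
  then have "(P - normal_form r s) + (Q - normal_form r' s') \<in> ideal_41"
    unfolding ideal_41_def by (rule left_ideal.add)
  moreover have "(P - normal_form r s) + (Q - normal_form r' s') = P + Q - normal_form (r + r') (s + s')"
    by (simp add: normal_form_def single_add algebra_simps)
  ultimately show ?thesis
    unfolding reducible_def by auto
qed

lemma reducible_normal_form: "reducible (normal_form r s)"
  unfolding reducible_def ideal_41_def by (intro exI[of _ r] exI[of _ s]) (simp add: left_ideal.zero)

lemma reducible_single_0: "reducible (single (0, 0) r)" and reducible_single_1: "reducible (single (0, 1) r)"
  using reducible_normal_form[of r 0] reducible_normal_form[of 0 r] by (simp_all add: normal_form_def)

text \<open>Left multiplication preserves the ideal, so \<open>Q\<close> may be replaced by its
  normal form before \<open>P\<close> is applied.\<close>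

lemma reducible_op_mult:
  assumes "reducible Q" "\<And>r s. reducible (P \<star> normal_form r s)"
  shows "reducible (P \<star> Q)"
proof -
  obtain r s where "Q - normal_form r s \<in> ideal_41"
    using assms(1) unfolding reducible_def by blast
  then have "P \<star> (Q - normal_form r s) \<in> ideal_41"
    unfolding ideal_41_def by (rule left_ideal_mult)
  then show ?thesis
    using reducible_cong assms(2) by (simp add: op_mult_diff_right)
qed

lemma reducible_coeff_op: "reducible Q \<Longrightarrow> reducible (coeff_op r \<star> Q)"
  by (erule reducible_op_mult, unfold normal_form_def op_mult_add_right coeff_op_single)
     (intro reducible_add reducible_single_0 reducible_single_1)

lemma x_rf_nonzero: "x_rf \<noteq> 0"
proof
  assume "x_rf = 0"
  then have "rf_eval x_rf 1 1 1 = rf_eval 0 1 1 1" by simp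
  then show False by simp
qed

text \<open>The leading coefficient x^(-3) of \<open>B_hat\<close> is a unit; multiplying by x^3
  expresses S_m^2 through 1 and S_m.\<close>

lemma reducible_S_m_square: "reducible (single (0, 2) r)"
proof -
  define Q :: qop where "Q = single (0, 0) (- (x_rf ^ 3)) + single (0, 1) (- (x_rf ^ 3 * (q_rf * M_rf - inverse x_rf - inverse (x_rf ^ 2))))"
  have "coeff_op (x_rf ^ 3) \<star> B_hat \<in> ideal_41"
    using B_hat_in_ideal unfolding ideal_41_def by (rule left_ideal_mult)
  moreover have "coeff_op (x_rf ^ 3) \<star> B_hat = single (0, 2) 1 - Q"
    using x_rf_nonzero by (simp add: B_hat_eq Q_def op_mult_add_right coeff_op_single single_uminus)
  ultimately have "reducible (single (0, 2) 1)"
    unfolding Q_def by (metis reducible_cong reducible_add reducible_single_0 reducible_single_1)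
  from reducible_coeff_op[OF this, of r] show ?thesis
    by (simp add: coeff_op_single)
qed

lemma reducible_S_m: "reducible Q \<Longrightarrow> reducible (S_m \<star> Q)"
  by (erule reducible_op_mult, unfold normal_form_def op_mult_add_right S_m_def op_mult_single)
     (intro reducible_add; use reducible_single_1 reducible_S_m_square in \<open>simp add: numeral_2_eq_2\<close>)

lemma reducible_S_x_0: "reducible (single (1, 0) r)"
proof -
  define Q :: qop where "Q = single (0, 0) (- (inverse (x_rf ^ 3) * (M_rf * x_rf ^ 2)))
     + single (0, 1) (- (inverse (x_rf ^ 3) * (- M_rf + q_rf * M_rf ^ 2 * x_rf ^ 2)))"
  have "coeff_op (inverse (x_rf ^ 3)) \<star> first_op \<in> ideal_41"
    using first_op_in_ideal unfolding ideal_41_def by (rule left_ideal_mult)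
  moreover have "coeff_op (inverse (x_rf ^ 3)) \<star> first_op = single (1, 0) 1 - Q"
    using x_rf_nonzero by (simp add: first_op_eq Q_def op_mult_add_right coeff_op_single single_uminus)
  ultimately have "reducible (single (1, 0) 1)"
    unfolding Q_def by (metis reducible_cong reducible_add reducible_single_0 reducible_single_1)
  from reducible_coeff_op[OF this, of r] show ?thesis
    by (simp add: coeff_op_single)
qed

text \<open>Read as S_m applied to S_x, so that \<open>first_op\<close> removes S_x and only powers
  of S_m remain.\<close>

lemma reducible_S_x_1: "reducible (single (1, 1) r)"
  using reducible_coeff_op[OF reducible_S_m[OF reducible_S_x_0[of 1]], of r]
  by (simp add: S_m_def op_mult_single coeff_op_single)

lemma reducible_S_x: "reducible Q \<Longrightarrow> reducible (S_x \<star> Q)"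
  by (erule reducible_op_mult, unfold normal_form_def op_mult_add_right S_x_def op_mult_single)
     (intro reducible_add; use reducible_S_x_0 reducible_S_x_1 in simp)

lemma reducible_all: "reducible P"
proof (induction P rule: pair_mapping_induct)
  case (single i j r)
  have m: "reducible (single (0, j) 1)" for j
  proof (induction j)
    case (Suc j)
    from reducible_S_m[OF this] show ?case
      by (simp add: S_m_def op_mult_single)
  qed (rule reducible_single_0)
  have "reducible (single (i, j) 1)"
  proof (induction i)
    case (Suc i)
    from reducible_S_x[OF this] show ?case
      by (simp add: S_x_def op_mult_single)
  qed (rule m)
  from reducible_coeff_op[OF this, of r] show ?case
    by (simp add: coeff_op_single)
qed (use reducible_single_0[of 0] in \<open>auto intro: reducible_add\<close>)

text \<open>The three facts common to both blocks from which annihilator, rank and growth are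
  derived. The third one excludes two consecutive zeros in \<open>m\<close>; for the blocks it comes
  from the nonvanishing Wronskian.\<close>

locale block_family =
  fixes f :: "complex \<Rightarrow> int \<Rightarrow> complex \<Rightarrow> complex"
  assumes rec: "\<And>q x m. admissible q \<Longrightarrow> x \<in> generic q \<Longrightarrow>
      f q (m + 2) x = (x\<^sup>2 + x - q powi (m + 1) * x ^ 3) * f q (m + 1) x - x ^ 3 * f q m x"
    and first: "\<And>q x m. admissible q \<Longrightarrow> x \<in> generic q \<Longrightarrow>
      x ^ 3 * f q m (q * x) = - (q powi m) * x\<^sup>2 * f q m x + (q powi m - q * (q powi m)\<^sup>2 * x\<^sup>2) * f q (m + 1) x"
    and nonzero: "\<And>q x m. admissible q \<Longrightarrow> x \<in> generic q \<Longrightarrow> f q m x \<noteq> 0 \<or> f q (m + 1) x \<noteq> 0"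
begin

text \<open>For each admissible \<open>q\<close> there are infinitely many generic \<open>x\<close>
  at which the relation holds for all \<open>m\<close>. At such a point
  \<open>recurrence_irreducible\<close> kills both coefficients as polynomials in M, and
  \<open>eval3_eq_0_imp\<close> concludes.\<close>

lemma shift_independent:
  assumes "\<And>q m. admissible q \<Longrightarrow> \<forall>\<^sub>\<approx>x\<in>-{0}.
     eval3 p x (q powi m) q * f q m x + eval3 r x (q powi m) q * f q (m + 1) x = 0"
  shows "p = 0 \<and> r = 0"
proof -
  define T where "T q = {x. \<forall>m. x \<in> generic q \<and>
     eval3 p x (q powi m) q * f q m x + eval3 r x (q powi m) q * f q (m + 1) x = 0}" for q
  have T: "infinite (T q)" if "q \<in> {q. admissible q}" for q
    unfolding T_def using that assms eventually_generic
    by (intro infinite_cosparse_family eventually_conj) auto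
  have "eval3 p x M q = 0 \<and> eval3 r x M q = 0" if "q \<in> {q. admissible q}" "x \<in> T q" for q x M
  proof -
    have q: "admissible q" and x: "x \<in> generic q"
      and rel: "\<And>m. eval3 p x (q powi m) q * f q m x + eval3 r x (q powi m) q * f q (m + 1) x = 0"
      using that by (auto simp: T_def)
    obtain P where P: "\<forall>M. poly P M = eval3 p x M q"
      using eval3_poly_M ..
    obtain R where R: "\<forall>M. poly R M = eval3 r x M q"
      using eval3_poly_M ..
    have "P = 0 \<and> R = 0"
      by (rule recurrence_irreducible[where u = "\<lambda>m. f q m x", OF q generic_nonzero[OF x] rec[OF q x] nonzero[OF q x]])
         (use P R rel in simp)
    then show ?thesis
      using P R by auto
  qed
  then show ?thesis
    using eval3_eq_0_imp[of "{q. admissible q}" T, OF infinite_admissible T] by simp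
qed

lemma generators_in_annihilator: "{first_op, B_hat} \<subseteq> annihilator f"
proof -
  have q0: "q \<noteq> 0" if "admissible q" for q
    using that by (simp add: admissible_def)
  have "\<forall>\<^sub>\<approx>x\<in>-{0}. apply_op first_op q (f q) m x = 0" if "admissible q" for q m
    using eventually_generic[OF that]
    by eventually_elim (use first that in \<open>simp add: apply_first_op_eq_0_iff\<close>)
  moreover have "\<forall>\<^sub>\<approx>x\<in>-{0}. apply_op B_hat q (f q) m x = 0" if "admissible q" for q m
    using eventually_generic[OF that]
    by eventually_elim (use rec that q0 generic_nonzero in \<open>simp add: apply_B_hat_eq_0_iff\<close>)
  ultimately show ?thesis
    unfolding annihilator_def by (auto intro!: exI[of _ 1])
qed

lemma ideal_subset_annihilator: "ideal_41 \<subseteq> annihilator f"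
  unfolding ideal_41_def by (rule left_ideal_subset_annihilator[OF generators_in_annihilator])

lemma normal_form_in_annihilator:
  assumes "normal_form r s \<in> annihilator f"
  shows "r = 0 \<and> s = 0"
proof -
  obtain D where D: "D \<noteq> 0" "\<And>q m. admissible q \<Longrightarrow>
      \<forall>\<^sub>\<approx>x\<in>-{0}. eval3 D x (q powi m) q \<noteq> 0 \<longrightarrow> apply_op (normal_form r s) q (f q) m x = 0"
    using assms(1) unfolding annihilator_def by blast
  obtain a b where r: "r = Fract a b" "b \<noteq> 0"
    by (cases r)
  obtain c d where s: "s = Fract c d" "d \<noteq> 0"
    by (cases s)
  \<comment> \<open>Multiplying by \<open>E\<close> makes the cleared relation trivial wherever a
    denominator vanishes, so it holds without exceptional condition on \<open>E\<close>.\<close>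
  define E where "E = D * b * d"
  have "\<forall>\<^sub>\<approx>x\<in>-{0}. eval3 (E * (a * d)) x (q powi m) q * f q m x + eval3 (E * (c * b)) x (q powi m) q * f q (m + 1) x = 0"
    if "admissible q" for q m
    using D(2)[OF that, of m]
  proof eventually_elim
    case (elim x)
    show ?case
    proof (cases "eval3 E x (q powi m) q = 0")
      case False
      then have nz: "eval3 D x (q powi m) q \<noteq> 0" "eval3 b x (q powi m) q \<noteq> 0" "eval3 d x (q powi m) q \<noteq> 0"
        by (auto simp: E_def)
      then have "eval3 a x (q powi m) q / eval3 b x (q powi m) q * f q m x
          + eval3 c x (q powi m) q / eval3 d x (q powi m) q * f q (m + 1) x = 0"
        using elim unfolding normal_form_def r s
        by (simp add: apply_op_add op_regular_single regular_Fract apply_op_single rf_eval_Fract)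
      then have "eval3 a x (q powi m) q * eval3 d x (q powi m) q * f q m x
          + eval3 c x (q powi m) q * eval3 b x (q powi m) q * f q (m + 1) x = 0"
        using nz by (simp add: field_simps)
      then show ?thesis
        unfolding eval3_mult by algebra
    qed simp
  qed
  then have "E * (a * d) = 0 \<and> E * (c * b) = 0"
    by (rule shift_independent)
  then have "a = 0" "c = 0"
    using D(1) r(2) s(2) by (auto simp: E_def)
  then show ?thesis
    using r s by (simp add: fract_collapse)
qed

text \<open>An annihilating operator differs from its normal form by an element of the ideal, so the
  normal form annihilates too and must be zero.\<close>

lemma annihilator_eq: "annihilator f = ideal_41"
proof
  show "annihilator f \<subseteq> ideal_41"
  proof
    fix P assume P: "P \<in> annihilator f"
    obtain r s where rs: "P - normal_form r s \<in> ideal_41"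
      using reducible_all unfolding reducible_def by blast
    then have "P - (P - normal_form r s) \<in> annihilator f"
      using P ideal_subset_annihilator by (blast intro: annihilator_diff)
    then have "r = 0 \<and> s = 0"
      using normal_form_in_annihilator by simp
    then show "P \<in> ideal_41"
      using rs by (simp add: normal_form_def)
  qed
qed (rule ideal_subset_annihilator)

text \<open>A purely algebraic fact, obtained by letting operators act on \<open>f\<close>: this
  action replaces a Groebner basis computation and gives the uniqueness half of the rank.\<close>

lemma normal_form_in_ideal: "normal_form r s \<in> ideal_41 \<Longrightarrow> r = 0 \<and> s = 0"
  using ideal_subset_annihilator normal_form_in_annihilator by blast

lemma rank_ideal: "has_rank ideal_41 2"
  unfolding has_rank_def
proof (intro exI conjI allI)
  have "(0, 0) \<noteq> (0, 1 :: nat)" by simp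
  then have ne: "coeff_op 1 \<noteq> S_m"
    unfolding coeff_op_def S_m_def by (metis lookup_single_eq lookup_single_not_eq zero_neq_one)
  show "finite {coeff_op 1, S_m}" by simp
  show "card {coeff_op 1, S_m} = 2"
    using ne by simp
  have sum: "(\<Sum>b\<in>{coeff_op 1, S_m}. coeff_op (c b) \<star> b) = normal_form (c (coeff_op 1)) (c S_m)" for c
    using ne by (simp add: normal_form_def) (simp add: coeff_op_def S_m_def op_mult_single)
  fix P
  show "\<exists>!c. (\<forall>b. b \<notin> {coeff_op 1, S_m} \<longrightarrow> c b = 0) \<and> P - (\<Sum>b\<in>{coeff_op 1, S_m}. coeff_op (c b) \<star> b) \<in> ideal_41"
    unfolding sum
  proof (rule ex_ex1I)
    obtain r s where "P - normal_form r s \<in> ideal_41"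
      using reducible_all unfolding reducible_def by blast
    then show "\<exists>c. (\<forall>b. b \<notin> {coeff_op 1, S_m} \<longrightarrow> c b = 0) \<and> P - normal_form (c (coeff_op 1)) (c S_m) \<in> ideal_41"
      using ne by (intro exI[of _ "\<lambda>b. if b = coeff_op 1 then r else if b = S_m then s else 0"]) auto
  next
    fix c c'
    assume c: "(\<forall>b. b \<notin> {coeff_op 1, S_m} \<longrightarrow> c b = 0) \<and> P - normal_form (c (coeff_op 1)) (c S_m) \<in> ideal_41"
      and c': "(\<forall>b. b \<notin> {coeff_op 1, S_m} \<longrightarrow> c' b = 0) \<and> P - normal_form (c' (coeff_op 1)) (c' S_m) \<in> ideal_41"
    then have "(P - normal_form (c' (coeff_op 1)) (c' S_m)) - (P - normal_form (c (coeff_op 1)) (c S_m)) \<in> ideal_41"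
      unfolding ideal_41_def by (blast intro: left_ideal_diff)
    moreover have "(P - normal_form (c' (coeff_op 1)) (c' S_m)) - (P - normal_form (c (coeff_op 1)) (c S_m))
        = normal_form (c (coeff_op 1) - c' (coeff_op 1)) (c S_m - c' S_m)"
      by (simp add: normal_form_def single_diff)
    ultimately have eq: "c (coeff_op 1) = c' (coeff_op 1)" "c S_m = c' S_m"
      using normal_form_in_ideal by force+
    show "c = c'"
    proof
      fix b show "c b = c' b"
        using eq c c' by (cases "b = coeff_op 1"; cases "b = S_m") auto
    qed
  qed
qed

end

text \<open>Polynomial functions of degree at most \<open>N\<close> in x and in M separately. The
  degree in q is unrestricted because functions of q are scalars for the Hilbert function.\<close>

inductive bounded_poly :: "nat \<Rightarrow> (complex \<Rightarrow> complex \<Rightarrow> complex \<Rightarrow> complex) \<Rightarrow> bool" where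
  monomial: "i \<le> N \<Longrightarrow> j \<le> N \<Longrightarrow> bounded_poly N (\<lambda>x M q. poly c q * x ^ i * M ^ j)"
| add: "bounded_poly N g \<Longrightarrow> bounded_poly N h \<Longrightarrow> bounded_poly N (\<lambda>x M q. g x M q + h x M q)"

lemma bounded_poly_mono: "bounded_poly N g \<Longrightarrow> N \<le> K \<Longrightarrow> bounded_poly K g"
  by (induction rule: bounded_poly.induct) (auto intro: bounded_poly.intros)

lemma bounded_poly_mult_monomial:
  assumes "bounded_poly N g" "i \<le> K" "j \<le> K"
  shows "bounded_poly (K + N) (\<lambda>x M q. poly c q * x ^ i * M ^ j * g x M q)"
  using assms(1)
proof induction
  case (monomial k N l d)
  have "(\<lambda>x M q. poly c q * x ^ i * M ^ j * (poly d q * x ^ k * M ^ l))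
      = (\<lambda>x M q. poly (c * d) q * x ^ (i + k) * M ^ (j + l))"
    by (simp add: fun_eq_iff power_add mult_ac)
  then show ?case
    using monomial assms(2,3) by (simp only:) (intro bounded_poly.monomial, auto)
next
  case (add N g h)
  from bounded_poly.add[OF add.IH] show ?case
    by (simp only: distrib_left)
qed

lemma bounded_poly_mult:
  assumes "bounded_poly K h" "bounded_poly N g"
  shows "bounded_poly (K + N) (\<lambda>x M q. h x M q * g x M q)"
  using assms(1)
proof induction
  case (monomial i K j c)
  then show ?case
    by (rule bounded_poly_mult_monomial[OF assms(2)])
next
  case (add K h h')
  from bounded_poly.add[OF add.IH] show ?case
    by (simp only: distrib_right)
qed

text \<open>The substitution only changes the coefficients in q. Hence degrees in x and M grow by a
  fixed amount per step, which keeps the Hilbert function quadratic.\<close>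

lemma bounded_poly_shift:
  assumes "bounded_poly N g"
  shows "bounded_poly N (\<lambda>x M q. g (q ^ i * x) (q ^ j * M) q)"
  using assms
proof induction
  case (monomial k N l c)
  have "(\<lambda>x M q. poly c q * (q ^ i * x) ^ k * (q ^ j * M) ^ l)
      = (\<lambda>x M q. poly (c * monom 1 (i * k) * monom 1 (j * l)) q * x ^ k * M ^ l)"
    by (simp add: fun_eq_iff poly_monom power_mult_distrib power_mult mult_ac)
  then show ?case
    using monomial by (simp only:) (intro bounded_poly.monomial)
qed (rule bounded_poly.add)

lemma bounded_poly_expansion:
  assumes "bounded_poly N g"
  shows "\<exists>u. \<forall>x M q. g x M q = (\<Sum>i\<le>N. \<Sum>j\<le>N. poly (u i j) q * x ^ i * M ^ j)"
  using assms
proof induction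
  case (monomial k N l c)
  define u where "u i j = (if i = k then if j = l then c else 0 else 0)" for i j
  have "poly (u i j) q * x ^ i * M ^ j = (if i = k then if j = l then poly c q * x ^ i * M ^ j else 0 else 0)" for i j x M q
    by (simp add: u_def)
  then have "(\<Sum>i\<le>N. \<Sum>j\<le>N. poly (u i j) q * x ^ i * M ^ j) = poly c q * x ^ k * M ^ l" for x M q
    using monomial by (simp add: if_distrib[of "sum _"] cong: if_cong)
       (subst sum.swap, simp)
  then show ?case
    by (intro exI[of _ u]) simp
next
  case (add N g h)
  then obtain u v where
    "\<forall>x M q. g x M q = (\<Sum>i\<le>N. \<Sum>j\<le>N. poly (u i j) q * x ^ i * M ^ j)"
    "\<forall>x M q. h x M q = (\<Sum>i\<le>N. \<Sum>j\<le>N. poly (v i j) q * x ^ i * M ^ j)"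
    by blast
  then show ?case
    by (intro exI[of _ "\<lambda>i j. u i j + v i j"]) (simp add: sum.distrib distrib_right)
qed

text \<open>Hides the degree bound where only its existence matters, as for the coefficients of
  one-step shifts.\<close>

definition is_poly :: "(complex \<Rightarrow> complex \<Rightarrow> complex \<Rightarrow> complex) \<Rightarrow> bool" where
  "is_poly g \<longleftrightarrow> (\<exists>N. bounded_poly N g)"

lemma is_poly_add: "is_poly g \<Longrightarrow> is_poly h \<Longrightarrow> is_poly (\<lambda>x M q. g x M q + h x M q)"
proof -
  assume "is_poly g" "is_poly h"
  then obtain N K where "bounded_poly N g" "bounded_poly K h"
    unfolding is_poly_def by blast
  then have "bounded_poly (max N K) g" "bounded_poly (max N K) h"
    by (auto intro: bounded_poly_mono)
  then show ?thesis
    unfolding is_poly_def by (blast intro: bounded_poly.add)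
qed

lemma is_poly_mult: "is_poly g \<Longrightarrow> is_poly h \<Longrightarrow> is_poly (\<lambda>x M q. g x M q * h x M q)"
  unfolding is_poly_def using bounded_poly_mult by blast

lemma is_poly_const: "is_poly (\<lambda>x M q. c)"
  and is_poly_x: "is_poly (\<lambda>x M q. x)" and is_poly_M: "is_poly (\<lambda>x M q. M)" and is_poly_q: "is_poly (\<lambda>x M q. q)"
  using bounded_poly.monomial[of 0 0 0 "[:c:]"] bounded_poly.monomial[of 1 1 0 1]
    bounded_poly.monomial[of 0 1 1 1] bounded_poly.monomial[of 0 0 0 "[:0, 1:]"]
  by (auto simp: is_poly_def)

lemma is_poly_power: "is_poly g \<Longrightarrow> is_poly (\<lambda>x M q. g x M q ^ n)"
  by (induction n) (simp_all add: is_poly_const is_poly_mult)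

lemma is_poly_minus: "is_poly g \<Longrightarrow> is_poly (\<lambda>x M q. - g x M q)"
  using is_poly_mult[OF is_poly_const[of "-1"], of g] by simp

lemma is_poly_diff: "is_poly g \<Longrightarrow> is_poly h \<Longrightarrow> is_poly (\<lambda>x M q. g x M q - h x M q)"
  using is_poly_add[OF _ is_poly_minus, of g h] by simp

lemmas is_poly_intros = is_poly_add is_poly_mult is_poly_power is_poly_minus is_poly_diff
  is_poly_const is_poly_x is_poly_M is_poly_q

text \<open>Fraction-free elimination: the relation is found inside the integral domain itself, so
  it applies directly to coefficients that are polynomials in q.\<close>

lemma linear_dependence:
  fixes v :: "'t \<Rightarrow> 'k \<Rightarrow> 'r :: idom"
  assumes "finite K" "finite T" "card T > card K"
  shows "\<exists>u. (\<exists>t\<in>T. u t \<noteq> 0) \<and> (\<forall>k\<in>K. (\<Sum>t\<in>T. u t * v t k) = 0)"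
  using assms
proof (induction K arbitrary: T v rule: finite_induct)
  case empty
  then have "T \<noteq> {}" by auto
  then show ?case by (intro exI[of _ "\<lambda>_. 1"]) auto
next
  case (insert k K)
  show ?case
  proof (cases "\<forall>t\<in>T. v t k = 0")
    case True
    obtain u where "\<exists>t\<in>T. u t \<noteq> 0" "\<forall>k\<in>K. (\<Sum>t\<in>T. u t * v t k) = 0"
      using insert.IH[of T v] insert.prems insert.hyps by auto
    then show ?thesis
      using True by (intro exI[of _ u]) auto
  next
    case False
    then obtain s where s: "s \<in> T" "v s k \<noteq> 0" by blast
    define T' where "T' = T - {s}"
    have T': "finite T'" "card T' > card K" "s \<notin> T'" "T = insert s T'"
      using insert.prems insert.hyps s by (auto simp: T'_def)
    \<comment> \<open>The vector \<open>s\<close> serves as pivot; these combinations have zero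
      \<open>k\<close>-coordinate and need no division.\<close>
    define w where "w t l = v s k * v t l - v t k * v s l" for t l
    obtain u where u: "\<exists>t\<in>T'. u t \<noteq> 0" "\<forall>l\<in>K. (\<Sum>t\<in>T'. u t * w t l) = 0"
      using insert.IH[OF T'(1,2), of w] by blast
    \<comment> \<open>The coefficient at \<open>s\<close> is the one that turns a relation between
      the \<open>w t\<close> into a relation between the original vectors.\<close>
    define u' where "u' t = (if t = s then - (\<Sum>t\<in>T'. u t * v t k) else u t * v s k)" for t
    have sum: "(\<Sum>t\<in>T. u' t * v t l) = (\<Sum>t\<in>T'. u t * w t l)" for l
    proof -
      have "(\<Sum>t\<in>T'. u' t * v t l) = (\<Sum>t\<in>T'. u t * v s k * v t l)"
        using T'(3) by (intro sum.cong) (auto simp: u'_def)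
      then show ?thesis
        using T' by (simp add: u'_def w_def sum_distrib_right sum_distrib_left sum_subtractf right_diff_distrib mult_ac
            flip: sum_negf)
    qed
    have "\<exists>t\<in>T. u' t \<noteq> 0"
      using u(1) s T' by (auto simp: u'_def)
    moreover have "(\<Sum>t\<in>T. u' t * v t l) = 0" if "l \<in> insert k K" for l
      using that u(2) unfolding sum by (auto simp: w_def)
    ultimately show ?thesis by blast
  qed
qed

section \<open>Quadratic growth of the Hilbert function\<close>

context block_family
begin

text \<open>Every S_x costs a factor x^3 and some power of q, an S_m costs nothing, and each of them
  raises the degrees in x and M by at most one constant \<open>K\<close>.\<close>

lemma shift_expansion:
  "\<exists>K. \<forall>c d. \<exists>E g h. bounded_poly (K * (c + d)) g \<and> bounded_poly (K * (c + d)) h \<and>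
     (\<forall>q m x. admissible q \<longrightarrow> x \<in> generic q \<longrightarrow>
        q ^ E * x ^ (3 * c) * f q (m + int d) (q ^ c * x) =
          g x (q powi m) q * f q m x + h x (q powi m) q * f q (m + 1) x)"
proof -
  \<comment> \<open>Coefficients with respect to f_m(x), f_(m+1)(x): the \<open>p\<close> give
    f_(m+2)(x), the \<open>r\<close> give x^3 f_m(qx), and the \<open>s\<close> give x^3 f_(m+1)(qx)
    after f_(m+2)(x) has been eliminated.\<close>
  define p1 p2 r1 r2 s1 s2 :: "complex \<Rightarrow> complex \<Rightarrow> complex \<Rightarrow> complex"
    where "p1 = (\<lambda>x M q. - (x ^ 3))" and "p2 = (\<lambda>x M q. x\<^sup>2 + x - q * M * x ^ 3)"
      and "r1 = (\<lambda>x M q. - (M * x\<^sup>2))" and "r2 = (\<lambda>x M q. M - q * M\<^sup>2 * x\<^sup>2)"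
      and "s1 = (\<lambda>x M q. - ((q * M - q ^ 3 * M\<^sup>2 * x\<^sup>2) * x ^ 3))"
      and "s2 = (\<lambda>x M q. - (q * M * x\<^sup>2) + (q * M - q ^ 3 * M\<^sup>2 * x\<^sup>2) * (x\<^sup>2 + x - q * M * x ^ 3))"
  note defs = this
  have "is_poly p1" "is_poly p2" "is_poly r1" "is_poly r2" "is_poly s1" "is_poly s2"
    unfolding defs by (intro is_poly_intros)+
  then obtain k1 k2 k3 k4 k5 k6 where k: "bounded_poly k1 p1" "bounded_poly k2 p2" "bounded_poly k3 r1"
      "bounded_poly k4 r2" "bounded_poly k5 s1" "bounded_poly k6 s2"
    unfolding is_poly_def by blast
  define K where "K = k1 + k2 + k3 + k4 + k5 + k6"
  have K: "bounded_poly K p1" "bounded_poly K p2" "bounded_poly K r1" "bounded_poly K r2"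
      "bounded_poly K s1" "bounded_poly K s2"
    by (rule bounded_poly_mono[OF k(1)] bounded_poly_mono[OF k(2)] bounded_poly_mono[OF k(3)] bounded_poly_mono[OF k(4)]
         bounded_poly_mono[OF k(5)] bounded_poly_mono[OF k(6)]; simp add: K_def)+
  have qM: "q powi (m + 1) = q * q powi m" if "admissible q" for q m
    using that by (simp add: admissible_def power_int_add)
  have p: "f q (m + 2) x = p1 x (q powi m) q * f q m x + p2 x (q powi m) q * f q (m + 1) x"
    if "admissible q" "x \<in> generic q" for q m x
    unfolding defs using rec[OF that] by (simp add: qM[OF that(1)])
  have r: "x ^ 3 * f q m (q * x) = r1 x (q powi m) q * f q m x + r2 x (q powi m) q * f q (m + 1) x"
    if "admissible q" "x \<in> generic q" for q m x
    unfolding defs using first[OF that] by simp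
  have s: "x ^ 3 * f q (m + 1) (q * x) = s1 x (q powi m) q * f q m x + s2 x (q powi m) q * f q (m + 1) x"
    if "admissible q" "x \<in> generic q" for q m x
  proof -
    have "m + 1 + 1 = m + 2" by simp
    then show ?thesis
      using first[OF that, of "m + 1"] rec[OF that, of m] unfolding defs qM[OF that(1)]
      by (simp add: algebra_simps power2_eq_square power3_eq_cube)
  qed
  have m_shift: "\<exists>g h. bounded_poly (K * d) g \<and> bounded_poly (K * d) h \<and>
     (\<forall>q m x. admissible q \<longrightarrow> x \<in> generic q \<longrightarrow>
        f q (m + int d) x = g x (q powi m) q * f q m x + h x (q powi m) q * f q (m + 1) x)" for d
  proof (induction d)
    case 0
    have "bounded_poly 0 (\<lambda>x M q. 1)" "bounded_poly 0 (\<lambda>x M q. 0)"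
      using bounded_poly.monomial[of 0 0 0 1] bounded_poly.monomial[of 0 0 0 0] by simp_all
    then show ?case
      by (intro exI[of _ "\<lambda>x M q. 1"] exI[of _ "\<lambda>x M q. 0"]) simp
  next
    case (Suc d)
    then obtain g h where g: "bounded_poly (K * d) g" "bounded_poly (K * d) h" and
      eq: "\<And>q m x. admissible q \<Longrightarrow> x \<in> generic q \<Longrightarrow>
        f q (m + int d) x = g x (q powi m) q * f q m x + h x (q powi m) q * f q (m + 1) x"
      by blast
    define g' where "g' x M q = g (q ^ 0 * x) (q ^ 1 * M) q" for x M q
    define h' where "h' x M q = h (q ^ 0 * x) (q ^ 1 * M) q" for x M q
    have b: "bounded_poly (K * d) g'" "bounded_poly (K * d) h'"
      unfolding g'_def[abs_def] h'_def[abs_def] by (intro bounded_poly_shift g)+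
    have Kd: "K * Suc d = K + K * d"
      by simp
    show ?case
    proof (intro exI conjI allI impI)
      show "bounded_poly (K * Suc d) (\<lambda>x M q. p1 x M q * h' x M q)"
        unfolding Kd by (intro bounded_poly_mult K b)
      show "bounded_poly (K * Suc d) (\<lambda>x M q. g' x M q + p2 x M q * h' x M q)"
        unfolding Kd by (intro bounded_poly.add bounded_poly_mult K b bounded_poly_mono[OF b(1)]) simp
      fix q m x assume qx: "admissible q" "x \<in> generic q"
      have i: "m + int (Suc d) = (m + 1) + int d" "m + 1 + 1 = m + 2"
        by simp_all
      show "f q (m + int (Suc d)) x = p1 x (q powi m) q * h' x (q powi m) q * f q m x
          + (g' x (q powi m) q + p2 x (q powi m) q * h' x (q powi m) q) * f q (m + 1) x"
        unfolding i(1) eq[OF qx, of "m + 1"] i(2) p[OF qx] qM[OF qx(1)] g'_def h'_def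
        by (simp add: algebra_simps)
    qed
  qed
  have x_shift: "\<exists>E g h. bounded_poly (K * (c + d)) g \<and> bounded_poly (K * (c + d)) h \<and>
     (\<forall>q m x. admissible q \<longrightarrow> x \<in> generic q \<longrightarrow>
        q ^ E * x ^ (3 * c) * f q (m + int d) (q ^ c * x) =
          g x (q powi m) q * f q m x + h x (q powi m) q * f q (m + 1) x)" for c d
  proof (induction c)
    case 0
    from m_shift[of d] obtain g h where "bounded_poly (K * d) g \<and> bounded_poly (K * d) h \<and>
     (\<forall>q m x. admissible q \<longrightarrow> x \<in> generic q \<longrightarrow>
        f q (m + int d) x = g x (q powi m) q * f q m x + h x (q powi m) q * f q (m + 1) x)" by blast
    then show ?case
      by (intro exI[of _ 0] exI[of _ g] exI[of _ h]) simp
  next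
    case (Suc c)
    then obtain E g h where g: "bounded_poly (K * (c + d)) g" "bounded_poly (K * (c + d)) h" and
      eq: "\<And>q m x. admissible q \<Longrightarrow> x \<in> generic q \<Longrightarrow>
        q ^ E * x ^ (3 * c) * f q (m + int d) (q ^ c * x) =
          g x (q powi m) q * f q m x + h x (q powi m) q * f q (m + 1) x"
      by blast
    define g' where "g' x M q = g (q ^ 1 * x) (q ^ 0 * M) q" for x M q
    define h' where "h' x M q = h (q ^ 1 * x) (q ^ 0 * M) q" for x M q
    have b: "bounded_poly (K * (c + d)) g'" "bounded_poly (K * (c + d)) h'"
      unfolding g'_def[abs_def] h'_def[abs_def] by (intro bounded_poly_shift g)+
    have Kd: "K * (Suc c + d) = K + K * (c + d)"
      by simp
    show ?case
    proof (intro exI conjI allI impI)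
      show "bounded_poly (K * (Suc c + d)) (\<lambda>x M q. r1 x M q * g' x M q + s1 x M q * h' x M q)"
        unfolding Kd by (intro bounded_poly.add bounded_poly_mult K b)
      show "bounded_poly (K * (Suc c + d)) (\<lambda>x M q. r2 x M q * g' x M q + s2 x M q * h' x M q)"
        unfolding Kd by (intro bounded_poly.add bounded_poly_mult K b)
      fix q m x assume qx: "admissible q" "x \<in> generic q"
      then have qx': "q * x \<in> generic q"
        by (intro generic_mult) (auto simp: admissible_def)
      \<comment> \<open>The induction hypothesis is used at \<open>q * x\<close>, and (qx)^(3c)
        contributes the additional q^(3c).\<close>
      have "q ^ (E + 3 * c) * x ^ (3 * Suc c) * f q (m + int d) (q ^ Suc c * x)
          = x ^ 3 * (q ^ E * (q * x) ^ (3 * c) * f q (m + int d) (q ^ c * (q * x)))"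
        by (simp add: power_add power_mult_distrib mult_ac)
      also have "\<dots> = g' x (q powi m) q * (x ^ 3 * f q m (q * x)) + h' x (q powi m) q * (x ^ 3 * f q (m + 1) (q * x))"
        unfolding eq[OF qx(1) qx'] g'_def h'_def by (simp add: algebra_simps)
      also have "\<dots> = (r1 x (q powi m) q * g' x (q powi m) q + s1 x (q powi m) q * h' x (q powi m) q) * f q m x
          + (r2 x (q powi m) q * g' x (q powi m) q + s2 x (q powi m) q * h' x (q powi m) q) * f q (m + 1) x"
        unfolding s[OF qx] unfolding r[OF qx] by (simp add: algebra_simps)
      finally show "q ^ (E + 3 * c) * x ^ (3 * Suc c) * f q (m + int d) (q ^ Suc c * x) = \<dots>" .
    qed
  qed
  then show ?thesis by blast
qed

text \<open>After multiplication by the common x^(3n) and a power of q, every monomial of degree at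
  most \<open>n\<close> is described by 2(N+1)^2 polynomials in q, with N linear in n. More
  monomials than that are dependent.\<close>

lemma weyl_independent_card_le:
  "\<exists>C. \<forall>n T. T \<subseteq> {(a, b, c, d). a + b + c + d \<le> n} \<longrightarrow> weyl_independent f T \<longrightarrow> card T \<le> 2 * (C * n + 1)\<^sup>2"
proof -
  obtain K where K: "\<forall>c d. \<exists>E g h. bounded_poly (K * (c + d)) g \<and> bounded_poly (K * (c + d)) h \<and>
     (\<forall>q m x. admissible q \<longrightarrow> x \<in> generic q \<longrightarrow>
        q ^ E * x ^ (3 * c) * f q (m + int d) (q ^ c * x) =
          g x (q powi m) q * f q m x + h x (q powi m) q * f q (m + 1) x)"
    using shift_expansion ..
  have "card T \<le> 2 * ((4 + K) * n + 1)\<^sup>2"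
    if T: "T \<subseteq> {(a, b, c, d). a + b + c + d \<le> n}" and ind: "weyl_independent f T" for n T
  proof (rule ccontr)
    assume big: "\<not> card T \<le> 2 * ((4 + K) * n + 1)\<^sup>2"
    \<comment> \<open>\<open>4 * n\<close> bounds the exponents of the monomial after clearing
      x^(3n), and \<open>K * n\<close> the degree of its shift expansion.\<close>
    define N where "N = (4 + K) * n"
    define A B X S where "A t = fst t" and "B t = fst (snd t)" and "X t = fst (snd (snd t))" and "S t = snd (snd (snd t))"
      for t :: "nat \<times> nat \<times> nat \<times> nat"
    note ABXS = this
    have deg: "A t + B t + X t + S t \<le> n" if "t \<in> T" for t
      using T that by (auto simp: ABXS)
    have "\<exists>E u v. \<forall>q m x. admissible q \<longrightarrow> x \<in> generic q \<longrightarrow>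
        q ^ E * x ^ (3 * n) * (x ^ A t * (q powi m) ^ B t * f q (m + int (S t)) (q ^ X t * x)) =
        (\<Sum>i\<le>N. \<Sum>j\<le>N. poly (u i j) q * x ^ i * (q powi m) ^ j) * f q m x +
        (\<Sum>i\<le>N. \<Sum>j\<le>N. poly (v i j) q * x ^ i * (q powi m) ^ j) * f q (m + 1) x" if t: "t \<in> T" for t
    proof -
      obtain E g h where g: "bounded_poly (K * (X t + S t)) g" "bounded_poly (K * (X t + S t)) h" and
        eq: "\<And>q m x. admissible q \<Longrightarrow> x \<in> generic q \<Longrightarrow>
        q ^ E * x ^ (3 * X t) * f q (m + int (S t)) (q ^ X t * x) =
          g x (q powi m) q * f q m x + h x (q powi m) q * f q (m + 1) x"
        using K[rule_format, of "X t" "S t"] by blast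
      have le: "3 * (n - X t) + A t \<le> 4 * n" "B t \<le> 4 * n" "4 * n + K * (X t + S t) \<le> N"
        using deg[OF t] mult_le_mono2[of "X t + S t" n K] by (auto simp: N_def algebra_simps)
      define g' where "g' x M q = poly 1 q * x ^ (3 * (n - X t) + A t) * M ^ B t * g x M q" for x M q
      define h' where "h' x M q = poly 1 q * x ^ (3 * (n - X t) + A t) * M ^ B t * h x M q" for x M q
      have "bounded_poly N g'" "bounded_poly N h'"
        unfolding g'_def[abs_def] h'_def[abs_def]
        by (rule bounded_poly_mono[OF bounded_poly_mult_monomial[OF g(1) le(1,2)] le(3)]
            bounded_poly_mono[OF bounded_poly_mult_monomial[OF g(2) le(1,2)] le(3)])+
      then obtain u v where u: "\<forall>x M q. g' x M q = (\<Sum>i\<le>N. \<Sum>j\<le>N. poly (u i j) q * x ^ i * M ^ j)"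
        and v: "\<forall>x M q. h' x M q = (\<Sum>i\<le>N. \<Sum>j\<le>N. poly (v i j) q * x ^ i * M ^ j)"
        using bounded_poly_expansion by meson
      have "q ^ E * x ^ (3 * n) * (x ^ A t * (q powi m) ^ B t * f q (m + int (S t)) (q ^ X t * x)) =
          g' x (q powi m) q * f q m x + h' x (q powi m) q * f q (m + 1) x"
        if "admissible q" "x \<in> generic q" for q m x
      proof -
        have "3 * n = 3 * (n - X t) + 3 * X t"
          using deg[OF t] by simp
        then have "x ^ (3 * n) = x ^ (3 * (n - X t)) * x ^ (3 * X t)"
          by (metis power_add)
        then have "q ^ E * x ^ (3 * n) * (x ^ A t * (q powi m) ^ B t * f q (m + int (S t)) (q ^ X t * x))
            = x ^ (3 * (n - X t) + A t) * (q powi m) ^ B t * (q ^ E * x ^ (3 * X t) * f q (m + int (S t)) (q ^ X t * x))"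
          by (simp add: power_add mult_ac)
        then show ?thesis
          unfolding eq[OF that] g'_def h'_def by (simp add: algebra_simps)
      qed
      then show ?thesis
        unfolding u[rule_format] v[rule_format] by blast
    qed
    then have "\<forall>t\<in>T. \<exists>E u v. \<forall>q m x. admissible q \<longrightarrow> x \<in> generic q \<longrightarrow>
        q ^ E * x ^ (3 * n) * (x ^ A t * (q powi m) ^ B t * f q (m + int (S t)) (q ^ X t * x)) =
        (\<Sum>i\<le>N. \<Sum>j\<le>N. poly (u i j) q * x ^ i * (q powi m) ^ j) * f q m x +
        (\<Sum>i\<le>N. \<Sum>j\<le>N. poly (v i j) q * x ^ i * (q powi m) ^ j) * f q (m + 1) x"
      by blast
    then obtain E u v where "\<forall>t\<in>T. \<forall>q m x. admissible q \<longrightarrow> x \<in> generic q \<longrightarrow>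
        q ^ E t * x ^ (3 * n) * (x ^ A t * (q powi m) ^ B t * f q (m + int (S t)) (q ^ X t * x)) =
        (\<Sum>i\<le>N. \<Sum>j\<le>N. poly (u t i j) q * x ^ i * (q powi m) ^ j) * f q m x +
        (\<Sum>i\<le>N. \<Sum>j\<le>N. poly (v t i j) q * x ^ i * (q powi m) ^ j) * f q (m + 1) x"
      unfolding bchoice_iff by blast
    then have Euv: "q ^ E t * x ^ (3 * n) * (x ^ A t * (q powi m) ^ B t * f q (m + int (S t)) (q ^ X t * x)) =
        (\<Sum>i\<le>N. \<Sum>j\<le>N. poly (u t i j) q * x ^ i * (q powi m) ^ j) * f q m x +
        (\<Sum>i\<le>N. \<Sum>j\<le>N. poly (v t i j) q * x ^ i * (q powi m) ^ j) * f q (m + 1) x"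
      if "t \<in> T" "admissible q" "x \<in> generic q" for t q m x
      using that by blast
    have "finite T"
      using big card.infinite by fastforce
    have "card ((UNIV :: bool set) \<times> {..N} \<times> {..N}) = 2 * (N + 1)\<^sup>2"
      by (simp add: card_cartesian_product power2_eq_square)
    then have "\<exists>w. (\<exists>t\<in>T. w t \<noteq> 0) \<and> (\<forall>k\<in>UNIV \<times> {..N} \<times> {..N}.
        (\<Sum>t\<in>T. w t * (if fst k then u t (fst (snd k)) (snd (snd k)) else v t (fst (snd k)) (snd (snd k)))) = 0)"
      using big \<open>finite T\<close> by (intro linear_dependence) (auto simp: N_def)
    then obtain w where w: "\<exists>t\<in>T. w t \<noteq> 0" and
      w0: "\<forall>k\<in>UNIV \<times> {..N} \<times> {..N}.
        (\<Sum>t\<in>T. w t * (if fst k then u t (fst (snd k)) (snd (snd k)) else v t (fst (snd k)) (snd (snd k)))) = 0"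
      by (elim exE conjE)
    have wu: "(\<Sum>t\<in>T. w t * u t i j) = 0" and wv: "(\<Sum>t\<in>T. w t * v t i j) = 0" if "i \<le> N" "j \<le> N" for i j
      using bspec[OF w0, of "(True, i, j)"] bspec[OF w0, of "(False, i, j)"] that by simp_all
    \<comment> \<open>The power of q cleared depends on the monomial, so it is absorbed into the
      coefficient of the relation.\<close>
    define z where "z t = w t * monom 1 (E t)" for t
    have "\<forall>\<^sub>\<approx>x\<in>-{0}. (\<Sum>(a, b, c, d)\<in>T. poly (z (a, b, c, d)) q * x ^ a * (q powi m) ^ b * f q (m + int d) (q ^ c * x)) = 0"
      if q: "admissible q" for q m
      using eventually_generic[OF q]
    proof eventually_elim
      case (elim x)
      have dbl: "(\<Sum>t\<in>T. poly (w t) q * (\<Sum>i\<le>N. \<Sum>j\<le>N. poly (y t i j) q * x ^ i * (q powi m) ^ j)) = 0"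
        if "\<And>i j. i \<le> N \<Longrightarrow> j \<le> N \<Longrightarrow> (\<Sum>t\<in>T. w t * y t i j) = 0" for y
      proof -
        have "(\<Sum>t\<in>T. poly (w t) q * (\<Sum>i\<le>N. \<Sum>j\<le>N. poly (y t i j) q * x ^ i * (q powi m) ^ j))
           = (\<Sum>t\<in>T. \<Sum>i\<le>N. \<Sum>j\<le>N. poly (w t * y t i j) q * x ^ i * (q powi m) ^ j)"
          by (simp add: sum_distrib_left mult_ac)
        also have "\<dots> = (\<Sum>i\<le>N. \<Sum>j\<le>N. \<Sum>t\<in>T. poly (w t * y t i j) q * x ^ i * (q powi m) ^ j)"
          by (subst sum.swap, intro sum.cong refl, rule sum.swap)
        also have "\<dots> = (\<Sum>i\<le>N. \<Sum>j\<le>N. poly (\<Sum>t\<in>T. w t * y t i j) q * x ^ i * (q powi m) ^ j)"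
          by (simp only: poly_sum sum_distrib_right)
        also have "\<dots> = 0"
          using that by (intro sum.neutral ballI) simp
        finally show ?thesis .
      qed
      define R where "R t = x ^ A t * (q powi m) ^ B t * f q (m + int (S t)) (q ^ X t * x)" for t
      have "x ^ (3 * n) * (\<Sum>(a, b, c, d)\<in>T. poly (z (a, b, c, d)) q * x ^ a * (q powi m) ^ b * f q (m + int d) (q ^ c * x))
         = (\<Sum>t\<in>T. poly (w t) q * (q ^ E t * x ^ (3 * n) * R t))"
        by (simp add: sum_distrib_left case_prod_unfold z_def poly_monom R_def ABXS mult_ac)
      also have "\<dots> = (\<Sum>t\<in>T. poly (w t) q * (\<Sum>i\<le>N. \<Sum>j\<le>N. poly (u t i j) q * x ^ i * (q powi m) ^ j)) * f q m x
         + (\<Sum>t\<in>T. poly (w t) q * (\<Sum>i\<le>N. \<Sum>j\<le>N. poly (v t i j) q * x ^ i * (q powi m) ^ j)) * f q (m + 1) x"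
        unfolding R_def sum_distrib_right sum.distrib[symmetric]
        by (intro sum.cong refl, subst Euv[OF _ q elim]) (simp_all only: distrib_left mult.assoc)
      also have "\<dots> = 0"
        using dbl[of u] dbl[of v] wu wv by simp
      finally show ?case
        using generic_nonzero[OF elim] by simp
    qed
    then have "\<forall>t\<in>T. z t = 0"
      using ind unfolding weyl_independent_def by blast
    then show False
      using w by (auto simp: z_def)
  qed
  then show ?thesis by blast
qed

lemma eval3_sum: "eval3 (sum g K) x M q = (\<Sum>k\<in>K. eval3 (g k) x M q)"
  by (induction K rule: infinite_finite_induct) auto

lemma eval3_monom: "eval3 (monom (monom c j) i) x M q = poly c q * x ^ i * M ^ j"
  by (simp add: eval3_def poly_monom)

text \<open>A relation between unshifted monomials is p f_m + 0 f_(m+1) = 0, a special case of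
  \<open>shift_independent\<close>.\<close>

lemma weyl_independent_monomials:
  "weyl_independent f ((\<lambda>(a, b). (a, b, 0, 0)) ` ({..k} \<times> {..k}))"
  unfolding weyl_independent_def
proof (intro allI impI ballI)
  fix u :: "nat \<times> nat \<times> nat \<times> nat \<Rightarrow> complex poly" and t :: "nat \<times> nat \<times> nat \<times> nat"
  assume rel: "\<forall>q m. admissible q \<longrightarrow>
           (\<forall>\<^sub>\<approx>x\<in>-{0}. (\<Sum>(a, b, c, d)\<in>(\<lambda>(a, b). (a, b, 0, 0)) ` ({..k} \<times> {..k}). poly (u (a, b, c, d)) q * x ^ a * (q powi m) ^ b *
                           f q (m + int d) (q ^ c * x)) = 0)"
    and t: "t \<in> (\<lambda>(a, b). (a, b, 0, 0)) ` ({..k} \<times> {..k})"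
  define p where "p = (\<Sum>a\<le>k. \<Sum>b\<le>k. monom (monom (u (a, b, 0, 0)) b) a)"
  have inj: "inj_on (\<lambda>(a, b). (a, b, 0 :: nat, 0 :: nat)) ({..k} \<times> {..k})"
    by (auto simp: inj_on_def)
  have "\<forall>\<^sub>\<approx>x\<in>-{0}. eval3 p x (q powi m) q * f q m x + eval3 0 x (q powi m) q * f q (m + 1) x = 0"
    if "admissible q" for q m
  proof -
    have "\<forall>\<^sub>\<approx>x\<in>-{0}. (\<Sum>(a, b, c, d)\<in>(\<lambda>(a, b). (a, b, 0, 0)) ` ({..k} \<times> {..k}). poly (u (a, b, c, d)) q * x ^ a * (q powi m) ^ b *
                           f q (m + int d) (q ^ c * x)) = 0"
      using rel that by blast
    then show ?thesis
      unfolding sum.reindex[OF inj]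
      by eventually_elim
         (simp add: case_prod_unfold p_def eval3_sum eval3_monom sum_distrib_right sum.cartesian_product)
  qed
  then have "p = 0"
    using shift_independent by blast
  obtain a b where ab: "t = (a, b, 0, 0)" "a \<le> k" "b \<le> k"
    using t by auto
  have "coeff (coeff p a) b = u t"
    using ab by (simp add: p_def coeff_sum if_distrib[of "\<lambda>p. coeff p b"] cong: if_cong) (subst sum.swap, simp)
  then show "u t = 0"
    using \<open>p = 0\<close> by simp
qed

lemma q_holonomic: "q_holonomic f"
proof -
  define H where "H n = {card T |T. T \<subseteq> {(a, b, c, d). a + b + c + d \<le> n} \<and> weyl_independent f T}" for n
  have fin: "finite {(a, b, c, d). a + b + c + d \<le> (n :: nat)}" for n
  proof (rule finite_subset)
    show "{(a, b, c, d). a + b + c + d \<le> n} \<subseteq> {..n} \<times> {..n} \<times> {..n} \<times> {..n}" by auto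
  qed simp
  have H_fin: "finite (H n)" for n
  proof (rule finite_subset)
    show "H n \<subseteq> card ` Pow {(a, b, c, d). a + b + c + d \<le> n}"
      by (auto simp: H_def)
  qed (use fin in simp)
  have hf: "hilbert_fun f n = Max (H n)" for n
    by (simp add: hilbert_fun_def H_def)
  have lower_mem: "(n div 2 + 1)\<^sup>2 \<in> H n" for n
  proof -
    define T where "T = (\<lambda>(a, b). (a, b, 0 :: nat, 0 :: nat)) ` ({..n div 2} \<times> {..n div 2})"
    have "card T = (n div 2 + 1)\<^sup>2"
      unfolding T_def by (subst card_image) (auto simp: inj_on_def card_cartesian_product power2_eq_square)
    moreover have "T \<subseteq> {(a, b, c, d). a + b + c + d \<le> n}"
      by (auto simp: T_def)
    ultimately show ?thesis
      unfolding H_def using weyl_independent_monomials[of "n div 2"] T_def by (metis (mono_tags, lifting) mem_Collect_eq)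
  qed
  have lower: "(n div 2 + 1)\<^sup>2 \<le> hilbert_fun f n" for n
    unfolding hf using H_fin lower_mem by (rule Max_ge)
  obtain C where C: "\<forall>n T. T \<subseteq> {(a, b, c, d). a + b + c + d \<le> n} \<longrightarrow> weyl_independent f T \<longrightarrow> card T \<le> 2 * (C * n + 1)\<^sup>2"
    using weyl_independent_card_le ..
  have upper: "hilbert_fun f n \<le> 2 * (C * n + 1)\<^sup>2" for n
    unfolding hf
  proof (rule Max.boundedI)
    show "H n \<noteq> {}"
      using lower_mem by blast
    show "a \<le> 2 * (C * n + 1)\<^sup>2" if "a \<in> H n" for a
      using that C unfolding H_def by blast
  qed (rule H_fin)
  have "(\<lambda>n. real (hilbert_fun f n)) \<in> \<Theta>(\<lambda>n. real n ^ 2)"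
  proof (rule bigthetaI)
    show "(\<lambda>n. real (hilbert_fun f n)) \<in> O(\<lambda>n. real n ^ 2)"
    proof (rule landau_o.bigI)
      show "2 * (real C + 1)\<^sup>2 > 0" by simp
      show "\<forall>\<^sub>F n in sequentially. norm (real (hilbert_fun f n)) \<le> 2 * (real C + 1)\<^sup>2 * norm (real n ^ 2)"
        using eventually_ge_at_top[of 1]
      proof eventually_elim
        case (elim n)
        have "real (hilbert_fun f n) \<le> real (2 * (C * n + 1)\<^sup>2)"
          using upper of_nat_mono by blast
        also have "\<dots> \<le> 2 * (real C * real n + real n)\<^sup>2"
          using elim by (simp add: power_mono)
        also have "\<dots> = 2 * (real C + 1)\<^sup>2 * real n ^ 2"
          by (simp add: power2_eq_square algebra_simps)
        finally show ?case by simp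
      qed
    qed
    show "(\<lambda>n. real (hilbert_fun f n)) \<in> \<Omega>(\<lambda>n. real n ^ 2)"
    proof (rule landau_omega.bigI)
      show "(1 / 4 :: real) > 0" by simp
      show "\<forall>\<^sub>F n in sequentially. norm (real (hilbert_fun f n)) \<ge> 1 / 4 * norm (real n ^ 2)"
      proof (rule always_eventually, rule allI)
        fix n :: nat
        \<comment> \<open>The box with both exponents at most \<open>n div 2\<close> lies in total
          degree at most n; this estimate is the origin of the constant 1/4.\<close>
        have "n \<le> 2 * (n div 2 + 1)" by simp
        then have "n\<^sup>2 \<le> (2 * (n div 2 + 1))\<^sup>2"
          by (rule power_mono) simp
        also have "\<dots> = 4 * (n div 2 + 1)\<^sup>2"
          by (simp only: power_mult_distrib) simp
        also have "\<dots> \<le> 4 * hilbert_fun f n"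
          using lower by simp
        finally have "real (n\<^sup>2) \<le> real (4 * hilbert_fun f n)"
          using of_nat_le_iff by blast
        then show "norm (real (hilbert_fun f n)) \<ge> 1 / 4 * norm (real n ^ 2)"
          by simp
      qed
    qed
  qed
  then show ?thesis
    by (simp add: q_holonomic_def)
qed

end

section \<open>Bases of solutions\<close>

interpretation block_A: block_family block_A
proof
  show "block_A q m x \<noteq> 0 \<or> block_A q (m + 1) x \<noteq> 0" if "admissible q" "x \<in> generic q" for q x m
    using block_wronskian[OF that, of m] generic_nonzero[OF that(2)] by auto
qed (rule block_rec(1) block_first(1); assumption)+

interpretation block_B: block_family block_B
proof
  show "block_B q m x \<noteq> 0 \<or> block_B q (m + 1) x \<noteq> 0" if "admissible q" "x \<in> generic q" for q x m
    using block_wronskian[OF that, of m] generic_nonzero[OF that(2)] by auto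
qed (rule block_rec(2) block_first(2); assumption)+

lemma mero_family_shift:
  assumes "q \<noteq> 0" "mero_family h"
  shows "mero_family (\<lambda>m x. h (m + int j) (q ^ i * x))"
  unfolding mero_family_def
proof
  fix m
  have "h (m + int j) meromorphic_on -{0}"
    using assms(2) by (simp add: mero_family_def)
  then show "(\<lambda>x. h (m + int j) (q ^ i * x)) meromorphic_on -{0}"
    by (rule meromorphic_on_compose) (use assms(1) in \<open>auto intro!: analytic_intros\<close>)
qed

text \<open>Cramer's rule: the coefficients of a solution are quotients of two Casorati determinants,
  both of which are multiplied by \<open>- \<gamma>\<close> under the shift.\<close>

lemma basis_of_solutions_second_order:
  fixes f g :: "int \<Rightarrow> complex \<Rightarrow> complex"
  assumes q: "q \<noteq> 0"
    and f: "is_solution q G f" and g: "is_solution q G g"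
    and W: "\<And>m. \<forall>\<^sub>\<approx>x\<in>-{0}. f m x * g (m + int j) (q ^ i * x) - g m x * f (m + int j) (q ^ i * x) \<noteq> 0"
    and \<gamma>: "\<And>m. \<forall>\<^sub>\<approx>x\<in>-{0}. \<gamma> m x \<noteq> 0"
    and rec: "\<And>h m. is_solution q G h \<Longrightarrow> \<forall>\<^sub>\<approx>x\<in>-{0}. h (m + int j + int j) (q ^ i * (q ^ i * x)) =
        \<beta> m x * h (m + int j) (q ^ i * x) + \<gamma> m x * h m x"
  shows "basis_of_solutions q {(i, j)} G f g"
proof -
  define \<sigma> where "\<sigma> h = (\<lambda>m x. h (m + int j) (q ^ i * x))" for h :: "int \<Rightarrow> complex \<Rightarrow> complex"
  define w where "w h k = (\<lambda>m x. h m x * \<sigma> k m x - k m x * \<sigma> h m x)" for h k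
  have mero_w: "mero_family (w h k)" if "mero_family h" "mero_family k" for h k
    using that mero_family_shift[OF q that(1), of j i] mero_family_shift[OF q that(2), of j i]
    unfolding mero_family_def w_def \<sigma>_def by (auto intro!: meromorphic_intros)
  have mero: "mero_family h" if "is_solution q G h" for h
    using that by (simp add: is_solution_def)
  have shift: "\<forall>\<^sub>\<approx>x\<in>-{0}. P (q ^ i * x)" if "\<forall>\<^sub>\<approx>x\<in>-{0}. P x" for P
    using q that by (intro cosparse_scale) auto
  have w_shift: "\<forall>\<^sub>\<approx>x\<in>-{0}. \<sigma> (w h k) m x = - \<gamma> m x * w h k m x"
    if "is_solution q G h" "is_solution q G k" for h k m
    using rec[OF that(1), of m] rec[OF that(2), of m]
    by eventually_elim (simp add: w_def \<sigma>_def algebra_simps)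
  have Wfg: "\<forall>\<^sub>\<approx>x\<in>-{0}. w f g m x \<noteq> 0" for m
    using W[of m] by (simp add: w_def \<sigma>_def)
  have scalar: "is_scalar q {(i, j)} (\<lambda>m x. w h k m x / w f g m x)" if "is_solution q G h" "is_solution q G k" for h k
    unfolding is_scalar_def
  proof (intro conjI ballI)
    show "mero_family (\<lambda>m x. w h k m x / w f g m x)"
      using mero_w mero f g that by (auto simp: mero_family_def intro!: meromorphic_intros)
    fix ij assume "ij \<in> {(i, j)}"
    moreover have "\<forall>\<^sub>\<approx>x\<in>-{0}. w h k (m + int j) (q ^ i * x) / w f g (m + int j) (q ^ i * x) = w h k m x / w f g m x" for m
      using w_shift[OF that, of m] w_shift[OF f g, of m] \<gamma>[of m] Wfg[of m]
      by eventually_elim (simp add: \<sigma>_def)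
    ultimately show "case ij of (i, j) \<Rightarrow> \<forall>m. \<forall>\<^sub>\<approx>x\<in>-{0}. w h k (m + int j) (q ^ i * x) / w f g (m + int j) (q ^ i * x) = w h k m x / w f g m x"
      by simp
  qed
  have "\<forall>\<^sub>\<approx>x\<in>-{0}. h m x = w h g m x / w f g m x * f m x + w f h m x / w f g m x * g m x" for h m
    using Wfg[of m]
  proof eventually_elim
    case (elim x)
    have "w f g m x * h m x = w h g m x * f m x + w f h m x * g m x"
      by (simp add: w_def algebra_simps)
    then show ?case
      using elim by (simp add: field_simps)
  qed
  then have "\<exists>c d. is_scalar q {(i, j)} c \<and> is_scalar q {(i, j)} d \<and>
           (\<forall>m. \<forall>\<^sub>\<approx>x\<in>-{0}. h m x = c m x * f m x + d m x * g m x)" if "is_solution q G h" for h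
    using scalar[OF that g] scalar[OF f that] by blast
  moreover have "\<forall>\<^sub>\<approx>x\<in>-{0}. c m x = 0 \<and> d m x = 0"
    if c: "is_scalar q {(i, j)} c" and d: "is_scalar q {(i, j)} d"
      and rel: "\<forall>m. \<forall>\<^sub>\<approx>x\<in>-{0}. c m x * f m x + d m x * g m x = 0" for c d m
  proof -
    have "\<forall>\<^sub>\<approx>x\<in>-{0}. c (m + int j) (q ^ i * x) = c m x" "\<forall>\<^sub>\<approx>x\<in>-{0}. d (m + int j) (q ^ i * x) = d m x"
      using c d by (auto simp: is_scalar_def)
    moreover have "\<forall>\<^sub>\<approx>x\<in>-{0}. c m x * f m x + d m x * g m x = 0"
      using rel by blast
    \<comment> \<open>Together with the relation itself, its shift gives a linear system for
      \<open>c\<close> and \<open>d\<close> with the nonvanishing determinant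
      \<open>w f g\<close>.\<close>
    moreover have "\<forall>\<^sub>\<approx>x\<in>-{0}. c (m + int j) (q ^ i * x) * \<sigma> f m x + d (m + int j) (q ^ i * x) * \<sigma> g m x = 0"
      unfolding \<sigma>_def using rel by (intro shift[where P = "\<lambda>y. c (m + int j) y * f (m + int j) y + d (m + int j) y * g (m + int j) y = 0"]) auto
    ultimately show ?thesis
      using Wfg[of m]
    proof eventually_elim
      case (elim x)
      have rel: "c m x * f m x + d m x * g m x = 0" "c m x * \<sigma> f m x + d m x * \<sigma> g m x = 0"
        using elim(1-4) by simp_all
      have "c m x * w f g m x = \<sigma> g m x * (c m x * f m x + d m x * g m x) - g m x * (c m x * \<sigma> f m x + d m x * \<sigma> g m x)"
        "d m x * w f g m x = f m x * (c m x * \<sigma> f m x + d m x * \<sigma> g m x) - \<sigma> f m x * (c m x * f m x + d m x * g m x)"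
        unfolding w_def by (simp_all add: algebra_simps)
      then have "c m x * w f g m x = 0" "d m x * w f g m x = 0"
        unfolding rel by simp_all
      then show ?case
        using elim by simp
    qed
  qed
  ultimately show ?thesis
    unfolding basis_of_solutions_def using f g by blast
qed

lemma is_solution_iff_B_hat:
  assumes "q \<noteq> 0"
  shows "is_solution q {B_hat} h \<longleftrightarrow> mero_family h \<and> (\<forall>m. \<forall>\<^sub>\<approx>x\<in>-{0}.
    h (m + 2) x = (x\<^sup>2 + x - q powi (m + 1) * x ^ 3) * h (m + 1) x - x ^ 3 * h m x)"
proof -
  have "(\<forall>\<^sub>\<approx>x\<in>-{0}. apply_op B_hat q h m x = 0) \<longleftrightarrow> (\<forall>\<^sub>\<approx>x\<in>-{0}.
    h (m + 2) x = (x\<^sup>2 + x - q powi (m + 1) * x ^ 3) * h (m + 1) x - x ^ 3 * h m x)" for m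
  proof (rule eventually_subst)
    have "\<forall>\<^sub>\<approx>x\<in>-{0::complex}. x \<in> - {0}"
      by (rule eventually_in_cosparse) (auto simp: open_Compl)
    then show "\<forall>\<^sub>\<approx>x\<in>-{0}. (apply_op B_hat q h m x = 0) =
        (h (m + 2) x = (x\<^sup>2 + x - q powi (m + 1) * x ^ 3) * h (m + 1) x - x ^ 3 * h m x)"
      by eventually_elim (use assms in \<open>simp add: apply_B_hat_eq_0_iff\<close>)
  qed
  then show ?thesis
    by (simp add: is_solution_def)
qed

lemma basis_B_hat:
  assumes "admissible q"
  shows "basis_of_solutions q {(0, 1)} {B_hat} (block_A q) (block_B q)"
proof (rule basis_of_solutions_second_order[where \<beta> = "\<lambda>m x. x\<^sup>2 + x - q powi (m + 1) * x ^ 3" and \<gamma> = "\<lambda>m x. - (x ^ 3)"])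
  show q0: "q \<noteq> 0"
    using assms by (simp add: admissible_def)
  have gen: "\<forall>\<^sub>\<approx>x\<in>-{0}. x \<in> generic q"
    using assms by (rule eventually_generic)
  show "is_solution q {B_hat} (block_A q)" "is_solution q {B_hat} (block_B q)"
    unfolding is_solution_iff_B_hat[OF q0]
    by (auto intro!: mero_family_block assms eventually_mono[OF gen] block_rec)
  show "\<forall>\<^sub>\<approx>x\<in>-{0}. block_A q m x * block_B q (m + int 1) (q ^ 0 * x) - block_B q m x * block_A q (m + int 1) (q ^ 0 * x) \<noteq> 0" for m
    using gen by eventually_elim (use block_wronskian[OF assms] generic_nonzero in simp)
  show "\<forall>\<^sub>\<approx>x\<in>-{0}. - (x ^ 3) \<noteq> (0 :: complex)"
    using gen by eventually_elim (use generic_nonzero in simp)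
  show "\<forall>\<^sub>\<approx>x\<in>-{0}. h (m + int 1 + int 1) (q ^ 0 * (q ^ 0 * x)) =
        (x\<^sup>2 + x - q powi (m + 1) * x ^ 3) * h (m + int 1) (q ^ 0 * x) + - (x ^ 3) * h m x"
    if "is_solution q {B_hat} h" for h m
  proof -
    have i: "m + int 1 = m + 1" "m + 1 + 1 = m + 2" "m + 1 + int 1 = m + 2" by simp_all
    show ?thesis
      using that unfolding is_solution_iff_B_hat[OF q0] i by simp
  qed
qed

lemma is_solution_first_op:
  "is_solution q G h \<Longrightarrow> first_op \<in> G \<Longrightarrow> \<forall>\<^sub>\<approx>x\<in>-{0}.
    x ^ 3 * h m (q * x) = - (q powi m) * x\<^sup>2 * h m x + (q powi m - q * (q powi m)\<^sup>2 * x\<^sup>2) * h (m + 1) x"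
  unfolding apply_first_op_eq_0_iff[symmetric] by (auto simp: is_solution_def)

text \<open>The equation in \<open>m\<close> supplies coefficients independent of \<open>m\<close>;
  \<open>first_op\<close> then forces them to be q-periodic in \<open>x\<close>. Independence is
  inherited, since the joint scalars are among those of the equation in \<open>m\<close>.\<close>

lemma basis_ideal:
  assumes "admissible q"
  shows "basis_of_solutions q {(1, 0), (0, 1)} {first_op, B_hat} (block_A q) (block_B q)"
proof -
  have q0: "q \<noteq> 0"
    using assms by (simp add: admissible_def)
  have gen: "\<forall>\<^sub>\<approx>x\<in>-{0}. x \<in> generic q"
    using assms by (rule eventually_generic)
  have scalar_iff: "is_scalar q {(1, 0), (0, 1)} c \<longleftrightarrow> is_scalar q {(0, 1)} c \<and> (\<forall>m. \<forall>\<^sub>\<approx>x\<in>-{0}. c m (q * x) = c m x)" for c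
    by (auto simp: is_scalar_def)
  have sol_iff: "is_solution q {first_op, B_hat} h \<longleftrightarrow> is_solution q {B_hat} h \<and> is_solution q {first_op} h" for h
    by (auto simp: is_solution_def)
  note basis = basis_B_hat[OF assms]
  have firstA: "\<forall>\<^sub>\<approx>x\<in>-{0}. apply_op first_op q (block_A q) m x = 0" for m
    using gen by eventually_elim (simp add: apply_first_op_eq_0_iff block_first assms)
  have firstB: "\<forall>\<^sub>\<approx>x\<in>-{0}. apply_op first_op q (block_B q) m x = 0" for m
    using gen by eventually_elim (simp add: apply_first_op_eq_0_iff block_first assms)
  have sol: "is_solution q {first_op, B_hat} (block_A q)" "is_solution q {first_op, B_hat} (block_B q)"
    using basis firstA firstB unfolding sol_iff basis_of_solutions_def by (auto simp: is_solution_def)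
  have "\<exists>c d. is_scalar q {(1, 0), (0, 1)} c \<and> is_scalar q {(1, 0), (0, 1)} d \<and>
           (\<forall>m. \<forall>\<^sub>\<approx>x\<in>-{0}. h m x = c m x * block_A q m x + d m x * block_B q m x)"
    if h: "is_solution q {first_op, B_hat} h" for h
  proof -
    have "is_solution q {B_hat} h"
      using h by (simp add: sol_iff)
    then obtain c d where c: "is_scalar q {(0, 1)} c" and d: "is_scalar q {(0, 1)} d"
      and hcd: "\<And>m. \<forall>\<^sub>\<approx>x\<in>-{0}. h m x = c m x * block_A q m x + d m x * block_B q m x"
      using basis unfolding basis_of_solutions_def by blast
    have inv: "\<forall>\<^sub>\<approx>x\<in>-{0}. c (m + 1) x = c m x" "\<forall>\<^sub>\<approx>x\<in>-{0}. d (m + 1) x = d m x" for m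
      using c d by (auto simp: is_scalar_def)
    \<comment> \<open>Comparing the expansion of \<open>h\<close> at \<open>q * x\<close> with the
      one obtained by applying \<open>first_op\<close> at \<open>x\<close> leaves the increments of
      \<open>c\<close> and \<open>d\<close> as coefficients.\<close>
    have rel: "\<forall>\<^sub>\<approx>x\<in>-{0}. (c m (q * x) - c m x) * block_A q m (q * x) + (d m (q * x) - d m x) * block_B q m (q * x) = 0" for m
      using gen hcd[of m] hcd[of "m + 1"] inv[of m] cosparse_scale[OF q0 hcd[of m]] is_solution_first_op[OF h, of m, simplified]
    proof eventually_elim
      case (elim x)
      define r where "r = - (q powi m) * x\<^sup>2"
      define s where "s = q powi m - q * (q powi m)\<^sup>2 * x\<^sup>2"
      have A: "x ^ 3 * block_A q m (q * x) = r * block_A q m x + s * block_A q (m + 1) x"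
        and B: "x ^ 3 * block_B q m (q * x) = r * block_B q m x + s * block_B q (m + 1) x"
        unfolding r_def s_def using block_first[OF assms elim(1)] by simp_all
      have h: "x ^ 3 * h m (q * x) = r * h m x + s * h (m + 1) x"
        using elim(7) by (simp add: r_def s_def)
      have "x ^ 3 * ((c m (q * x) - c m x) * block_A q m (q * x) + (d m (q * x) - d m x) * block_B q m (q * x))
         = x ^ 3 * h m (q * x) - c m x * (x ^ 3 * block_A q m (q * x)) - d m x * (x ^ 3 * block_B q m (q * x))"
        unfolding elim(6) by (simp add: algebra_simps)
      also have "\<dots> = 0"
        unfolding h A B elim(2,3) elim(4,5) by (simp add: algebra_simps)
      finally show ?case
        using generic_nonzero[OF elim(1)] by simp
    qed
    \<comment> \<open>The relation at \<open>m\<close> and at \<open>m + 1\<close> has the same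
      increments, and its determinant is the Wronskian at \<open>q * x\<close>.\<close>
    have "\<forall>\<^sub>\<approx>x\<in>-{0}. c m (q * x) = c m x \<and> d m (q * x) = d m x" for m
      using gen rel[of m] rel[of "m + 1"] inv[of m] cosparse_scale[OF q0 inv(1)[of m]] cosparse_scale[OF q0 inv(2)[of m]]
    proof eventually_elim
      case (elim x)
      have W: "block_A q m (q * x) * block_B q (m + 1) (q * x) - block_B q m (q * x) * block_A q (m + 1) (q * x) \<noteq> 0"
        using block_wronskian[OF assms generic_mult[OF q0 elim(1)], of m] generic_nonzero[OF elim(1)] q0 by simp
      define C D where "C = c m (q * x) - c m x" and "D = d m (q * x) - d m x"
      have "C * block_A q m (q * x) + D * block_B q m (q * x) = 0"
        "C * block_A q (m + 1) (q * x) + D * block_B q (m + 1) (q * x) = 0"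
        using elim(2,3) unfolding elim(4-7) by (simp_all add: C_def D_def)
      then have "C * (block_A q m (q * x) * block_B q (m + 1) (q * x) - block_B q m (q * x) * block_A q (m + 1) (q * x)) = 0"
        "D * (block_A q m (q * x) * block_B q (m + 1) (q * x) - block_B q m (q * x) * block_A q (m + 1) (q * x)) = 0"
        by algebra+
      then show ?case
        using W by (simp add: C_def D_def)
    qed
    then have "\<forall>m. \<forall>\<^sub>\<approx>x\<in>-{0}. c m (q * x) = c m x" "\<forall>m. \<forall>\<^sub>\<approx>x\<in>-{0}. d m (q * x) = d m x"
      by (simp_all add: eventually_conj_iff)
    then show ?thesis
      using c d hcd scalar_iff by blast
  qed
  then show ?thesis
    using basis sol unfolding basis_of_solutions_def scalar_iff by blast
qed

section \<open>The second-order equation in x\<close>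

definition A_hat_coeff0 :: "complex \<Rightarrow> complex \<Rightarrow> complex \<Rightarrow> complex" where
  "A_hat_coeff0 q M x = q\<^sup>2 * M ^ 3 * x\<^sup>2 * (- 1 + q ^ 3 * M * x\<^sup>2)"

definition A_hat_coeff1 :: "complex \<Rightarrow> complex \<Rightarrow> complex \<Rightarrow> complex" where
  "A_hat_coeff1 q M x = - M * (- 1 + q\<^sup>2 * M * x\<^sup>2) * (1 - q * x - q * M * x\<^sup>2 - q ^ 3 * M * x\<^sup>2
             - q ^ 3 * M * x ^ 3 + q ^ 4 * M\<^sup>2 * x ^ 4)"

definition A_hat_coeff2 :: "complex \<Rightarrow> complex \<Rightarrow> complex \<Rightarrow> complex" where
  "A_hat_coeff2 q M x = q\<^sup>2 * x\<^sup>2 * (- 1 + q * M * x\<^sup>2)"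

lemma apply_A_hat:
  "apply_op A_hat q h m x = A_hat_coeff0 q (q powi m) x * h m x + A_hat_coeff1 q (q powi m) x * h m (q * x) + A_hat_coeff2 q (q powi m) x * h m (q * (q * x))"
proof -
  have A: "A_hat = single (0, 0) C0 + single (1, 0) C1 + single (2, 0) C2"
    by (simp add: A_hat_def coeff_op_def S_x_def op_mult_single numeral_2_eq_2)
  have c: "regular C0 x M q" "rf_eval C0 x M q = A_hat_coeff0 q M x" "regular C1 x M q" "rf_eval C1 x M q = A_hat_coeff1 q M x"
    "regular C2 x M q" "rf_eval C2 x M q = A_hat_coeff2 q M x" for M
    unfolding C0_def C1_def C2_def A_hat_coeff0_def A_hat_coeff1_def A_hat_coeff2_def
    by (simp_all add: regular_simps regular_diff rf_eval_diff)
  show ?thesis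
    unfolding A
    by (simp add: apply_op_add op_regular_add op_regular_single apply_op_single c)
       (simp add: power2_eq_square mult.assoc)
qed

text \<open>The letters stand for f_m(x), f_(m+1)(x), f_m(qx), f_(m+1)(qx) and f_m(q^2 x);
  \<open>g\<close> and \<open>G\<close> are eliminated. Multiplying by q x^4 produces the left-hand
  sides of the hypotheses.\<close>

lemma A_hat_from_system:
  fixes f g F G H M q x :: complex
  assumes "q \<noteq> 0" "x \<noteq> 0"
    and F: "x ^ 3 * F = - M * x\<^sup>2 * f + (M - q * M\<^sup>2 * x\<^sup>2) * g"
    and G: "x ^ 3 * G = - (q * M) * x\<^sup>2 * g + (q * M - q * (q * M)\<^sup>2 * x\<^sup>2) * ((x\<^sup>2 + x - q * M * x ^ 3) * g - x ^ 3 * f)"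
    and H: "(q * x) ^ 3 * H = - M * (q * x)\<^sup>2 * F + (M - q * M\<^sup>2 * (q * x)\<^sup>2) * G"
  shows "A_hat_coeff0 q M x * f + A_hat_coeff1 q M x * F + A_hat_coeff2 q M x * H = 0"
proof -
  have "q * x ^ 4 * (A_hat_coeff0 q M x * f + A_hat_coeff1 q M x * F + A_hat_coeff2 q M x * H) =
     q * x ^ 4 * A_hat_coeff0 q M x * f + q * x * A_hat_coeff1 q M x * (x ^ 3 * F) + (- 1 + q * M * x\<^sup>2) * x ^ 3 * ((q * x) ^ 3 * H)"
    by (simp add: A_hat_coeff2_def algebra_simps power2_eq_square power3_eq_cube power4_eq_xxxx)
  also have "\<dots> = q * x ^ 4 * A_hat_coeff0 q M x * f + q * x * A_hat_coeff1 q M x * (x ^ 3 * F) +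
     (- 1 + q * M * x\<^sup>2) * (- M * (q * x)\<^sup>2 * (x ^ 3 * F) + (M - q * M\<^sup>2 * (q * x)\<^sup>2) * (x ^ 3 * G))"
    unfolding H by (simp add: algebra_simps)
  also have "\<dots> = 0"
    unfolding F G A_hat_coeff0_def A_hat_coeff1_def by algebra
  finally show ?thesis
    using assms(1,2) by simp
qed

lemma eventually_quadratic_nonzero:
  fixes c :: complex
  shows "\<forall>\<^sub>\<approx>x\<in>-{0}. - 1 + c * x\<^sup>2 \<noteq> 0"
proof -
  have "{x. - 1 + c * x\<^sup>2 = 0} = {x. poly [:-1, 0, c:] x = 0}"
    by (simp add: power2_eq_square mult_ac)
  moreover have "[:-1, 0, c:] \<noteq> 0"
    by simp
  ultimately have "finite {x. - 1 + c * x\<^sup>2 = 0}"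
    using poly_roots_finite by metis
  then show ?thesis
    by (simp add: eventually_cosparse finite_imp_sparse)
qed

text \<open>Inserting \<open>first_op\<close> into the second row, the multiple of the first row
  drops out and the coefficient of f_(m+1) times the Wronskian in \<open>m\<close> remains.\<close>

lemma det_wronskian_x:
  assumes "admissible q" "x \<in> generic q"
  shows "block_A q m x * block_B q m (q * x) - block_B q m x * block_A q m (q * x)
    = q powi m * x powi (3 * m) * (1 - q powi (m + 1) * x\<^sup>2)"
proof -
  have x: "x \<noteq> 0"
    using assms(2) by (rule generic_nonzero)
  have qM: "q powi (m + 1) = q * q powi m" "x powi (3 * m + 3) = x ^ 3 * x powi (3 * m)"
    using assms(1) x by (simp_all add: admissible_def power_int_add)
  have "x ^ 3 * (block_A q m x * block_B q m (q * x) - block_B q m x * block_A q m (q * x))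
     = block_A q m x * (x ^ 3 * block_B q m (q * x)) - block_B q m x * (x ^ 3 * block_A q m (q * x))"
    by (simp add: algebra_simps)
  also have "\<dots> = (q powi m - q * (q powi m)\<^sup>2 * x\<^sup>2)
      * (block_A q m x * block_B q (m + 1) x - block_B q m x * block_A q (m + 1) x)"
    unfolding block_first[OF assms] by (simp add: algebra_simps)
  also have "\<dots> = x ^ 3 * (q powi m * x powi (3 * m) * (1 - q powi (m + 1) * x\<^sup>2))"
    unfolding block_wronskian[OF assms] qM by (simp add: algebra_simps power2_eq_square)
  finally show ?thesis
    using x by simp
qed

lemma basis_A_hat:
  assumes "admissible q"
  shows "basis_of_solutions q {(1, 0)} {A_hat} (block_A q) (block_B q)"
proof (rule basis_of_solutions_second_order[where \<beta> = "\<lambda>m x. - (A_hat_coeff1 q (q powi m) x / A_hat_coeff2 q (q powi m) x)"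
      and \<gamma> = "\<lambda>m x. - (A_hat_coeff0 q (q powi m) x / A_hat_coeff2 q (q powi m) x)"])
  show q0: "q \<noteq> 0"
    using assms by (simp add: admissible_def)
  have gen: "\<forall>\<^sub>\<approx>x\<in>-{0}. x \<in> generic q"
    using assms by (rule eventually_generic)
  have A_hat_coeff2: "\<forall>\<^sub>\<approx>x\<in>-{0}. A_hat_coeff2 q (q powi m) x \<noteq> 0" for m
    using gen eventually_quadratic_nonzero[of "q * q powi m"]
    by eventually_elim (use q0 generic_nonzero in \<open>auto simp: A_hat_coeff2_def\<close>)
  have A_hat_coeff0: "\<forall>\<^sub>\<approx>x\<in>-{0}. A_hat_coeff0 q (q powi m) x \<noteq> 0" for m
    using gen eventually_quadratic_nonzero[of "q ^ 3 * q powi m"]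
    by eventually_elim (use q0 generic_nonzero in \<open>auto simp: A_hat_coeff0_def\<close>)
  have qM: "q powi (m + 1) = q * q powi m" and i: "m + 1 + 1 = m + 2" for m
    using q0 by (simp_all add: power_int_add)
  have "\<forall>\<^sub>\<approx>x\<in>-{0}. apply_op A_hat q (block_A q) m x = 0" for m
    using gen
  proof eventually_elim
    case (elim x)
    show ?case
      unfolding apply_A_hat
      using block_first(1)[OF assms elim, of m] block_first(1)[OF assms elim, of "m + 1"] block_rec(1)[OF assms elim, of m]
        block_first(1)[OF assms generic_mult[OF q0 elim], of m]
      by (intro A_hat_from_system[where G = "block_A q (m + 1) (q * x)" and g = "block_A q (m + 1) x"] q0 generic_nonzero[OF elim])
         (simp_all only: qM i)
  qed
  moreover have "\<forall>\<^sub>\<approx>x\<in>-{0}. apply_op A_hat q (block_B q) m x = 0" for m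
    using gen
  proof eventually_elim
    case (elim x)
    show ?case
      unfolding apply_A_hat
      using block_first(2)[OF assms elim, of m] block_first(2)[OF assms elim, of "m + 1"] block_rec(2)[OF assms elim, of m]
        block_first(2)[OF assms generic_mult[OF q0 elim], of m]
      by (intro A_hat_from_system[where G = "block_B q (m + 1) (q * x)" and g = "block_B q (m + 1) x"] q0 generic_nonzero[OF elim])
         (simp_all only: qM i)
  qed
  ultimately show "is_solution q {A_hat} (block_A q)" "is_solution q {A_hat} (block_B q)"
    using mero_family_block[OF assms] by (auto simp: is_solution_def)
  show "\<forall>\<^sub>\<approx>x\<in>-{0}. block_A q m x * block_B q (m + int 0) (q ^ 1 * x) - block_B q m x * block_A q (m + int 0) (q ^ 1 * x) \<noteq> 0" for m
    using gen eventually_quadratic_nonzero[of "q * q powi m"]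
  proof eventually_elim
    case (elim x)
    then show ?case
      using det_wronskian_x[OF assms elim(1), of m] generic_nonzero[OF elim(1)] q0 by (auto simp: qM)
  qed
  show "\<forall>\<^sub>\<approx>x\<in>-{0}. - (A_hat_coeff0 q (q powi m) x / A_hat_coeff2 q (q powi m) x) \<noteq> 0" for m
    using A_hat_coeff0[of m] A_hat_coeff2[of m] by eventually_elim simp
  show "\<forall>\<^sub>\<approx>x\<in>-{0}. h (m + int 0 + int 0) (q ^ 1 * (q ^ 1 * x)) =
       - (A_hat_coeff1 q (q powi m) x / A_hat_coeff2 q (q powi m) x) * h (m + int 0) (q ^ 1 * x) + - (A_hat_coeff0 q (q powi m) x / A_hat_coeff2 q (q powi m) x) * h m x"
    if "is_solution q {A_hat} h" for h m
  proof -
    have "\<forall>\<^sub>\<approx>x\<in>-{0}. apply_op A_hat q h m x = 0"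
      using that by (simp add: is_solution_def)
    then show ?thesis
      using A_hat_coeff2[of m]
    proof eventually_elim
      case (elim x)
      have "A_hat_coeff2 q (q powi m) x * h m (q * (q * x)) = - A_hat_coeff1 q (q powi m) x * h m (q * x) - A_hat_coeff0 q (q powi m) x * h m x"
        using elim(1) unfolding apply_A_hat by algebra
      then have "h m (q * (q * x)) = (- A_hat_coeff1 q (q powi m) x * h m (q * x) - A_hat_coeff0 q (q powi m) x * h m x) / A_hat_coeff2 q (q powi m) x"
        using elim(2) by (simp add: eq_divide_eq mult.commute)
      then show ?case
        by (simp add: diff_divide_distrib)
    qed
  qed
qed

section \<open>Determinants and orthogonality\<close>

lemma laurent_eval_superset:
  assumes "finite K" "keys p \<subseteq> K"
  shows "laurent_eval p q x = (\<Sum>(i, j)\<in>K. of_int (lookup p (i, j)) * q powi i * x powi j)"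
  unfolding laurent_eval_def using assms by (intro sum.mono_neutral_left) (auto simp: in_keys_iff)

lemma laurent_eval_0 [simp]: "laurent_eval 0 q x = 0"
  by (simp add: laurent_eval_def)

lemma laurent_eval_single: "laurent_eval (single (i, j) c) q x = of_int c * q powi i * x powi j"
  by (subst laurent_eval_superset[of "{(i, j)}"]) auto

lemma laurent_eval_add: "laurent_eval (p + r) q x = laurent_eval p q x + laurent_eval r q x"
proof -
  define K where "K = keys p \<union> keys r"
  have K: "finite K" "keys (p + r) \<subseteq> K" "keys p \<subseteq> K" "keys r \<subseteq> K"
    using keys_add[of p r] by (auto simp: K_def)
  show ?thesis
    unfolding laurent_eval_superset[OF K(1,2)] laurent_eval_superset[OF K(1,3)] laurent_eval_superset[OF K(1,4)]
    by (simp add: lookup_add distrib_right sum.distrib case_prod_unfold)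
qed

lemma laurent_eval_mult:
  assumes "q \<noteq> 0" "x \<noteq> 0"
  shows "laurent_eval (p * r) q x = laurent_eval p q x * laurent_eval r q x"
proof (induction p rule: pair_mapping_induct)
  case (single i j c)
  show ?case
  proof (induction r rule: pair_mapping_induct)
    case (single k l d)
    then show ?case
      using assms by (simp add: mult_single laurent_eval_single power_int_add)
  qed (simp_all add: laurent_eval_add distrib_left)
qed (simp_all add: laurent_eval_add distrib_right)

lemma laurent_eval_sum: "laurent_eval (sum g K) q x = (\<Sum>k\<in>K. laurent_eval (g k) q x)"
  by (induction K rule: infinite_finite_induct) (auto simp: laurent_eval_add)

definition laurent_mat :: "laurent^2^2 \<Rightarrow> complex \<Rightarrow> complex \<Rightarrow> complex^2^2" where
  "laurent_mat G q x = (\<chi> i j. laurent_eval (G $ i $ j) q x)"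

lemma laurent_mat_mult:
  assumes "q \<noteq> 0" "x \<noteq> 0"
  shows "laurent_mat (G ** H) q x = laurent_mat G q x ** laurent_mat H q x"
  by (simp add: laurent_mat_def matrix_matrix_mult_def vec_eq_iff laurent_eval_sum laurent_eval_mult[OF assms])

lemma laurent_mat_transpose: "laurent_mat (transpose G) q x = transpose (laurent_mat G q x)"
  by (simp add: laurent_mat_def transpose_def vec_eq_iff)

abbreviation (input) entry :: "'a^'n^'m \<Rightarrow> 'm \<Rightarrow> 'n \<Rightarrow> 'a" where
  "entry A i j \<equiv> vec_nth (vec_nth A i) j"

lemma matrix_2x2_eq_iff:
  fixes A B :: "'a^2^2"
  shows "A = B \<longleftrightarrow> entry A 1 1 = entry B 1 1 \<and> entry A 1 2 = entry B 1 2
     \<and> entry A 2 1 = entry B 2 1 \<and> entry A 2 2 = entry B 2 2"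
  unfolding vec_eq_iff forall_2 by (simp only: conj_assoc)

lemma vector_2x2 [simp]:
  fixes a b c d :: "'a::zero"
  shows "entry (vector [vector [a, b], vector [c, d]] :: 'a^2^2) 1 1 = a"
  "entry (vector [vector [a, b], vector [c, d]] :: 'a^2^2) 1 2 = b"
  "entry (vector [vector [a, b], vector [c, d]] :: 'a^2^2) 2 1 = c"
  "entry (vector [vector [a, b], vector [c, d]] :: 'a^2^2) 2 2 = d"
  by simp_all

lemmas matrix_2x2_simps = matrix_2x2_eq_iff matrix_matrix_mult_def sum_2 transpose_def mat_def

lemma invertible_transpose: 
  fixes A :: "'a::comm_semiring_1^'n^'n"
  shows "invertible A \<Longrightarrow> invertible (transpose A)"
  unfolding invertible_def by (metis matrix_transpose_mul transpose_mat)

text \<open>The transfer matrix from \<open>m\<close> to \<open>m + 1\<close> is \<open>transfer (m + 1)\<close> evaluated at \<open>q\<close>; the one for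
  \<open>inverse q\<close> is \<open>transfer (- (m + 1))\<close>, again evaluated at \<open>q\<close>.\<close>

definition transfer :: "int \<Rightarrow> laurent^2^2" where
  "transfer n = vector [vector [0, 1],
     vector [- single (0, 3) 1, single (0, 2) 1 + single (0, 1) 1 - single (n, 3) 1]]"

definition transfer_inv :: "int \<Rightarrow> laurent^2^2" where
  "transfer_inv n = vector [vector [single (0, - 1) 1 + single (0, - 2) 1 - single (n, 0) 1, - single (0, - 3) 1],
     vector [1, 0]]"

text \<open>The determinant of \<open>transfer n\<close> is x^3, a unit of the Laurent ring, so the
  inverse has Laurent entries.\<close>

lemma transfer_inverse: "transfer n ** transfer_inv n = mat 1" "transfer_inv n ** transfer n = mat 1"
proof -
  have "(1 :: laurent) = single (0, 0) 1"
    by (simp flip: zero_prod_def)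
  then show "transfer n ** transfer_inv n = mat 1" "transfer_inv n ** transfer n = mat 1"
    by (simp_all add: transfer_def transfer_inv_def matrix_2x2_simps mult_single algebra_simps)
qed

lemma invertible_transfer: "invertible (transfer n)" "invertible (transfer_inv n)"
  unfolding invertible_def using transfer_inverse by blast+

lemma laurent_eval_minus: "laurent_eval (- p) q x = - laurent_eval p q x"
  using laurent_eval_add[of p "- p" q x] by (simp add: add_eq_0_iff2)

lemma laurent_eval_diff: "laurent_eval (p - r) q x = laurent_eval p q x - laurent_eval r q x"
  using laurent_eval_add[of "p - r" r q x] by simp

lemma laurent_eval_1 [simp]: "laurent_eval 1 q x = 1"
  using laurent_eval_single[of 0 0 1 q x] by (simp flip: zero_prod_def)

lemmas laurent_eval_simps = laurent_eval_add laurent_eval_minus laurent_eval_diff laurent_eval_single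

lemma laurent_mat_transfer:
  "laurent_mat (transfer n) q x = vector [vector [0, 1], vector [- (x ^ 3), x\<^sup>2 + x - q powi n * x ^ 3]]"
  by (simp add: matrix_2x2_eq_iff laurent_mat_def transfer_def laurent_eval_simps)

lemma wronskian_transfer:
  assumes "admissible q" "x \<in> generic q"
  shows "wronskian_m q (m + 1) x = laurent_mat (transfer (m + 1)) q x ** wronskian_m q m x"
proof -
  have i: "m + 1 + 1 = m + 2" by simp
  show ?thesis
    unfolding laurent_mat_transfer wronskian_m_def i using block_rec[OF assms, of m]
    by (simp add: matrix_2x2_simps)
qed

lemma wronskian_transfer_inverse:
  assumes "admissible q" "x \<in> generic q"
  shows "wronskian_m (inverse q) (m + 1) x = laurent_mat (transfer (- (m + 1))) q x ** wronskian_m (inverse q) m x"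
proof -
  have "wronskian_m (inverse q) (m + 1) x = laurent_mat (transfer (m + 1)) (inverse q) x ** wronskian_m (inverse q) m x"
    using assms by (intro wronskian_transfer) (simp_all add: admissible_inverse generic_inverse)
  moreover have "laurent_mat (transfer (m + 1)) (inverse q) x = laurent_mat (transfer (- (m + 1))) q x"
    unfolding laurent_mat_transfer by (simp add: power_int_inverse flip: power_int_minus)
  ultimately show ?thesis by simp
qed

lemma det_wronskian_m:
  assumes "admissible q" "x \<in> generic q"
  shows "det (wronskian_m q m x) = x powi (3 * m + 3)"
  using block_wronskian[OF assms, of m] by (simp add: wronskian_m_def det_2)

text \<open>By \<open>block_inverse\<close> the second matrix consists of blocks at indices 1 and 0
  in base q with A and B interchanged. The signature then turns every entry of the product into a
  Casorati determinant of A and B for two of the indices -1, 0, 1, up to a power of x.\<close>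

lemma orthogonality:
  assumes "admissible q" "x \<in> generic q"
  shows "wronskian_m q (-1) x ** signature_mat ** transpose (wronskian_m (inverse q) (-1) x)
    = vector [vector [x powi (-2) + x powi (-1) - 1, 1], vector [1, 0]]"
proof -
  have x: "x \<noteq> 0"
    using assms(2) by (rule generic_nonzero)
  define a b a0 b0 a1 b1 where "a = block_A q (- 1) x" and "b = block_B q (- 1) x"
    and "a0 = block_A q 0 x" and "b0 = block_B q 0 x" and "a1 = block_A q 1 x" and "b1 = block_B q 1 x"
  note ab = this
  have W: "a * b0 - b * a0 = 1"
    using block_wronskian[OF assms, of "- 1"] by (simp add: ab)
  have rec: "a1 = (x\<^sup>2 + x - x ^ 3) * a0 - x ^ 3 * a" "b1 = (x\<^sup>2 + x - x ^ 3) * b0 - x ^ 3 * b"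
    using block_rec[OF assms, of "- 1"] by (simp_all add: ab)
  have inv: "block_A (inverse q) (- 1) x = x powi (- 3) * b1" "block_B (inverse q) (- 1) x = x powi (- 3) * a1"
    "block_A (inverse q) 0 x = b0" "block_B (inverse q) 0 x = a0"
    using block_inverse[OF assms, of "- 1"] block_inverse[OF assms, of 0] by (simp_all add: ab)
  have x3: "x powi (- 3) * x ^ 3 = 1" "x powi (- 3) * (x\<^sup>2 + x - x ^ 3) = x powi (- 2) + x powi (- 1) - 1"
    using x by (simp_all add: power_int_minus field_simps power2_eq_square power3_eq_cube)
  have "a * (x powi (- 3) * b1) - b * (x powi (- 3) * a1) = x powi (- 3) * (x\<^sup>2 + x - x ^ 3) * (a * b0 - b * a0)"
    unfolding rec by (simp add: algebra_simps)
  moreover have "a0 * (x powi (- 3) * b1) - b0 * (x powi (- 3) * a1) = x powi (- 3) * x ^ 3 * (a * b0 - b * a0)"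
    unfolding rec by (simp add: algebra_simps)
  ultimately have e: "a * (x powi (- 3) * b1) - b * (x powi (- 3) * a1) = x powi (- 2) + x powi (- 1) - 1"
    "a0 * (x powi (- 3) * b1) - b0 * (x powi (- 3) * a1) = 1"
    unfolding W x3 by simp_all
  have "- 1 + 1 = (0 :: int)" by simp
  then show ?thesis
    unfolding wronskian_m_def signature_mat_def inv
    using e W by (simp add: matrix_2x2_simps inv flip: ab)
qed

text \<open>From the pair (-1, -1) every other pair is reached by transfer matrices, on the left for
  \<open>m\<close> and transposed on the right for \<open>l\<close>. All are invertible over the
  Laurent ring and do not depend on the values of \<open>q\<close> and \<open>x\<close>.\<close>

lemma unimodular_products:
  "\<exists>G :: laurent^2^2. invertible G \<and> (\<forall>q x. admissible q \<longrightarrow> x \<in> generic q \<longrightarrow>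
     wronskian_m q m x ** signature_mat ** transpose (wronskian_m (inverse q) l x) = laurent_mat G q x)"
proof -
  define P where "P m l \<longleftrightarrow> (\<exists>G :: laurent^2^2. invertible G \<and> (\<forall>q x. admissible q \<longrightarrow> x \<in> generic q \<longrightarrow>
     wronskian_m q m x ** signature_mat ** transpose (wronskian_m (inverse q) l x) = laurent_mat G q x))" for m l
  have nz: "q \<noteq> 0" "x \<noteq> 0" if "admissible q" "x \<in> generic q" for q x
    using that generic_nonzero by (auto simp: admissible_def)
  have inv: "laurent_mat (transfer_inv n) q x ** laurent_mat (transfer n) q x = mat 1" if "admissible q" "x \<in> generic q" for q x n
    unfolding laurent_mat_mult[OF nz[OF that], symmetric] transfer_inverse
    by (simp add: matrix_2x2_eq_iff laurent_mat_def mat_def)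
  have base: "P (- 1) (- 1)"
  proof -
    \<comment> \<open>The matrix of the orthogonality relation has determinant -1, so its inverse
      \<open>G'\<close> again has Laurent entries.\<close>
    define G :: "laurent^2^2" where "G = vector [vector [single (0, - 2) 1 + single (0, - 1) 1 - 1, 1], vector [1, 0]]"
    define G' :: "laurent^2^2" where "G' = vector [vector [0, 1], vector [1, 1 - single (0, - 1) 1 - single (0, - 2) 1]]"
    have "G ** G' = mat 1 \<and> G' ** G = mat 1"
      by (simp add: G_def G'_def matrix_2x2_simps)
    then have "invertible G"
      unfolding invertible_def by blast
    moreover have "laurent_mat G q x = vector [vector [x powi (-2) + x powi (-1) - 1, 1], vector [1, 0]]" for q x
      by (simp add: matrix_2x2_eq_iff laurent_mat_def G_def laurent_eval_simps)
    ultimately show ?thesis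
      unfolding P_def using orthogonality by metis
  qed
  have left: "P m' l" if P: "P m l" and H: "invertible H"
    and w: "\<And>q x. admissible q \<Longrightarrow> x \<in> generic q \<Longrightarrow> wronskian_m q m' x = laurent_mat H q x ** wronskian_m q m x" for m m' l H
  proof -
    obtain G where G: "invertible G" "\<And>q x. admissible q \<Longrightarrow> x \<in> generic q \<Longrightarrow>
       wronskian_m q m x ** signature_mat ** transpose (wronskian_m (inverse q) l x) = laurent_mat G q x"
      using P unfolding P_def by blast
    have "wronskian_m q m' x ** signature_mat ** transpose (wronskian_m (inverse q) l x) = laurent_mat (H ** G) q x"
      if "admissible q" "x \<in> generic q" for q x
      unfolding laurent_mat_mult[OF nz[OF that]] G(2)[OF that, symmetric] w[OF that] by (simp add: matrix_mul_assoc)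
    then show ?thesis
      unfolding P_def using invertible_mult[OF H G(1)] by blast
  qed
  have right: "P m l'" if P: "P m l" and H: "invertible H"
    and w: "\<And>q x. admissible q \<Longrightarrow> x \<in> generic q \<Longrightarrow>
       wronskian_m (inverse q) l' x = laurent_mat H q x ** wronskian_m (inverse q) l x" for m l l' H
  proof -
    obtain G where G: "invertible G" "\<And>q x. admissible q \<Longrightarrow> x \<in> generic q \<Longrightarrow>
       wronskian_m q m x ** signature_mat ** transpose (wronskian_m (inverse q) l x) = laurent_mat G q x"
      using P unfolding P_def by blast
    have "wronskian_m q m x ** signature_mat ** transpose (wronskian_m (inverse q) l' x) = laurent_mat (G ** transpose H) q x"
      if "admissible q" "x \<in> generic q" for q x
      unfolding laurent_mat_mult[OF nz[OF that]] G(2)[OF that, symmetric] w[OF that]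
      by (simp add: matrix_mul_assoc matrix_transpose_mul laurent_mat_transpose)
    then show ?thesis
      unfolding P_def using invertible_mult[OF G(1) invertible_transpose[OF H]] by blast
  qed
  have m: "P m (- 1)" for m
  proof (induction m rule: int_induct[of _ "- 1"])
    case base
    show ?case by fact
  next
    case (step1 m)
    then show ?case
      using left[OF _ invertible_transfer(1) wronskian_transfer] by blast
  next
    case (step2 m)
    have "wronskian_m q (m - 1) x = laurent_mat (transfer_inv m) q x ** wronskian_m q m x"
      if "admissible q" "x \<in> generic q" for q x
      using wronskian_transfer[OF that, of "m - 1"] inv[OF that, of m] by (simp add: matrix_mul_assoc)
    then show ?case
      using left[OF step2(2) invertible_transfer(2)] by blast
  qed
  have "P m l"
  proof (induction l rule: int_induct[of _ "- 1"])
    case base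
    show ?case by (rule m)
  next
    case (step1 l)
    then show ?case
      using right[OF _ invertible_transfer(1) wronskian_transfer_inverse] by blast
  next
    case (step2 l)
    have "wronskian_m (inverse q) (l - 1) x = laurent_mat (transfer_inv (- l)) q x ** wronskian_m (inverse q) l x"
      if "admissible q" "x \<in> generic q" for q x
      using wronskian_transfer_inverse[OF that, of "l - 1"] inv[OF that, of "- l"] by (simp add: matrix_mul_assoc)
    then show ?case
      using right[OF step2(2) invertible_transfer(2)] by blast
  qed
  then show ?thesis
    unfolding P_def .
qed

theorem theorem16:
  shows
    "(q_holonomic block_A \<and> q_holonomic block_B \<and>
      annihilator block_A = ideal_41 \<and> annihilator block_B = ideal_41 \<and>
      has_rank ideal_41 2 \<and>
      (\<forall>q. admissible q \<longrightarrow>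
         basis_of_solutions q {(1, 0), (0, 1)} {first_op, B_hat} (block_A q) (block_B q))) \<and>
     (\<forall>q. admissible q \<longrightarrow>
         basis_of_solutions q {(0, 1)} {B_hat} (block_A q) (block_B q)) \<and>
     (\<forall>q m. admissible q \<longrightarrow>
         (\<forall>\<^sub>\<approx>x\<in>-{0}. det (wronskian_m q m x) = x powi (3 * m + 3))) \<and>
     (\<forall>q. admissible q \<longrightarrow>
         (\<forall>\<^sub>\<approx>x\<in>-{0}.
            wronskian_m q (-1) x ** signature_mat ** transpose (wronskian_m (inverse q) (-1) x)
              = vector [vector [x powi (-2) + x powi (-1) - 1, 1], vector [1, 0]])) \<and>
     (\<forall>m l. \<exists>G :: laurent^2^2. invertible G \<and>
         (\<forall>q. admissible q \<longrightarrow>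
            (\<forall>\<^sub>\<approx>x\<in>-{0}.
               wronskian_m q m x ** signature_mat ** transpose (wronskian_m (inverse q) l x)
                 = (\<chi> i j. laurent_eval (G $ i $ j) q x)))) \<and>
     (\<forall>q. admissible q \<longrightarrow>
         basis_of_solutions q {(1, 0)} {A_hat} (block_A q) (block_B q)) \<and>
     (\<forall>q m. admissible q \<longrightarrow>
         (\<forall>\<^sub>\<approx>x\<in>-{0}. det (wronskian_x q m x)
                       = q powi m * x powi (3 * m) * (1 - q powi (m + 1) * x\<^sup>2)))"
proof (intro conjI allI impI)
  show "q_holonomic block_A" "q_holonomic block_B"
    by (rule block_A.q_holonomic block_B.q_holonomic)+
  show "annihilator block_A = ideal_41" "annihilator block_B = ideal_41"
    by (rule block_A.annihilator_eq block_B.annihilator_eq)+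
  show "has_rank ideal_41 2"
    by (rule block_A.rank_ideal)
next
  fix m l :: int
  obtain G :: "laurent^2^2" where G: "invertible G" "\<And>q x. admissible q \<Longrightarrow> x \<in> generic q \<Longrightarrow>
     wronskian_m q m x ** signature_mat ** transpose (wronskian_m (inverse q) l x) = laurent_mat G q x"
    using unimodular_products by blast
  show "\<exists>G :: laurent^2^2. invertible G \<and>
         (\<forall>q. admissible q \<longrightarrow>
            (\<forall>\<^sub>\<approx>x\<in>-{0}.
               wronskian_m q m x ** signature_mat ** transpose (wronskian_m (inverse q) l x)
                 = (\<chi> i j. laurent_eval (G $ i $ j) q x)))"
    using G by (intro exI[of _ G] conjI allI impI eventually_mono[OF eventually_generic]) (simp_all add: laurent_mat_def)
next
  fix q :: complex
  assume q: "admissible q"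
  note gen = eventually_mono[OF eventually_generic[OF q]]
  show "basis_of_solutions q {(1, 0), (0, 1)} {first_op, B_hat} (block_A q) (block_B q)"
    "basis_of_solutions q {(0, 1)} {B_hat} (block_A q) (block_B q)"
    "basis_of_solutions q {(1, 0)} {A_hat} (block_A q) (block_B q)"
    by (rule basis_ideal[OF q] basis_B_hat[OF q] basis_A_hat[OF q])+
  show "\<forall>\<^sub>\<approx>x\<in>-{0}. wronskian_m q (-1) x ** signature_mat ** transpose (wronskian_m (inverse q) (-1) x)
              = vector [vector [x powi (-2) + x powi (-1) - 1, 1], vector [1, 0]]"
    by (rule gen) (rule orthogonality[OF q])
  fix m :: int
  show "\<forall>\<^sub>\<approx>x\<in>-{0}. det (wronskian_m q m x) = x powi (3 * m + 3)"
    by (rule gen) (rule det_wronskian_m[OF q])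
  show "\<forall>\<^sub>\<approx>x\<in>-{0}. det (wronskian_x q m x) = q powi m * x powi (3 * m) * (1 - q powi (m + 1) * x\<^sup>2)"
    by (rule gen) (use det_wronskian_x[OF q] in \<open>simp add: wronskian_x_def det_2\<close>)
qed

end
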